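(* Let $R$ be a commutative ring with unit and let $A$ be a commutative $R$-algebra with injective structure map $R\to A$. Then the differential graded algebra $(\Omega^*(A),d)$ of non-commutative differential forms on $A$, with cup-one products inherited from $T^*(A)$, is a $\cup_1$-dga.
   Context: For $n\ge0$ let $T^n(A)$ be the $(n+1)$-fold tensor product $A\otimes_R\cdots\otimes_R A$. Then $T^*(A)=\bigoplus_nT^n(A)$ is an $R$-dga with $(a_0\otimes\cdots\otimes a_n)\cup(b_0\otimes\cdots\otimes b_m)=a_0\otimes\cdots\otimes a_{n-1}\otimes a_nb_0\otimes b_1\otimes\cdots\otimes b_m$ and differential $D(a_0\otimes\cdots\otimes a_n)=\sum_{i=0}^{n+1}(-1)^i a_0\otimes\cdots\otimes a_{i-1}\otimes1\otimes a_i\otimes\cdots\otimes a_n$. Set $\Omega^0(A)=A$, let $\Omega^1(A)$ be the kernel of the multiplication map $A\otimes_RA\to A$ (an $A$-bimodule), and let $\Omega^n(A)=\Omega^1(A)\otimes_A\cdots\otimes_A\Omega^1(A)$ ($n$ factors), viewed inside $T^n(A)$. $\Omega^*(A)=\bigoplus_n\Omega^n(A)$ inherits the dga structure of $T^*(A)$, with differential $d$; elements of $\Omega^n(A)$ are linear combinations of forms $a_0\,da_1\cdots da_n$ and $d(a_0da_1\cdots da_n)=da_0da_1\cdots da_n$. The cup-one product on $T^*(A)$ is $$(a_0\otimes\cdots\otimes a_p)\cup_1(b_0\otimes\cdots\otimes b_q)=\sum_{i=0}^{p-1}(-1)^{(p-i)(q+1)}a_0\otimes\cdots\otimes a_{i-1}\otimes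 a_ib_0\otimes b_1\otimes\cdots\otimes b_{q-1}\otimes b_qa_{i+1}\otimes a_{i+2}\otimes\cdots\otimes a_p,$$ so $(a_0\otimes a_1)\cup_1(b_0\otimes b_1)=a_0b_0\otimes b_1a_1$; it restricts to $\Omega^*(A)$. Graded $R$-algebras $B=\bigoplus_{i\ge0}B^i$ are associative and unital, with injective structure map $R\to B$, so that $R\subset B^0$; the product is denoted $a\cup b$. A differential graded $R$-algebra (dga) is a graded $R$-algebra with an $R$-linear degree $1$ map $d$ with $d^2=0$ and $d(a\cup b)=da\cup b+(-1)^{|a|}a\cup db$ for homogeneous $a,b$. $D^2(B)\subseteq B^2$ is the $R$-submodule spanned by all $a\cup b$ with $a,b\in B^1$. A graded algebra with cup-one products is a graded $R$-algebra $B$ with $R$-linear maps $\cup_1\colon B^p\otimes_R B^1\to B^p$ for $p=1,2$ such that (i) $(a\cup b)\cup_1 c=a\cup(b\cup_1 c)+(a\cup_1 c)\cup b$ for all $a,b,c\in B^1$; (ii) the $R$-module $R\oplus B^1$, with multiplication $(r+a)(s+b)=rs+(rb+sa+a\cup_1 b)$, is a commutative ring. A $\cup_1$-dga is a differential graded $R$-algebra $(B,d)$ such that $B$ is a graded algebra with cup-one products, there is an $R$-linear map $\circ\colon D^2(B)\otimes_R D^2(B)\to D^2(B)$ with $(u\cup v)\circ(w\cup z)=(u\cup_1 w)\cup(v\cup_1 z)$ for all $u,v,w,z\in B^1$, and $d(a\cup_1 b)=-a\cup b-b\cup a+da\cup_1 b+db\cup_1 a-da\circ db$ for all $a,b\in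 B^1$ with $da,db\in D^2(B)$. *)

theory Defs
  imports "HOL.Hull" "HOL-Algebra.Module" "HOL-Algebra.AbelCoset"
begin

section \<open>Linear algebra over a commutative ring\<close>

definition linear_map ::
  "('r, 'm) ring_scheme \<Rightarrow> ('r, 'b, 'n) module_scheme \<Rightarrow> ('r, 'c, 'k) module_scheme \<Rightarrow> ('b \<Rightarrow> 'c) \<Rightarrow> bool"
  where "linear_map R M N h \<longleftrightarrow>
    h \<in> carrier M \<rightarrow> carrier N \<and>
    (\<forall>x\<in>carrier M. \<forall>y\<in>carrier M. h (x \<oplus>\<^bsub>M\<^esub> y) = h x \<oplus>\<^bsub>N\<^esub> h y) \<and>
    (\<forall>r\<in>carrier R. \<forall>x\<in>carrier M. h (r \<odot>\<^bsub>M\<^esub> x) = r \<odot>\<^bsub>N\<^esub> h x)"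

text \<open>Linear maps out of a tensor product of two modules are rendered as bilinear maps.\<close>

definition bilinear_map ::
  "('r, 'm) ring_scheme \<Rightarrow> ('r, 'b, 'n) module_scheme \<Rightarrow> ('r, 'c, 'k) module_scheme \<Rightarrow>
    ('r, 'd, 'l) module_scheme \<Rightarrow> ('b \<Rightarrow> 'c \<Rightarrow> 'd) \<Rightarrow> bool"
  where "bilinear_map R M N P f \<longleftrightarrow>
    (\<forall>x\<in>carrier M. linear_map R N P (f x)) \<and>
    (\<forall>y\<in>carrier N. linear_map R M P (\<lambda>x. f x y))"

definition submod_span :: "('r, 'm) ring_scheme \<Rightarrow> ('r, 'b, 'n) module_scheme \<Rightarrow> 'b set \<Rightarrow> 'b set"
  where "submod_span R M S = (\<lambda>N. submodule N R M) hull S"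

definition sgn_pow :: "('r, 'm) ring_scheme \<Rightarrow> nat \<Rightarrow> 'r"
  where "sgn_pow R n = (\<ominus>\<^bsub>R\<^esub> \<one>\<^bsub>R\<^esub>) [^]\<^bsub>R\<^esub> n"


section \<open>Differential graded algebras with cup-one products\<close>

text \<open>
  A graded algebra is given by the family \<open>B\<close> of its homogeneous components.  Only the module
  structure of \<open>B n\<close> is used; the fields \<open>mult\<close> and \<open>one\<close> of the record type are ignored.
  Degrees are passed explicitly: \<open>cup p q\<close> is the product of elements of degrees \<open>p\<close> and \<open>q\<close>.
\<close>

locale graded_algebra = cring R
  for R :: "('r, 'm) ring_scheme" (structure) +
  fixes B :: "nat \<Rightarrow> ('r, 'b) module"
    and cup :: "nat \<Rightarrow> nat \<Rightarrow> 'b \<Rightarrow> 'b \<Rightarrow> 'b"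
    and unity :: 'b
  assumes component_module: "module R (B n)"
    and cup_bilinear: "bilinear_map R (B p) (B q) (B (p + q)) (cup p q)"
    and cup_assoc: "\<lbrakk>a \<in> carrier (B p); b \<in> carrier (B q); c \<in> carrier (B s)\<rbrakk> \<Longrightarrow>
      cup (p + q) s (cup p q a b) c = cup p (q + s) a (cup q s b c)"
    and unity_closed: "unity \<in> carrier (B 0)"
    and unity_cup: "a \<in> carrier (B p) \<Longrightarrow> cup 0 p unity a = a"
    and cup_unity: "a \<in> carrier (B p) \<Longrightarrow> cup p 0 a unity = a"
    and structure_map_inj: "inj_on (\<lambda>r. r \<odot>\<^bsub>B 0\<^esub> unity) (carrier R)"

locale dg_algebra = graded_algebra R B cup unity
  for R :: "('r, 'm) ring_scheme" (structure)
    and B :: "nat \<Rightarrow> ('r, 'b) module"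
    and cup :: "nat \<Rightarrow> nat \<Rightarrow> 'b \<Rightarrow> 'b \<Rightarrow> 'b"
    and unity :: 'b +
  fixes d :: "nat \<Rightarrow> 'b \<Rightarrow> 'b"
  assumes d_linear: "linear_map R (B n) (B (n + 1)) (d n)"
    and d_d: "a \<in> carrier (B n) \<Longrightarrow> d (n + 1) (d n a) = \<zero>\<^bsub>B (n + 2)\<^esub>"
    and leibniz: "\<lbrakk>a \<in> carrier (B p); b \<in> carrier (B q)\<rbrakk> \<Longrightarrow>
      d (p + q) (cup p q a b) =
        cup (p + 1) q (d p a) b \<oplus>\<^bsub>B (p + q + 1)\<^esub>
        sgn_pow R p \<odot>\<^bsub>B (p + q + 1)\<^esub> cup p (q + 1) a (d q b)"

text \<open>The module \<open>R \<oplus> B\<^sup>1\<close> with multiplication \<open>(r + a)(s + b) = rs + (rb + sa + a \<union>\<^sub>1 b)\<close>.\<close>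

definition cup1_extension ::
  "('r, 'm) ring_scheme \<Rightarrow> ('r, 'b, 'n) module_scheme \<Rightarrow> ('b \<Rightarrow> 'b \<Rightarrow> 'b) \<Rightarrow> ('r \<times> 'b) ring"
  where "cup1_extension R M m =
    \<lparr>carrier = carrier R \<times> carrier M,
     mult = (\<lambda>(r, a) (s, b). (r \<otimes>\<^bsub>R\<^esub> s, r \<odot>\<^bsub>M\<^esub> b \<oplus>\<^bsub>M\<^esub> s \<odot>\<^bsub>M\<^esub> a \<oplus>\<^bsub>M\<^esub> m a b)),
     one = (\<one>\<^bsub>R\<^esub>, \<zero>\<^bsub>M\<^esub>),
     zero = (\<zero>\<^bsub>R\<^esub>, \<zero>\<^bsub>M\<^esub>),
     add = (\<lambda>(r, a) (s, b). (r \<oplus>\<^bsub>R\<^esub> s, a \<oplus>\<^bsub>M\<^esub> b))\<rparr>"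

text \<open>\<open>cup1 p\<close> is the map \<open>B\<^sup>p \<otimes> B\<^sup>1 \<rightarrow> B\<^sup>p\<close>; it is constrained only for \<open>p = 1, 2\<close>.\<close>

locale cup1_algebra = graded_algebra R B cup unity
  for R :: "('r, 'm) ring_scheme" (structure)
    and B :: "nat \<Rightarrow> ('r, 'b) module"
    and cup :: "nat \<Rightarrow> nat \<Rightarrow> 'b \<Rightarrow> 'b \<Rightarrow> 'b"
    and unity :: 'b +
  fixes cup1 :: "nat \<Rightarrow> 'b \<Rightarrow> 'b \<Rightarrow> 'b"
  assumes cup1_bilinear: "p \<in> {1, 2} \<Longrightarrow> bilinear_map R (B p) (B 1) (B p) (cup1 p)"
    and hirsch: "\<lbrakk>a \<in> carrier (B 1); b \<in> carrier (B 1); c \<in> carrier (B 1)\<rbrakk> \<Longrightarrow>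
      cup1 2 (cup 1 1 a b) c = cup 1 1 a (cup1 1 b c) \<oplus>\<^bsub>B 2\<^esub> cup 1 1 (cup1 1 a c) b"
    and extension_cring: "cring (cup1_extension R (B 1) (cup1 1))"

definition decomposables2 ::
  "('r, 'm) ring_scheme \<Rightarrow> (nat \<Rightarrow> ('r, 'b) module) \<Rightarrow> (nat \<Rightarrow> nat \<Rightarrow> 'b \<Rightarrow> 'b \<Rightarrow> 'b) \<Rightarrow> ('r, 'b) module"
  where "decomposables2 R B cup =
    (B 2)\<lparr>carrier := submod_span R (B 2) {cup 1 1 a b | a b. a \<in> carrier (B 1) \<and> b \<in> carrier (B 1)}\<rparr>"

locale cup1_dg_algebra = dg_algebra R B cup unity d + cup1_algebra R B cup unity cup1
  for R :: "('r, 'm) ring_scheme" (structure)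
    and B :: "nat \<Rightarrow> ('r, 'b) module"
    and cup :: "nat \<Rightarrow> nat \<Rightarrow> 'b \<Rightarrow> 'b \<Rightarrow> 'b"
    and unity :: 'b
    and d :: "nat \<Rightarrow> 'b \<Rightarrow> 'b"
    and cup1 :: "nat \<Rightarrow> 'b \<Rightarrow> 'b \<Rightarrow> 'b" +
  assumes d_cup1: "\<exists>circ.
    bilinear_map R (decomposables2 R B cup) (decomposables2 R B cup) (decomposables2 R B cup) circ \<and>
    (\<forall>u\<in>carrier (B 1). \<forall>v\<in>carrier (B 1). \<forall>w\<in>carrier (B 1). \<forall>z\<in>carrier (B 1).
      circ (cup 1 1 u v) (cup 1 1 w z) = cup 1 1 (cup1 1 u w) (cup1 1 v z)) \<and>
    (\<forall>a\<in>carrier (B 1). \<forall>b\<in>carrier (B 1).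
      d 1 a \<in> carrier (decomposables2 R B cup) \<longrightarrow> d 1 b \<in> carrier (decomposables2 R B cup) \<longrightarrow>
      d 1 (cup1 1 a b) =
        \<ominus>\<^bsub>B 2\<^esub> cup 1 1 a b \<ominus>\<^bsub>B 2\<^esub> cup 1 1 b a
        \<oplus>\<^bsub>B 2\<^esub> cup1 2 (d 1 a) b \<oplus>\<^bsub>B 2\<^esub> cup1 2 (d 1 b) a
        \<ominus>\<^bsub>B 2\<^esub> circ (d 1 a) (d 1 b))"


section \<open>Tensor powers\<close>

text \<open>The free module on \<open>S\<close>: finitely supported functions vanishing outside \<open>S\<close>.
  As before, the fields \<open>mult\<close> and \<open>one\<close> play no role.\<close>

definition free_module :: "('r, 'm) ring_scheme \<Rightarrow> 'i set \<Rightarrow> ('r, 'i \<Rightarrow> 'r) module"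
  where "free_module R S =
    \<lparr>carrier = {f. (\<forall>x. f x \<in> carrier R) \<and> (\<forall>x. x \<notin> S \<longrightarrow> f x = \<zero>\<^bsub>R\<^esub>) \<and> finite {x. f x \<noteq> \<zero>\<^bsub>R\<^esub>}},
     mult = undefined, one = undefined,
     zero = (\<lambda>x. \<zero>\<^bsub>R\<^esub>),
     add = (\<lambda>f g x. f x \<oplus>\<^bsub>R\<^esub> g x),
     smult = (\<lambda>r f x. r \<otimes>\<^bsub>R\<^esub> f x)\<rparr>"

definition free_gen :: "('r, 'm) ring_scheme \<Rightarrow> 'i \<Rightarrow> 'i \<Rightarrow> 'r"
  where "free_gen R x = (\<lambda>y. if y = x then \<one>\<^bsub>R\<^esub> else \<zero>\<^bsub>R\<^esub>)"

definition quot_module :: "('r, 'b, 'n) module_scheme \<Rightarrow> 'b set \<Rightarrow> ('r, 'b set) module"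
  where "quot_module M N =
    \<lparr>carrier = a_rcosets\<^bsub>M\<^esub> N,
     mult = undefined, one = undefined,
     zero = N,
     add = set_add M,
     smult = (\<lambda>r X. \<Union>x\<in>X. N +>\<^bsub>M\<^esub> (r \<odot>\<^bsub>M\<^esub> x))\<rparr>"

text \<open>
  Linear extension of a map \<open>g\<close> on generators, and the map it induces on a quotient of the
  free module.  The latter is meaningful if \<open>g\<close> respects the relations; then the linear
  extension is constant on each coset.
\<close>

definition free_ext ::
  "('r, 'm) ring_scheme \<Rightarrow> ('r, 'c, 'n) module_scheme \<Rightarrow> ('i \<Rightarrow> 'c) \<Rightarrow> ('i \<Rightarrow> 'r) \<Rightarrow> 'c"
  where "free_ext R P g f = (\<Oplus>\<^bsub>P\<^esub>x\<in>{x. f x \<noteq> \<zero>\<^bsub>R\<^esub>}. f x \<odot>\<^bsub>P\<^esub> g x)"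

definition quot_ext ::
  "('r, 'm) ring_scheme \<Rightarrow> ('r, 'c, 'n) module_scheme \<Rightarrow> ('i \<Rightarrow> 'c) \<Rightarrow> ('i \<Rightarrow> 'r) set \<Rightarrow> 'c"
  where "quot_ext R P g X = the_elem (free_ext R P g ` X)"

definition words :: "('r, 'b, 'n) module_scheme \<Rightarrow> nat \<Rightarrow> 'b list set"
  where "words M k = {xs. set xs \<subseteq> carrier M \<and> length xs = k}"

abbreviation free_words ::
  "('r, 'm) ring_scheme \<Rightarrow> nat \<Rightarrow> ('r, 'b, 'n) module_scheme \<Rightarrow> ('r, 'b list \<Rightarrow> 'r) module"
  where "free_words R k M \<equiv> free_module R (words M k)"

definition multilinear_rels ::
  "('r, 'm) ring_scheme \<Rightarrow> nat \<Rightarrow> ('r, 'b, 'n) module_scheme \<Rightarrow> ('b list \<Rightarrow> 'r) set"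
  where "multilinear_rels R k M =
    {free_gen R (xs @ [a \<oplus>\<^bsub>M\<^esub> b] @ ys)
        \<ominus>\<^bsub>free_words R k M\<^esub> free_gen R (xs @ [a] @ ys)
        \<ominus>\<^bsub>free_words R k M\<^esub> free_gen R (xs @ [b] @ ys) | xs ys a b.
      set xs \<subseteq> carrier M \<and> set ys \<subseteq> carrier M \<and> a \<in> carrier M \<and> b \<in> carrier M \<and>
      length xs + length ys + 1 = k} \<union>
    {free_gen R (xs @ [r \<odot>\<^bsub>M\<^esub> a] @ ys)
        \<ominus>\<^bsub>free_words R k M\<^esub> r \<odot>\<^bsub>free_words R k M\<^esub> free_gen R (xs @ [a] @ ys) | xs ys a r.
      set xs \<subseteq> carrier M \<and> set ys \<subseteq> carrier M \<and> a \<in> carrier M \<and> r \<in> carrier R \<and>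
      length xs + length ys + 1 = k}"

text \<open>The \<open>k\<close>-fold tensor product of the module \<open>M\<close> over \<open>R\<close>.\<close>

definition tensor_rels ::
  "('r, 'm) ring_scheme \<Rightarrow> nat \<Rightarrow> ('r, 'b, 'n) module_scheme \<Rightarrow> ('b list \<Rightarrow> 'r) set"
  where "tensor_rels R k M = submod_span R (free_words R k M) (multilinear_rels R k M)"

definition tensor_power ::
  "('r, 'm) ring_scheme \<Rightarrow> nat \<Rightarrow> ('r, 'b, 'n) module_scheme \<Rightarrow> ('r, ('b list \<Rightarrow> 'r) set) module"
  where "tensor_power R k M = quot_module (free_words R k M) (tensor_rels R k M)"

text \<open>
  The \<open>k\<close>-fold tensor product over \<open>A\<close> of an \<open>A\<close>-bimodule \<open>M\<close>, with left action \<open>lact a m\<close>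
  and right action \<open>ract m a\<close>, where \<open>R\<close> acts on \<open>M\<close> through \<open>A\<close> and symmetrically: the
  quotient of the tensor product over \<open>R\<close> by \<open>\<dots> \<otimes> ma \<otimes> m' \<otimes> \<dots> = \<dots> \<otimes> m \<otimes> am' \<otimes> \<dots>\<close>.
\<close>

definition balanced_rels ::
  "('r, 'm) ring_scheme \<Rightarrow> 'a set \<Rightarrow> ('a \<Rightarrow> 'b \<Rightarrow> 'b) \<Rightarrow> ('b \<Rightarrow> 'a \<Rightarrow> 'b) \<Rightarrow>
    nat \<Rightarrow> ('r, 'b, 'n) module_scheme \<Rightarrow> ('b list \<Rightarrow> 'r) set"
  where "balanced_rels R A lact ract k M =
    {free_gen R (xs @ [ract m a, m'] @ ys)
        \<ominus>\<^bsub>free_words R k M\<^esub> free_gen R (xs @ [m, lact a m'] @ ys) | xs ys m m' a.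
      set xs \<subseteq> carrier M \<and> set ys \<subseteq> carrier M \<and> m \<in> carrier M \<and> m' \<in> carrier M \<and> a \<in> A \<and>
      length xs + length ys + 2 = k}"

definition bimod_tensor_power ::
  "('r, 'm) ring_scheme \<Rightarrow> 'a set \<Rightarrow> ('a \<Rightarrow> 'b \<Rightarrow> 'b) \<Rightarrow> ('b \<Rightarrow> 'a \<Rightarrow> 'b) \<Rightarrow>
    nat \<Rightarrow> ('r, 'b, 'n) module_scheme \<Rightarrow> ('r, ('b list \<Rightarrow> 'r) set) module"
  where "bimod_tensor_power R A lact ract k M =
    quot_module (free_words R k M)
      (submod_span R (free_words R k M)
        (multilinear_rels R k M \<union> balanced_rels R A lact ract k M))"


section \<open>The algebra \<open>T\<^sup>*(A)\<close>\<close>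

definition TA ::
  "('r, 'm) ring_scheme \<Rightarrow> ('r, 'a, 'n) module_scheme \<Rightarrow> nat \<Rightarrow> ('r, ('a list \<Rightarrow> 'r) set) module"
  where "TA R A n = tensor_power R (n + 1) A"

text \<open>\<open>TA_pure R A n [a\<^sub>0, \<dots>, a\<^sub>n]\<close> is \<open>a\<^sub>0 \<otimes> \<dots> \<otimes> a\<^sub>n\<close>.  In particular \<open>A\<close> is identified with
  \<open>TA R A 0\<close> via \<open>a \<mapsto> TA_pure R A 0 [a]\<close>.\<close>

definition TA_pure ::
  "('r, 'm) ring_scheme \<Rightarrow> ('r, 'a, 'n) module_scheme \<Rightarrow> nat \<Rightarrow> 'a list \<Rightarrow> ('a list \<Rightarrow> 'r) set"
  where "TA_pure R A n xs = tensor_rels R (n + 1) A +>\<^bsub>free_words R (n + 1) A\<^esub> free_gen R xs"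

definition TA_unity ::
  "('r, 'm) ring_scheme \<Rightarrow> ('r, 'a, 'n) module_scheme \<Rightarrow> ('a list \<Rightarrow> 'r) set"
  where "TA_unity R A = TA_pure R A 0 [\<one>\<^bsub>A\<^esub>]"

definition cup_word :: "('r, 'a, 'n) module_scheme \<Rightarrow> 'a list \<Rightarrow> 'a list \<Rightarrow> 'a list"
  where "cup_word A xs ys = butlast xs @ [last xs \<otimes>\<^bsub>A\<^esub> hd ys] @ tl ys"

definition TA_cup ::
  "('r, 'm) ring_scheme \<Rightarrow> ('r, 'a, 'n) module_scheme \<Rightarrow> nat \<Rightarrow> nat \<Rightarrow>
    ('a list \<Rightarrow> 'r) set \<Rightarrow> ('a list \<Rightarrow> 'r) set \<Rightarrow> ('a list \<Rightarrow> 'r) set"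
  where "TA_cup R A p q X Y =
    quot_ext R (TA R A (p + q)) (\<lambda>xs.
      quot_ext R (TA R A (p + q)) (\<lambda>ys. TA_pure R A (p + q) (cup_word A xs ys)) Y) X"

definition TA_diff ::
  "('r, 'm) ring_scheme \<Rightarrow> ('r, 'a, 'n) module_scheme \<Rightarrow> nat \<Rightarrow>
    ('a list \<Rightarrow> 'r) set \<Rightarrow> ('a list \<Rightarrow> 'r) set"
  where "TA_diff R A n =
    quot_ext R (TA R A (n + 1)) (\<lambda>xs.
      \<Oplus>\<^bsub>TA R A (n + 1)\<^esub>i\<in>{0..n + 1}.
        sgn_pow R i \<odot>\<^bsub>TA R A (n + 1)\<^esub> TA_pure R A (n + 1) (take i xs @ [\<one>\<^bsub>A\<^esub>] @ drop i xs))"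

text \<open>
  For words \<open>a = [a\<^sub>0, \<dots>, a\<^sub>p]\<close> and \<open>b = [b\<^sub>0, \<dots>, b\<^sub>q]\<close>, the \<open>i\<close>-th summand of \<open>a \<union>\<^sub>1 b\<close> is
  \<open>(a\<^sub>0 \<otimes> \<dots> \<otimes> a\<^sub>i) \<union> b \<union> (a\<^sub>i\<^sub>+\<^sub>1 \<otimes> \<dots> \<otimes> a\<^sub>p)\<close>, that is,
  \<open>a\<^sub>0 \<otimes> \<dots> \<otimes> a\<^sub>i b\<^sub>0 \<otimes> b\<^sub>1 \<otimes> \<dots> \<otimes> b\<^sub>q a\<^sub>i\<^sub>+\<^sub>1 \<otimes> \<dots> \<otimes> a\<^sub>p\<close>.
\<close>

definition TA_cup1 ::
  "('r, 'm) ring_scheme \<Rightarrow> ('r, 'a, 'n) module_scheme \<Rightarrow> nat \<Rightarrow> nat \<Rightarrow>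
    ('a list \<Rightarrow> 'r) set \<Rightarrow> ('a list \<Rightarrow> 'r) set \<Rightarrow> ('a list \<Rightarrow> 'r) set"
  where "TA_cup1 R A p q X Y =
    quot_ext R (TA R A (p + q - 1)) (\<lambda>xs.
      quot_ext R (TA R A (p + q - 1)) (\<lambda>ys.
        \<Oplus>\<^bsub>TA R A (p + q - 1)\<^esub>i\<in>{0..<p}.
          sgn_pow R ((p - i) * (q + 1)) \<odot>\<^bsub>TA R A (p + q - 1)\<^esub>
          TA_pure R A (p + q - 1)
            (cup_word A (cup_word A (take (i + 1) xs) ys) (drop (i + 1) xs))) Y) X"


section \<open>Non-commutative differential forms\<close>

definition mult_map ::
  "('r, 'm) ring_scheme \<Rightarrow> ('r, 'a, 'n) module_scheme \<Rightarrow> ('a list \<Rightarrow> 'r) set \<Rightarrow> 'a"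
  where "mult_map R A = quot_ext R A (\<lambda>xs. xs ! 0 \<otimes>\<^bsub>A\<^esub> xs ! 1)"

definition Omega1 ::
  "('r, 'm) ring_scheme \<Rightarrow> ('r, 'a, 'n) module_scheme \<Rightarrow> ('r, ('a list \<Rightarrow> 'r) set) module"
  where "Omega1 R A = (TA R A 1)\<lparr>carrier := a_kernel (TA R A 1) A (mult_map R A)\<rparr>"

text \<open>\<open>\<Omega>\<^sup>1(A) \<otimes>\<^sub>A \<dots> \<otimes>\<^sub>A \<Omega>\<^sup>1(A)\<close> with \<open>n\<close> factors.  The bimodule structure of \<open>A \<otimes>\<^sub>R A\<close>,
  \<open>c (a \<otimes> b) = ca \<otimes> b\<close> and \<open>(a \<otimes> b) c = a \<otimes> bc\<close>, is given by cup products with degree \<open>0\<close>.\<close>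

definition Omega1_power ::
  "('r, 'm) ring_scheme \<Rightarrow> ('r, 'a, 'n) module_scheme \<Rightarrow> nat \<Rightarrow>
    ('r, (('a list \<Rightarrow> 'r) set list \<Rightarrow> 'r) set) module"
  where "Omega1_power R A n =
    bimod_tensor_power R (carrier A)
      (\<lambda>a w. TA_cup R A 0 1 (TA_pure R A 0 [a]) w)
      (\<lambda>w a. TA_cup R A 1 0 w (TA_pure R A 0 [a]))
      n (Omega1 R A)"

text \<open>
  \<open>\<Omega>\<^sup>n(A)\<close> is viewed inside \<open>T\<^sup>n(A)\<close> via the canonical map
  \<open>w\<^sub>1 \<otimes> \<dots> \<otimes> w\<^sub>n \<mapsto> w\<^sub>1 \<union> \<dots> \<union> w\<^sub>n\<close>, i.e. the \<open>n\<close>-fold tensor power over \<open>A\<close> of the inclusion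
  \<open>\<Omega>\<^sup>1(A) \<subseteq> A \<otimes>\<^sub>R A\<close>.  It is injective because this inclusion splits both as a map of left and
  as a map of right \<open>A\<close>-modules.
\<close>

primrec form_prod ::
  "('r, 'm) ring_scheme \<Rightarrow> ('r, 'a, 'n) module_scheme \<Rightarrow> ('a list \<Rightarrow> 'r) set list \<Rightarrow>
    ('a list \<Rightarrow> 'r) set"
  where
    "form_prod R A [] = TA_unity R A"
  | "form_prod R A (w # ws) = TA_cup R A 1 (length ws) w (form_prod R A ws)"

definition Omega_incl ::
  "('r, 'm) ring_scheme \<Rightarrow> ('r, 'a, 'n) module_scheme \<Rightarrow> nat \<Rightarrow>
    (('a list \<Rightarrow> 'r) set list \<Rightarrow> 'r) set \<Rightarrow> ('a list \<Rightarrow> 'r) set"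
  where "Omega_incl R A n = quot_ext R (TA R A n) (form_prod R A)"

definition Omega ::
  "('r, 'm) ring_scheme \<Rightarrow> ('r, 'a, 'n) module_scheme \<Rightarrow> nat \<Rightarrow> ('r, ('a list \<Rightarrow> 'r) set) module"
  where "Omega R A n =
    (TA R A n)\<lparr>carrier :=
      (if n = 0 then carrier (TA R A 0) else Omega_incl R A n ` carrier (Omega1_power R A n))\<rparr>"

end

theory Submission
  imports Defs
begin

text \<open>
  All identities are proved on the whole of \<open>T\<^sup>*(A)\<close>, and \<open>\<Omega>\<^sup>*(A)\<close> is then shown to be closed
  under the operations.  A multilinear function of words extends uniquely to a linear map on
  \<open>T\<^sup>n(A)\<close>, so operations may be defined, and identities between multilinear expressions checked, on
  pure tensors \<open>a\<^sub>0 \<otimes> \<dots> \<otimes> a\<^sub>n\<close> (\<open>T_ext2\<close>, \<open>linear_T_eqI\<close>, \<open>bilinear_T_eqI\<close>).  Associativity of the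
  cup product, the Hirsch identity and the commutativity and associativity of \<open>\<union>\<^sub>1\<close> in degree \<open>1\<close>
  thus become computations with words.  In the Leibniz rule (\<open>leibniz\<close>) the summands in which a unit
  is inserted at the junction of the two words cancel; all others match.  Since
  \<open>a\<^sub>0 \<otimes> \<dots> \<otimes> a\<^sub>n = (a\<^sub>0 \<otimes> 1) \<union> (a\<^sub>1 \<otimes> \<dots> \<otimes> a\<^sub>n)\<close>, the Leibniz rule reduces \<open>d\<^sup>2 = 0\<close> to the tensors \<open>a\<close> and
  \<open>a \<otimes> 1\<close> (\<open>diff_diff\<close>).

  The map \<open>\<circ>\<close> is the letterwise product
  \<open>(a\<^sub>0 \<otimes> a\<^sub>1 \<otimes> a\<^sub>2) \<circ> (b\<^sub>0 \<otimes> b\<^sub>1 \<otimes> b\<^sub>2) = a\<^sub>0b\<^sub>0 \<otimes> a\<^sub>1b\<^sub>1 \<otimes> a\<^sub>2b\<^sub>2\<close> on \<open>T\<^sup>2(A)\<close>.  As \<open>A\<close> is commutative, it satisfies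
  \<open>(u \<union> v) \<circ> (w \<union> z) = (u \<union>\<^sub>1 w) \<union> (v \<union>\<^sub>1 z)\<close> (\<open>T_circ_cup\<close>), and with it the formula for \<open>d(a \<union>\<^sub>1 b)\<close> holds
  for all \<open>a\<close> and \<open>b\<close> in \<open>T\<^sup>1(A)\<close> (\<open>diff_cup1\<close>).

  For the closure, \<open>\<Omega>\<^sup>n(A)\<close> with \<open>n > 0\<close> is spanned by the products \<open>w\<^sub>1 \<union> \<dots> \<union> w\<^sub>n\<close> with \<open>w\<^sub>i\<close> in
  \<open>\<Omega>\<^sup>1(A)\<close> (\<open>Omega_incl_image\<close>).  It is closed under cup products because \<open>\<Omega>\<^sup>1(A)\<close> is a sub-bimodule of
  \<open>A \<otimes> A\<close>, and under \<open>d\<close> because of the Leibniz rule and \<open>d \<Omega>\<^sup>1(A) \<subseteq> \<Omega>\<^sup>2(A)\<close> (\<open>diff_Omega_one\<close>): the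
  linear map \<open>a \<otimes> b \<mapsto> a \<otimes> b - ab \<otimes> 1 = a db\<close> fixes \<open>\<Omega>\<^sup>1(A)\<close>, and \<open>d(a db) = da \<union> db\<close>.  The
  multiplication map carries \<open>\<union>\<^sub>1\<close> on \<open>T\<^sup>1(A)\<close> to the product of \<open>A\<close>, so its kernel \<open>\<Omega>\<^sup>1(A)\<close> is closed
  under \<open>\<union>\<^sub>1\<close>; the Hirsch identity and the formula for \<open>\<circ>\<close> carry this over to \<open>\<Omega>\<^sup>2(A)\<close>.  Finally,
  \<open>\<Omega>\<^sup>2(A)\<close> is spanned by products of elements of degree \<open>1\<close>, so it equals its own submodule of
  decomposables and \<open>\<circ>\<close> is defined exactly where it is required (\<open>decomposables2_Omega\<close>).
\<close>


section \<open>Cancellation and finite sums in abelian groups\<close>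

lemma (in abelian_group) minus_eq_zeroD:
  assumes "x \<in> carrier G" "y \<in> carrier G" "x \<ominus> y = \<zero>"
  shows "x = y"
  using minus_equality[of x "\<ominus> y"] assms by (simp add: a_minus_def)

lemma (in abelian_group) minus_minus_eq:
  assumes "x \<in> carrier G" "y \<in> carrier G" "z \<in> carrier G"
  shows "x \<ominus> y \<ominus> z = x \<ominus> (y \<oplus> z)"
  using assms by (simp add: a_minus_def minus_add a_assoc)

lemma (in abelian_monoid) finsum_split:
  fixes f :: "nat \<Rightarrow> 'a" and p q :: nat
  assumes "\<And>i. f i \<in> carrier G"
  shows "(\<Oplus>i\<in>{..p + 1 + q}. f i) = (\<Oplus>i\<in>{..p}. f i) \<oplus> (\<Oplus>j\<in>{..q}. f (p + 1 + j))"
proof (induction q)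
  case 0
  then show ?case using assms by (simp add: finsum_Suc Pi_def a_comm)
next
  case (Suc q)
  have "(\<Oplus>i\<in>{..p + 1 + Suc q}. f i) = f (p + 1 + Suc q) \<oplus> (\<Oplus>i\<in>{..p + 1 + q}. f i)"
    using assms finsum_Suc[of f "p + 1 + q"] by simp
  then show ?case
    unfolding Suc.IH using assms by (simp add: finsum_Suc Pi_def a_lcomm)
qed

lemma (in abelian_monoid) finsum_upto_small:
  assumes "\<And>i. f i \<in> carrier G"
  shows "(\<Oplus>i\<in>{0..0 + 1::nat}. f i) = f 0 \<oplus> f 1"
    and "(\<Oplus>i\<in>{0..1 + 1::nat}. f i) = f 0 \<oplus> f 1 \<oplus> f 2"
    and "(\<Oplus>i\<in>{0..2 + 1::nat}. f i) = f 0 \<oplus> f 1 \<oplus> f 2 \<oplus> f 3"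
  using assms by (simp_all add: atLeast0AtMost numeral_2_eq_2 numeral_3_eq_3 finsum_Suc Pi_def a_ac)

lemma (in abelian_group) add_minus_add_cancel:
  assumes "a \<in> carrier G" "b \<in> carrier G" "d \<in> carrier G"
  shows "(a \<oplus> d) \<ominus> (b \<oplus> d) = a \<ominus> b"
proof -
  have "(a \<oplus> d) \<ominus> (b \<oplus> d) = (a \<oplus> d) \<ominus> d \<ominus> b"
    using assms by (simp add: minus_minus_eq a_comm[of b d])
  also have "(a \<oplus> d) \<ominus> d = a"
    using assms by (simp add: a_minus_def a_assoc r_neg)
  finally show ?thesis .
qed

lemma (in abelian_group) add_neg_add_cancel:
  assumes "s \<in> carrier G" "u \<in> carrier G" "e \<in> carrier G"
  shows "s \<oplus> u = s \<oplus> \<ominus> e \<oplus> (u \<oplus> e)"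
proof -
  have "s \<oplus> \<ominus> e \<oplus> (u \<oplus> e) = s \<oplus> u \<oplus> (e \<oplus> \<ominus> e)"
    using assms by (simp add: a_ac)
  then show ?thesis using assms by (simp add: r_neg)
qed

lemma (in abelian_group) diff_eq_diffI:
  assumes "a \<in> carrier G" "b \<in> carrier G" "c \<in> carrier G" "d \<in> carrier G" "a \<oplus> d = c \<oplus> b"
  shows "a \<ominus> b = c \<ominus> d"
proof -
  have "a \<ominus> b = (a \<oplus> d) \<ominus> (b \<oplus> d)"
    by (rule add_minus_add_cancel[symmetric]) (rule assms)+
  also have "\<dots> = (c \<oplus> b) \<ominus> (d \<oplus> b)"
    using assms(2,4) by (simp add: assms(5) a_comm[of b d])
  also have "\<dots> = c \<ominus> d"
    by (rule add_minus_add_cancel) (rule assms)+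
  finally show ?thesis .
qed

text \<open>The cancellation in \<open>-a \<union> b - b \<union> a + da \<union>\<^sub>1 b + db \<union>\<^sub>1 a - da \<circ> db\<close> for \<open>a = a\<^sub>0 \<otimes> a\<^sub>1\<close> and
  \<open>b = b\<^sub>0 \<otimes> b\<^sub>1\<close>.  Here \<open>x1, x2, x3\<close> are the summands of \<open>d(a\<^sub>0b\<^sub>0 \<otimes> a\<^sub>1b\<^sub>1)\<close>, ordered by the position of
  the inserted unit, \<open>m1\<close> is \<open>b \<union> a\<close>, \<open>m2\<close> is \<open>a \<union> b\<close>, and the \<open>p\<close>'s cancel between the last three
  expressions.\<close>

lemma (in abelian_group) cup1_cancellation:
  assumes "x1 \<in> carrier G" "x2 \<in> carrier G" "x3 \<in> carrier G" "m1 \<in> carrier G" "m2 \<in> carrier G"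
    "p1 \<in> carrier G" "p2 \<in> carrier G" "p3 \<in> carrier G" "p4 \<in> carrier G"
  shows "x1 \<ominus> x2 \<oplus> x3 = \<ominus> m2 \<ominus> m1 \<oplus> ((m1 \<oplus> x1) \<ominus> (p1 \<oplus> p2) \<oplus> (x3 \<oplus> m2))
    \<oplus> ((m2 \<oplus> x1) \<ominus> (p3 \<oplus> p4) \<oplus> (x3 \<oplus> m1))
    \<ominus> ((x1 \<ominus> p4 \<oplus> m1) \<ominus> (p2 \<ominus> x2 \<oplus> p1) \<oplus> (m2 \<ominus> p3 \<oplus> x3))" (is "_ = ?rhs")
proof -
  let ?c = "m1 \<oplus> x1 \<oplus> x3 \<oplus> m2 \<oplus> m2 \<oplus> x1 \<oplus> x3 \<oplus> m1 \<oplus> p4 \<oplus> p2 \<oplus> p1 \<oplus> p3"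
  let ?d = "m2 \<oplus> m1 \<oplus> p1 \<oplus> p2 \<oplus> p3 \<oplus> p4 \<oplus> x1 \<oplus> m1 \<oplus> x2 \<oplus> m2 \<oplus> x3"
  have "x1 \<ominus> x2 \<oplus> x3 = (x1 \<oplus> x3) \<ominus> x2"
    using assms by (simp add: a_minus_def a_ac)
  also have "\<dots> = ?c \<ominus> ?d"
    using assms by (intro diff_eq_diffI) (simp_all add: a_ac)
  also have "\<dots> = ?rhs"
    using assms by (simp add: a_minus_def minus_add a_ac)
  finally show ?thesis .
qed


section \<open>Linear maps and spans\<close>

lemma linear_mapI:
  assumes "\<And>x. x \<in> carrier M \<Longrightarrow> h x \<in> carrier N"
    and "\<And>x y. \<lbrakk>x \<in> carrier M; y \<in> carrier M\<rbrakk> \<Longrightarrow> h (x \<oplus>\<^bsub>M\<^esub> y) = h x \<oplus>\<^bsub>N\<^esub> h y"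
    and "\<And>r x. \<lbrakk>r \<in> carrier R; x \<in> carrier M\<rbrakk> \<Longrightarrow> h (r \<odot>\<^bsub>M\<^esub> x) = r \<odot>\<^bsub>N\<^esub> h x"
  shows "linear_map R M N h"
  using assms by (auto simp: linear_map_def)

lemma linear_mapD:
  assumes "linear_map R M N h"
  shows "\<And>x. x \<in> carrier M \<Longrightarrow> h x \<in> carrier N"
    and "\<And>x y. \<lbrakk>x \<in> carrier M; y \<in> carrier M\<rbrakk> \<Longrightarrow> h (x \<oplus>\<^bsub>M\<^esub> y) = h x \<oplus>\<^bsub>N\<^esub> h y"
    and "\<And>r x. \<lbrakk>r \<in> carrier R; x \<in> carrier M\<rbrakk> \<Longrightarrow> h (r \<odot>\<^bsub>M\<^esub> x) = r \<odot>\<^bsub>N\<^esub> h x"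
  using assms by (auto simp: linear_map_def)

lemma linear_map_zero:
  assumes "module R M" "module R N" "linear_map R M N h"
  shows "h \<zero>\<^bsub>M\<^esub> = \<zero>\<^bsub>N\<^esub>"
proof -
  interpret M: module R M by fact
  interpret N: module R N by fact
  have "h (\<zero>\<^bsub>R\<^esub> \<odot>\<^bsub>M\<^esub> \<zero>\<^bsub>M\<^esub>) = \<zero>\<^bsub>R\<^esub> \<odot>\<^bsub>N\<^esub> h \<zero>\<^bsub>M\<^esub>"
    using linear_mapD(3)[OF assms(3)] by blast
  then show ?thesis
    using linear_mapD(1)[OF assms(3), of "\<zero>\<^bsub>M\<^esub>"] by simp
qed

lemma linear_map_neg:
  assumes "module R M" "module R N" "linear_map R M N h" "x \<in> carrier M"
  shows "h (\<ominus>\<^bsub>M\<^esub> x) = \<ominus>\<^bsub>N\<^esub> h x"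
proof -
  interpret M: module R M by fact
  interpret N: module R N by fact
  have "h ((\<ominus>\<^bsub>R\<^esub> \<one>\<^bsub>R\<^esub>) \<odot>\<^bsub>M\<^esub> x) = (\<ominus>\<^bsub>R\<^esub> \<one>\<^bsub>R\<^esub>) \<odot>\<^bsub>N\<^esub> h x"
    using linear_mapD(3)[OF assms(3)] assms(4) by blast
  then show ?thesis
    using linear_mapD(1)[OF assms(3,4)] assms(4) by (simp add: M.smult_l_minus N.smult_l_minus)
qed

lemma linear_map_minus:
  assumes "module R M" "module R N" "linear_map R M N h" "x \<in> carrier M" "y \<in> carrier M"
  shows "h (x \<ominus>\<^bsub>M\<^esub> y) = h x \<ominus>\<^bsub>N\<^esub> h y"
proof -
  interpret M: module R M by fact
  show ?thesis
    using assms by (simp add: a_minus_def linear_mapD(2)[OF assms(3)] linear_map_neg)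
qed

lemma linear_map_id: "linear_map R M M (\<lambda>x. x)"
  by (rule linear_mapI) simp_all

lemma linear_map_compose:
  assumes "linear_map R M N f" "linear_map R N P g"
  shows "linear_map R M P (\<lambda>x. g (f x))"
  using assms by (auto simp: linear_map_def Pi_iff)

lemma linear_map_add:
  assumes "module R N" "linear_map R M N f" "linear_map R M N g"
  shows "linear_map R M N (\<lambda>x. f x \<oplus>\<^bsub>N\<^esub> g x)"
proof -
  interpret N: module R N by fact
  show ?thesis
    by (rule linear_mapI)
      (simp_all add: linear_mapD[OF assms(2)] linear_mapD[OF assms(3)] N.a_ac N.smult_r_distr)
qed

lemma linear_map_smult:
  assumes "module R N" "linear_map R M N f" "r \<in> carrier R"
  shows "linear_map R M N (\<lambda>x. r \<odot>\<^bsub>N\<^esub> f x)"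
proof -
  interpret N: module R N by fact
  have "r \<odot>\<^bsub>N\<^esub> (s \<odot>\<^bsub>N\<^esub> y) = s \<odot>\<^bsub>N\<^esub> (r \<odot>\<^bsub>N\<^esub> y)" if "s \<in> carrier R" "y \<in> carrier N" for s y
    using N.smult_assoc1[of r s y] N.smult_assoc1[of s r y] N.R.m_comm[of r s] assms(3) that by simp
  then show ?thesis
    by (intro linear_mapI)
      (simp_all add: assms(3) linear_mapD[OF assms(2)] N.smult_r_distr)
qed

lemma linear_map_uminus:
  assumes "module R N" "linear_map R M N f"
  shows "linear_map R M N (\<lambda>x. \<ominus>\<^bsub>N\<^esub> f x)"
proof -
  interpret N: module R N by fact
  show ?thesis
    by (rule linear_mapI)
      (simp_all add: linear_mapD[OF assms(2)] N.minus_add N.smult_r_minus)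
qed

lemma linear_map_diff:
  assumes "module R N" "linear_map R M N f" "linear_map R M N g"
  shows "linear_map R M N (\<lambda>x. f x \<ominus>\<^bsub>N\<^esub> g x)"
  unfolding a_minus_def using assms by (intro linear_map_add linear_map_uminus)

lemma linear_map_finsum:
  assumes "module R N" "finite I" "\<And>i. i \<in> I \<Longrightarrow> linear_map R M N (f i)"
  shows "linear_map R M N (\<lambda>x. \<Oplus>\<^bsub>N\<^esub>i\<in>I. f i x)"
proof -
  interpret N: module R N by fact
  have cl: "(\<lambda>i. f i x) \<in> I \<rightarrow> carrier N" if "x \<in> carrier M" for x
    using that linear_mapD(1)[OF assms(3)] by blast
  show ?thesis
  proof (rule linear_mapI)
    fix x assume x: "x \<in> carrier M"
    then show "(\<Oplus>\<^bsub>N\<^esub>i\<in>I. f i x) \<in> carrier N"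
      using cl by (intro N.finsum_closed)
    fix y assume y: "y \<in> carrier M"
    have "(\<Oplus>\<^bsub>N\<^esub>i\<in>I. f i (x \<oplus>\<^bsub>M\<^esub> y)) = (\<Oplus>\<^bsub>N\<^esub>i\<in>I. f i x \<oplus>\<^bsub>N\<^esub> f i y)"
      using x y cl by (intro N.finsum_cong') (auto simp: linear_mapD(2)[OF assms(3)])
    then show "(\<Oplus>\<^bsub>N\<^esub>i\<in>I. f i (x \<oplus>\<^bsub>M\<^esub> y)) = (\<Oplus>\<^bsub>N\<^esub>i\<in>I. f i x) \<oplus>\<^bsub>N\<^esub> (\<Oplus>\<^bsub>N\<^esub>i\<in>I. f i y)"
      using N.finsum_addf[OF cl[OF x] cl[OF y]] by simp
  next
    fix r x assume r: "r \<in> carrier R" and x: "x \<in> carrier M"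
    have "(\<Oplus>\<^bsub>N\<^esub>i\<in>I. f i (r \<odot>\<^bsub>M\<^esub> x)) = (\<Oplus>\<^bsub>N\<^esub>i\<in>I. r \<odot>\<^bsub>N\<^esub> f i x)"
      using x r cl by (intro N.finsum_cong') (auto simp: linear_mapD(3)[OF assms(3)])
    then show "(\<Oplus>\<^bsub>N\<^esub>i\<in>I. f i (r \<odot>\<^bsub>M\<^esub> x)) = r \<odot>\<^bsub>N\<^esub> (\<Oplus>\<^bsub>N\<^esub>i\<in>I. f i x)"
      using N.finsum_smult_ldistr[OF assms(2) r cl[OF x]] by simp
  qed
qed

lemma submodule_vimage:
  assumes "module R M" "module R N" "linear_map R M N h" "submodule H R N"
  shows "submodule {x \<in> carrier M. h x \<in> H} R M"
proof -
  interpret M: module R M by fact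
  interpret N: module R N by fact
  note H = N.submoduleE[OF assms(4)]
  have "\<zero>\<^bsub>N\<^esub> \<in> H"
    using submodule.axioms(1)[OF assms(4)] subgroup.one_closed by fastforce
  then show ?thesis
    using H by (intro M.submoduleI)
      (auto simp: linear_map_zero[OF assms(1-3)] linear_map_neg[OF assms(1-3)]
        linear_mapD[OF assms(3)])
qed

lemma submodule_equalizer:
  assumes "module R M" "module R N" "linear_map R M N f" "linear_map R M N g"
  shows "submodule {x \<in> carrier M. f x = g x} R M"
proof -
  interpret M: module R M by fact
  show ?thesis
    by (rule M.submoduleI)
      (auto simp: linear_map_zero[OF assms(1-3)] linear_map_neg[OF assms(1-3)]
        linear_map_zero[OF assms(1,2,4)] linear_map_neg[OF assms(1,2,4)]
        linear_mapD[OF assms(3)] linear_mapD[OF assms(4)])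
qed

lemma submodule_zero_closed: "submodule H R M \<Longrightarrow> \<zero>\<^bsub>M\<^esub> \<in> H"
  using submodule.axioms(1) subgroup.one_closed by fastforce

lemma submodule_Inter:
  assumes "module R M" "\<H> \<noteq> {}" "\<And>H. H \<in> \<H> \<Longrightarrow> submodule H R M"
  shows "submodule (\<Inter>\<H>) R M"
proof -
  interpret M: module R M by fact
  note H = M.submoduleE[OF assms(3)]
  show ?thesis
  proof (rule M.submoduleI)
    show "\<Inter>\<H> \<subseteq> carrier M" using assms(2) H(1) by blast
    show "\<zero>\<^bsub>M\<^esub> \<in> \<Inter>\<H>" using submodule_zero_closed[OF assms(3)] by blast
  qed (use H(3-5) in blast)+
qed

lemma submodule_span:
  assumes "module R M" "S \<subseteq> carrier M"
  shows "submodule (submod_span R M S) R M"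
proof -
  have "carrier M \<in> {H. submodule H R M \<and> S \<subseteq> H}"
    using assms(2) module.carrier_is_submodule[OF assms(1)] by simp
  then have "submodule (\<Inter>{H. submodule H R M \<and> S \<subseteq> H}) R M"
    by (intro submodule_Inter[OF assms(1)]) (simp_all, blast)
  then show ?thesis by (simp add: submod_span_def hull_def)
qed

lemma span_superset: "S \<subseteq> submod_span R M S"
  unfolding submod_span_def by (rule hull_subset)

lemma span_inc: "x \<in> S \<Longrightarrow> x \<in> submod_span R M S"
  by (rule subsetD[OF span_superset])

lemma span_minimal: "\<lbrakk>S \<subseteq> H; submodule H R M\<rbrakk> \<Longrightarrow> submod_span R M S \<subseteq> H"
  unfolding submod_span_def by (rule hull_minimal)

lemma span_subset_carrier:
  assumes "module R M" "S \<subseteq> carrier M"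
  shows "submod_span R M S \<subseteq> carrier M"
  by (rule span_minimal[OF assms(2) module.carrier_is_submodule[OF assms(1)]])

lemma linear_map_eq_on_span:
  assumes "module R M" "module R N" "linear_map R M N f" "linear_map R M N g"
    and "S \<subseteq> carrier M" "\<And>x. x \<in> S \<Longrightarrow> f x = g x" "x \<in> submod_span R M S"
  shows "f x = g x"
proof -
  have "S \<subseteq> {x \<in> carrier M. f x = g x}" using assms(5,6) by blast
  then show ?thesis using span_minimal[OF _ submodule_equalizer[OF assms(1-4)]] assms(7) by blast
qed

lemma linear_map_span_into:
  assumes "module R M" "module R N" "linear_map R M N h" "submodule H R N"
    and "S \<subseteq> carrier M" "\<And>x. x \<in> S \<Longrightarrow> h x \<in> H" "x \<in> submod_span R M S"
  shows "h x \<in> H"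
proof -
  have "S \<subseteq> {x \<in> carrier M. h x \<in> H}" using assms(5,6) by blast
  then show ?thesis using span_minimal[OF _ submodule_vimage[OF assms(1-4)]] assms(7) by blast
qed

lemma submodule_image:
  assumes "module R M" "module R N" "linear_map R M N h" "submodule K R M"
  shows "submodule (h ` K) R N"
proof -
  interpret M: module R M by fact
  interpret N: module R N by fact
  note K = M.submoduleE[OF assms(4)]
  have K1: "x \<in> carrier M" if "x \<in> K" for x using K(1) that by blast
  show ?thesis
  proof (rule N.submoduleI)
    show "h ` K \<subseteq> carrier N" using K1 linear_mapD(1)[OF assms(3)] by auto
    show "\<zero>\<^bsub>N\<^esub> \<in> h ` K"
      using linear_map_zero[OF assms(1-3)] submodule_zero_closed[OF assms(4)] by (metis imageI)
    show "\<ominus>\<^bsub>N\<^esub> a \<in> h ` K" if "a \<in> h ` K" for a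
      using that K(3) K1 by (auto simp: linear_map_neg[OF assms(1-3), symmetric])
    show "a \<oplus>\<^bsub>N\<^esub> b \<in> h ` K" if "a \<in> h ` K" "b \<in> h ` K" for a b
      using that K(5) K1 by (auto simp: linear_mapD(2)[OF assms(3), symmetric])
    show "r \<odot>\<^bsub>N\<^esub> a \<in> h ` K" if "r \<in> carrier R" "a \<in> h ` K" for r a
      using that K(4) K1 by (auto simp: linear_mapD(3)[OF assms(3), symmetric])
  qed
qed

lemma span_linear_image:
  assumes "module R M" "module R N" "linear_map R M N h" "S \<subseteq> carrier M"
  shows "h ` submod_span R M S = submod_span R N (h ` S)"
proof
  have "h ` S \<subseteq> carrier N" using assms(4) linear_mapD(1)[OF assms(3)] by auto
  then have "submodule (submod_span R N (h ` S)) R N" by (rule submodule_span[OF assms(2)])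
  from linear_map_span_into[OF assms(1-3) this assms(4) span_inc]
  show "h ` submod_span R M S \<subseteq> submod_span R N (h ` S)" by blast
  show "submod_span R N (h ` S) \<subseteq> h ` submod_span R M S"
    by (rule span_minimal[OF image_mono[OF span_superset]
          submodule_image[OF assms(1-3) submodule_span[OF assms(1,4)]]])
qed

text \<open>Bilinear maps, checked on spanning sets.\<close>

lemma bilinear_mapD:
  assumes "bilinear_map R M N P f"
  shows "x \<in> carrier M \<Longrightarrow> linear_map R N P (f x)"
    and "y \<in> carrier N \<Longrightarrow> linear_map R M P (\<lambda>x. f x y)"
  using assms by (auto simp: bilinear_map_def)

lemma bilinear_map_closed:
  "\<lbrakk>bilinear_map R M N P f; x \<in> carrier M; y \<in> carrier N\<rbrakk> \<Longrightarrow> f x y \<in> carrier P"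
  by (auto simp: bilinear_map_def linear_map_def)

lemma bilinear_map_eq_on_span:
  assumes "module R M" "module R N" "module R P" "bilinear_map R M N P f" "bilinear_map R M N P g"
    and "S \<subseteq> carrier M" "T \<subseteq> carrier N" "\<And>x y. \<lbrakk>x \<in> S; y \<in> T\<rbrakk> \<Longrightarrow> f x y = g x y"
    and "x \<in> submod_span R M S" "y \<in> submod_span R N T"
  shows "f x y = g x y"
proof -
  have y: "y \<in> carrier N" using span_subset_carrier[OF assms(2,7)] assms(10) by blast
  have *: "f x y = g x y" if "x \<in> S" for x
  proof (rule linear_map_eq_on_span[OF assms(2,3) _ _ assms(7) _ assms(10)])
    have "x \<in> carrier M" using that assms(6) by blast
    then show "linear_map R N P (f x)" "linear_map R N P (g x)"
      by (fact bilinear_mapD(1)[OF assms(4)], fact bilinear_mapD(1)[OF assms(5)])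
  qed (rule assms(8)[OF that])
  show ?thesis
    by (rule linear_map_eq_on_span[OF assms(1,3) bilinear_mapD(2)[OF assms(4) y]
          bilinear_mapD(2)[OF assms(5) y] assms(6) * assms(9)])
qed

lemma linear_map_apply_finsum:
  assumes "module R M" "module R N" "linear_map R M N h" "finite I" "f \<in> I \<rightarrow> carrier M"
  shows "h (\<Oplus>\<^bsub>M\<^esub>i\<in>I. f i) = (\<Oplus>\<^bsub>N\<^esub>i\<in>I. h (f i))"
proof -
  interpret M: module R M by fact
  interpret N: module R N by fact
  show ?thesis
    using assms(4,5)
  proof (induction I rule: finite_induct)
    case empty
    then show ?case by (simp add: linear_map_zero[OF assms(1-3)])
  next
    case (insert i I)
    then have f: "f \<in> I \<rightarrow> carrier M" "f i \<in> carrier M" by auto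
    then have "(\<lambda>i. h (f i)) \<in> I \<rightarrow> carrier N" "h (f i) \<in> carrier N"
      using linear_mapD(1)[OF assms(3)] by auto
    then show ?case
      using insert.hyps insert.IH[OF f(1)] linear_mapD(2)[OF assms(3) f(2) M.finsum_closed[OF f(1)]] f
      by simp
  qed
qed

lemma linear_map_restrict:
  assumes "linear_map R M N f" "H \<subseteq> carrier M" "\<And>x. x \<in> H \<Longrightarrow> f x \<in> K"
  shows "linear_map R (M\<lparr>carrier := H\<rparr>) (N\<lparr>carrier := K\<rparr>) f"
proof (rule linear_mapI; simp)
  show "f x \<in> K" if "x \<in> H" for x by (rule assms(3)[OF that])
  show "f (x \<oplus>\<^bsub>M\<^esub> y) = f x \<oplus>\<^bsub>N\<^esub> f y" if "x \<in> H" "y \<in> H" for x y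
    using that assms(2) by (intro linear_mapD(2)[OF assms(1)]) blast+
  show "f (r \<odot>\<^bsub>M\<^esub> x) = r \<odot>\<^bsub>N\<^esub> f x" if "r \<in> carrier R" "x \<in> H" for r x
    using that assms(2) by (intro linear_mapD(3)[OF assms(1)]) blast+
qed

lemma bilinear_map_restrict:
  assumes "bilinear_map R M N P f" "H \<subseteq> carrier M" "K \<subseteq> carrier N"
    and "\<And>x y. \<lbrakk>x \<in> H; y \<in> K\<rbrakk> \<Longrightarrow> f x y \<in> L"
  shows "bilinear_map R (M\<lparr>carrier := H\<rparr>) (N\<lparr>carrier := K\<rparr>) (P\<lparr>carrier := L\<rparr>) f"
  unfolding bilinear_map_def
proof (intro conjI ballI)
  fix x assume "x \<in> carrier (M\<lparr>carrier := H\<rparr>)"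
  then have x: "x \<in> H" by simp
  then show "linear_map R (N\<lparr>carrier := K\<rparr>) (P\<lparr>carrier := L\<rparr>) (f x)"
    using assms(2) by (intro linear_map_restrict[OF bilinear_mapD(1)[OF assms(1)] assms(3)] assms(4)) auto
next
  fix y assume "y \<in> carrier (N\<lparr>carrier := K\<rparr>)"
  then have y: "y \<in> K" by simp
  then show "linear_map R (M\<lparr>carrier := H\<rparr>) (P\<lparr>carrier := L\<rparr>) (\<lambda>x. f x y)"
    using assms(3) by (intro linear_map_restrict[OF bilinear_mapD(2)[OF assms(1)] assms(2)] assms(4)) auto
qed

text \<open>The additive inverse is defined by a description over the carrier, so its value in a submodule
  is not definitionally the value in the ambient module.\<close>

lemma submodule_a_inv:
  assumes "module R M" "submodule H R M" "x \<in> H"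
  shows "\<ominus>\<^bsub>M\<lparr>carrier := H\<rparr>\<^esub> x = \<ominus>\<^bsub>M\<^esub> x"
proof -
  have H: "H \<subseteq> carrier M" by (rule module.submoduleE(1)[OF assms(1,2)])
  have "linear_map R (M\<lparr>carrier := H\<rparr>) M (\<lambda>x. x)"
    using H by (intro linear_mapI) auto
  from linear_map_neg[OF submodule.submodule_is_module[OF assms(2,1)] assms(1) this] assms(3)
  show ?thesis by simp
qed

lemma submodule_trans:
  assumes "module R M" "submodule H R M" "submodule K R (M\<lparr>carrier := H\<rparr>)"
  shows "submodule K R M"
proof (rule module.module_incl_imp_submodule[OF assms(1)])
  note HM = submodule.submodule_is_module[OF assms(2,1)]
  show "K \<subseteq> carrier M"
    using module.submoduleE(1)[OF HM assms(3)] module.submoduleE(1)[OF assms(1,2)] by auto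
  show "module R (M\<lparr>carrier := K\<rparr>)"
    using submodule.submodule_is_module[OF assms(3) HM] by simp
qed

text \<open>The unitization \<open>R \<oplus> M\<close> of a commutative, associative bilinear product on \<open>M\<close>.\<close>

lemma cring_cup1_extension:
  assumes "module R M" "bilinear_map R M M M m"
    and assoc: "\<And>x y z. \<lbrakk>x \<in> carrier M; y \<in> carrier M; z \<in> carrier M\<rbrakk> \<Longrightarrow> m (m x y) z = m x (m y z)"
    and comm: "\<And>x y. \<lbrakk>x \<in> carrier M; y \<in> carrier M\<rbrakk> \<Longrightarrow> m x y = m y x"
  shows "cring (cup1_extension R M m)"
proof -
  interpret M: module R M by fact
  note lin1 = linear_mapD[OF bilinear_mapD(1)[OF assms(2)]]
  note lin2 = linear_mapD[OF bilinear_mapD(2)[OF assms(2)]]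
  have m0: "m \<zero>\<^bsub>M\<^esub> x = \<zero>\<^bsub>M\<^esub>" if "x \<in> carrier M" for x
    by (rule linear_map_zero[OF assms(1,1) bilinear_mapD(2)[OF assms(2) that]])
  have m0': "m x \<zero>\<^bsub>M\<^esub> = \<zero>\<^bsub>M\<^esub>" if "x \<in> carrier M" for x
    by (rule linear_map_zero[OF assms(1,1) bilinear_mapD(1)[OF assms(2) that]])
  show ?thesis
  proof (rule cringI)
    show "abelian_group (cup1_extension R M m)"
    proof (rule abelian_groupI, goal_cases)
      case (6 x)
      then obtain r a where "x = (r, a)" "r \<in> carrier R" "a \<in> carrier M" by (auto simp: cup1_extension_def)
      then show ?case
        by (intro bexI[of _ "(\<ominus>\<^bsub>R\<^esub> r, \<ominus>\<^bsub>M\<^esub> a)"]) (auto simp: cup1_extension_def M.R.l_neg M.l_neg)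
    qed (auto simp: cup1_extension_def M.R.a_ac M.a_ac)
    show "comm_monoid (cup1_extension R M m)"
    proof (rule comm_monoidI, goal_cases)
      case (3 x y z)
      then obtain r a s b t c where *: "x = (r, a)" "y = (s, b)" "z = (t, c)"
        "r \<in> carrier R" "s \<in> carrier R" "t \<in> carrier R" "a \<in> carrier M" "b \<in> carrier M" "c \<in> carrier M"
        by (auto simp: cup1_extension_def)
      then show ?case
        by (simp add: cup1_extension_def lin1 lin2 assoc M.smult_r_distr M.a_ac M.R.m_ac
            M.smult_assoc1[symmetric])
    qed (auto simp: cup1_extension_def lin1 m0 m0' comm M.R.m_comm M.a_ac)
    show "(x \<oplus>\<^bsub>cup1_extension R M m\<^esub> y) \<otimes>\<^bsub>cup1_extension R M m\<^esub> z
        = x \<otimes>\<^bsub>cup1_extension R M m\<^esub> z \<oplus>\<^bsub>cup1_extension R M m\<^esub> y \<otimes>\<^bsub>cup1_extension R M m\<^esub> z"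
      if "x \<in> carrier (cup1_extension R M m)" "y \<in> carrier (cup1_extension R M m)"
        "z \<in> carrier (cup1_extension R M m)" for x y z
    proof -
      from that obtain r a s b t c where "x = (r, a)" "y = (s, b)" "z = (t, c)"
        "r \<in> carrier R" "s \<in> carrier R" "t \<in> carrier R" "a \<in> carrier M" "b \<in> carrier M" "c \<in> carrier M"
        by (auto simp: cup1_extension_def)
      then show ?thesis
        by (simp add: cup1_extension_def lin1 lin2 M.smult_r_distr M.smult_l_distr M.R.l_distr M.a_ac)
    qed
  qed
qed


section \<open>Free modules and their quotients\<close>

lemma free_module_simps [simp]:
  "add (free_module R S) = (\<lambda>f g x. f x \<oplus>\<^bsub>R\<^esub> g x)"
  "zero (free_module R S) = (\<lambda>x. \<zero>\<^bsub>R\<^esub>)"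
  "smult (free_module R S) = (\<lambda>r f x. r \<otimes>\<^bsub>R\<^esub> f x)"
  by (auto simp: free_module_def)

lemma carrier_free_module:
  "f \<in> carrier (free_module R S) \<longleftrightarrow>
    (\<forall>x. f x \<in> carrier R) \<and> (\<forall>x. x \<notin> S \<longrightarrow> f x = \<zero>\<^bsub>R\<^esub>) \<and> finite {x. f x \<noteq> \<zero>\<^bsub>R\<^esub>}"
  by (auto simp: free_module_def)

lemma module_free_module:
  assumes "cring R"
  shows "module R (free_module R S)"
proof -
  interpret cring R by fact
  show ?thesis
  proof (rule moduleI[OF assms], rule abelian_groupI)
    fix f g assume f: "f \<in> carrier (free_module R S)" and g: "g \<in> carrier (free_module R S)"
    have "{x. f x \<oplus>\<^bsub>R\<^esub> g x \<noteq> \<zero>\<^bsub>R\<^esub>} \<subseteq> {x. f x \<noteq> \<zero>\<^bsub>R\<^esub>} \<union> {x. g x \<noteq> \<zero>\<^bsub>R\<^esub>}" by auto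
    then show "f \<oplus>\<^bsub>free_module R S\<^esub> g \<in> carrier (free_module R S)"
      using f g by (auto simp: carrier_free_module dest: finite_subset)
  next
    fix f assume f: "f \<in> carrier (free_module R S)"
    have "{x. \<ominus>\<^bsub>R\<^esub> f x \<noteq> \<zero>\<^bsub>R\<^esub>} \<subseteq> {x. f x \<noteq> \<zero>\<^bsub>R\<^esub>}" by auto
    then have "(\<lambda>x. \<ominus>\<^bsub>R\<^esub> f x) \<in> carrier (free_module R S)"
      using f by (auto simp: carrier_free_module dest: finite_subset)
    then show "\<exists>y\<in>carrier (free_module R S). y \<oplus>\<^bsub>free_module R S\<^esub> f = \<zero>\<^bsub>free_module R S\<^esub>"
      using f by (intro bexI[of _ "\<lambda>x. \<ominus>\<^bsub>R\<^esub> f x"]) (auto simp: carrier_free_module l_neg)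
  next
    fix r f assume r: "r \<in> carrier R" and f: "f \<in> carrier (free_module R S)"
    have "{x. r \<otimes>\<^bsub>R\<^esub> f x \<noteq> \<zero>\<^bsub>R\<^esub>} \<subseteq> {x. f x \<noteq> \<zero>\<^bsub>R\<^esub>}" using r by auto
    then show "r \<odot>\<^bsub>free_module R S\<^esub> f \<in> carrier (free_module R S)"
      using f r by (auto simp: carrier_free_module dest: finite_subset)
  qed (auto simp: carrier_free_module a_ac l_distr r_distr m_assoc fun_eq_iff)
qed

lemma free_gen_closed:
  assumes "cring R" "x \<in> S"
  shows "free_gen R x \<in> carrier (free_module R S)"
proof -
  interpret cring R by fact
  have "{y. free_gen R x y \<noteq> \<zero>\<^bsub>R\<^esub>} \<subseteq> {x}" by (auto simp: free_gen_def)
  then have "finite {y. free_gen R x y \<noteq> \<zero>\<^bsub>R\<^esub>}" by (rule finite_subset) simp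
  then show ?thesis using assms(2) by (auto simp: carrier_free_module free_gen_def)
qed

lemma span_free_gen:
  assumes "cring R"
  shows "submod_span R (free_module R S) (free_gen R ` S) = carrier (free_module R S)"
    (is "?H = carrier ?F")
proof -
  interpret cring R by fact
  interpret F: module R ?F by (rule module_free_module) fact
  have gens: "free_gen R ` S \<subseteq> carrier ?F" using free_gen_closed[OF assms] by auto
  have H: "submodule ?H R ?F" by (rule submodule_span[OF F.module_axioms gens])
  have *: "f \<in> ?H" if "finite T" "f \<in> carrier ?F" "{x. f x \<noteq> \<zero>\<^bsub>R\<^esub>} \<subseteq> T" for f T
    using that
  proof (induction T arbitrary: f)
    case empty
    then have "f = \<zero>\<^bsub>?F\<^esub>" by auto
    then show ?case using submodule_zero_closed[OF H] by simp
  next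
    case (insert x T)
    note f = insert.prems(1)[unfolded carrier_free_module]
    define f' where "f' = (\<lambda>y. if y = x then \<zero>\<^bsub>R\<^esub> else f y)"
    have "{y. f' y \<noteq> \<zero>\<^bsub>R\<^esub>} \<subseteq> {y. f y \<noteq> \<zero>\<^bsub>R\<^esub>}" by (auto simp: f'_def)
    then have "f' \<in> carrier ?F"
      using f by (auto simp: carrier_free_module f'_def intro: finite_subset)
    then have 1: "f' \<in> ?H" using insert.prems(2) by (intro insert.IH) (auto simp: f'_def)
    show ?case
    proof (cases "x \<in> S")
      case True
      have "f = f' \<oplus>\<^bsub>?F\<^esub> f x \<odot>\<^bsub>?F\<^esub> free_gen R x"
        using f by (auto simp: free_gen_def f'_def fun_eq_iff)
      moreover have "\<dots> \<in> ?H"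
        using f True by (intro F.submoduleE(5)[OF H 1] F.submoduleE(4)[OF H] span_inc) auto
      ultimately show ?thesis by simp
    next
      case False
      then have "f = f'" using f by (auto simp: f'_def)
      then show ?thesis using 1 by simp
    qed
  qed
  have "f \<in> ?H" if "f \<in> carrier ?F" for f
    using *[of "{x. f x \<noteq> \<zero>\<^bsub>R\<^esub>}" f] that by (simp add: carrier_free_module)
  then show ?thesis using span_subset_carrier[OF F.module_axioms gens] by (intro equalityI subsetI) auto
qed

lemma free_ext_eq_finsum:
  assumes "module R P" "g \<in> S \<rightarrow> carrier P" "f \<in> carrier (free_module R S)"
    and "finite T" "T \<subseteq> S" "{x. f x \<noteq> \<zero>\<^bsub>R\<^esub>} \<subseteq> T"
  shows "free_ext R P g f = (\<Oplus>\<^bsub>P\<^esub>x\<in>T. f x \<odot>\<^bsub>P\<^esub> g x)"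
proof -
  interpret P: module R P by fact
  show ?thesis
    unfolding free_ext_def
    using assms(2-6) by (intro P.add.finprod_mono_neutral_cong_left)
      (auto simp: carrier_free_module Pi_iff subset_iff)
qed

lemma linear_map_free_ext:
  assumes "module R P" "g \<in> S \<rightarrow> carrier P"
  shows "linear_map R (free_module R S) P (free_ext R P g)"
proof -
  interpret P: module R P by fact
  have supp: "finite {x. f x \<noteq> \<zero>\<^bsub>R\<^esub>}" "{x. f x \<noteq> \<zero>\<^bsub>R\<^esub>} \<subseteq> S"
    if "f \<in> carrier (free_module R S)" for f
    using that by (auto simp: carrier_free_module)
  have cl: "(\<lambda>x. f x \<odot>\<^bsub>P\<^esub> g x) \<in> T \<rightarrow> carrier P"
    if "f \<in> carrier (free_module R S)" "T \<subseteq> S" for f T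
    using that assms(2) by (auto simp: carrier_free_module Pi_iff)
  interpret F: module R "free_module R S" by (rule module_free_module) (rule P.is_cring)
  show ?thesis
  proof (rule linear_mapI)
    fix f assume f: "f \<in> carrier (free_module R S)"
    show "free_ext R P g f \<in> carrier P"
      unfolding free_ext_def by (intro P.finsum_closed cl f supp)
    fix h assume h: "h \<in> carrier (free_module R S)"
    \<comment> \<open>The supports of \<open>f\<close>, \<open>h\<close> and \<open>f + h\<close> differ, so the sums are compared over a common set.\<close>
    let ?T = "{x. f x \<noteq> \<zero>\<^bsub>R\<^esub>} \<union> {x. h x \<noteq> \<zero>\<^bsub>R\<^esub>}"
    have T: "finite ?T" "?T \<subseteq> S" using supp f h by auto
    have fh: "f \<oplus>\<^bsub>free_module R S\<^esub> h \<in> carrier (free_module R S)" using f h by (rule F.a_closed)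
    have "free_ext R P g (f \<oplus>\<^bsub>free_module R S\<^esub> h)
        = (\<Oplus>\<^bsub>P\<^esub>x\<in>?T. (f x \<oplus>\<^bsub>R\<^esub> h x) \<odot>\<^bsub>P\<^esub> g x)"
      by (subst free_ext_eq_finsum[OF assms fh T]) auto
    also have "\<dots> = (\<Oplus>\<^bsub>P\<^esub>x\<in>?T. f x \<odot>\<^bsub>P\<^esub> g x \<oplus>\<^bsub>P\<^esub> h x \<odot>\<^bsub>P\<^esub> g x)"
    proof (rule P.finsum_cong')
      show "(\<lambda>x. f x \<odot>\<^bsub>P\<^esub> g x \<oplus>\<^bsub>P\<^esub> h x \<odot>\<^bsub>P\<^esub> g x) \<in> ?T \<rightarrow> carrier P"
        using cl[OF f T(2)] cl[OF h T(2)] by blast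
    next
      fix x assume "x \<in> ?T"
      then have "x \<in> S" using T by blast
      then show "(f x \<oplus>\<^bsub>R\<^esub> h x) \<odot>\<^bsub>P\<^esub> g x = f x \<odot>\<^bsub>P\<^esub> g x \<oplus>\<^bsub>P\<^esub> h x \<odot>\<^bsub>P\<^esub> g x"
        using f h assms(2) by (intro P.smult_l_distr) (auto simp: carrier_free_module)
    qed simp
    also have "\<dots> = free_ext R P g f \<oplus>\<^bsub>P\<^esub> free_ext R P g h"
      using P.finsum_addf[OF cl[OF f T(2)] cl[OF h T(2)]]
      by (simp add: free_ext_eq_finsum[OF assms f T] free_ext_eq_finsum[OF assms h T])
    finally show "free_ext R P g (f \<oplus>\<^bsub>free_module R S\<^esub> h)
        = free_ext R P g f \<oplus>\<^bsub>P\<^esub> free_ext R P g h" .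
  next
    fix r f assume r: "r \<in> carrier R" and f: "f \<in> carrier (free_module R S)"
    let ?T = "{x. f x \<noteq> \<zero>\<^bsub>R\<^esub>}"
    have T: "finite ?T" "?T \<subseteq> S" using supp f by auto
    have rf: "r \<odot>\<^bsub>free_module R S\<^esub> f \<in> carrier (free_module R S)" using r f by (rule F.smult_closed)
    have "free_ext R P g (r \<odot>\<^bsub>free_module R S\<^esub> f) = (\<Oplus>\<^bsub>P\<^esub>x\<in>?T. (r \<otimes>\<^bsub>R\<^esub> f x) \<odot>\<^bsub>P\<^esub> g x)"
      using r by (subst free_ext_eq_finsum[OF assms rf T]) auto
    also have "\<dots> = (\<Oplus>\<^bsub>P\<^esub>x\<in>?T. r \<odot>\<^bsub>P\<^esub> (f x \<odot>\<^bsub>P\<^esub> g x))"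
    proof (rule P.finsum_cong')
      show "(\<lambda>x. r \<odot>\<^bsub>P\<^esub> (f x \<odot>\<^bsub>P\<^esub> g x)) \<in> ?T \<rightarrow> carrier P"
        using cl[OF f T(2)] r by blast
    next
      fix x assume "x \<in> ?T"
      then have "x \<in> S" using T by blast
      then show "(r \<otimes>\<^bsub>R\<^esub> f x) \<odot>\<^bsub>P\<^esub> g x = r \<odot>\<^bsub>P\<^esub> (f x \<odot>\<^bsub>P\<^esub> g x)"
        using f r assms(2) by (intro P.smult_assoc1) (auto simp: carrier_free_module)
    qed simp
    also have "\<dots> = r \<odot>\<^bsub>P\<^esub> free_ext R P g f"
      unfolding free_ext_def using cl[OF f T(2)] r T by (subst P.finsum_smult_ldistr) auto
    finally show "free_ext R P g (r \<odot>\<^bsub>free_module R S\<^esub> f) = r \<odot>\<^bsub>P\<^esub> free_ext R P g f" .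
  qed
qed

text \<open>The sum is taken over \<open>{x}\<close> rather than over the support of the generator, which is empty when
  \<open>R\<close> is the zero ring.\<close>

lemma free_ext_free_gen:
  assumes "module R P" "g \<in> S \<rightarrow> carrier P" "x \<in> S"
  shows "free_ext R P g (free_gen R x) = g x"
proof -
  interpret P: module R P by fact
  have "free_ext R P g (free_gen R x) = (\<Oplus>\<^bsub>P\<^esub>y\<in>{x}. free_gen R x y \<odot>\<^bsub>P\<^esub> g y)"
    using assms(3) by (intro free_ext_eq_finsum[OF assms(1,2) free_gen_closed[OF P.is_cring assms(3)]])
      (auto simp: free_gen_def)
  also have "\<dots> = free_gen R x x \<odot>\<^bsub>P\<^esub> g x"
    using assms(2,3) by (subst P.finsum_insert) (auto simp: free_gen_def Pi_iff)
  finally show ?thesis using assms(2,3) by (auto simp: free_gen_def Pi_iff)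
qed

context
  fixes R :: "('r, 'm) ring_scheme" and M :: "('r, 'b, 'n) module_scheme" and N :: "'b set"
  assumes M: "module R M" and N: "submodule N R M"
begin

interpretation M: module R M by (rule M)

interpretation N: abelian_subgroup N M
  by (rule abelian_subgroupI3)
    (use N in \<open>auto simp: submodule_def additive_subgroup_def intro: M.abelian_group_axioms\<close>)

lemma quot_module_simps:
  "carrier (quot_module M N) = (\<lambda>x. N +>\<^bsub>M\<^esub> x) ` carrier M"
  "zero (quot_module M N) = N"
  "\<lbrakk>x \<in> carrier M; y \<in> carrier M\<rbrakk> \<Longrightarrow>
    (N +>\<^bsub>M\<^esub> x) \<oplus>\<^bsub>quot_module M N\<^esub> (N +>\<^bsub>M\<^esub> y) = N +>\<^bsub>M\<^esub> (x \<oplus>\<^bsub>M\<^esub> y)"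
  "\<lbrakk>r \<in> carrier R; x \<in> carrier M\<rbrakk> \<Longrightarrow>
    r \<odot>\<^bsub>quot_module M N\<^esub> (N +>\<^bsub>M\<^esub> x) = N +>\<^bsub>M\<^esub> (r \<odot>\<^bsub>M\<^esub> x)"
proof -
  show "carrier (quot_module M N) = (\<lambda>x. N +>\<^bsub>M\<^esub> x) ` carrier M"
    by (auto simp: quot_module_def A_RCOSETS_def')
  show "zero (quot_module M N) = N" by (simp add: quot_module_def)
  show "(N +>\<^bsub>M\<^esub> x) \<oplus>\<^bsub>quot_module M N\<^esub> (N +>\<^bsub>M\<^esub> y) = N +>\<^bsub>M\<^esub> (x \<oplus>\<^bsub>M\<^esub> y)"
    if "x \<in> carrier M" "y \<in> carrier M"
    using that by (simp add: quot_module_def N.a_rcos_sum)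
  assume r: "r \<in> carrier R" and x: "x \<in> carrier M"
  have const: "N +>\<^bsub>M\<^esub> (r \<odot>\<^bsub>M\<^esub> y) = N +>\<^bsub>M\<^esub> (r \<odot>\<^bsub>M\<^esub> x)" if "y \<in> N +>\<^bsub>M\<^esub> x" for y
  proof -
    obtain n where n: "n \<in> N" "y = n \<oplus>\<^bsub>M\<^esub> x" using \<open>y \<in> N +>\<^bsub>M\<^esub> x\<close> by (auto simp: a_r_coset_def')
    have "r \<odot>\<^bsub>M\<^esub> y = (r \<odot>\<^bsub>M\<^esub> n) \<oplus>\<^bsub>M\<^esub> (r \<odot>\<^bsub>M\<^esub> x)"
      using n r x N.a_subset by (auto simp: M.smult_r_distr)
    moreover have "r \<odot>\<^bsub>M\<^esub> n \<in> N" using r n N by (intro submodule.smult_closed)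
    ultimately have "r \<odot>\<^bsub>M\<^esub> y \<in> N +>\<^bsub>M\<^esub> (r \<odot>\<^bsub>M\<^esub> x)" by (auto simp: a_r_coset_def')
    then show ?thesis using r x by (intro N.a_repr_independence'[symmetric]) auto
  qed
  have "N +>\<^bsub>M\<^esub> x \<noteq> {}" using N.a_rcos_self[OF x] by blast
  then have "(\<Union>y\<in>N +>\<^bsub>M\<^esub> x. N +>\<^bsub>M\<^esub> (r \<odot>\<^bsub>M\<^esub> y)) = N +>\<^bsub>M\<^esub> (r \<odot>\<^bsub>M\<^esub> x)"
    by (rule SUP_eq_const) (rule const)
  then show "r \<odot>\<^bsub>quot_module M N\<^esub> (N +>\<^bsub>M\<^esub> x) = N +>\<^bsub>M\<^esub> (r \<odot>\<^bsub>M\<^esub> x)"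
    by (simp add: quot_module_def)
qed

lemma module_quot_module: "module R (quot_module M N)"
proof -
  note [simp] = quot_module_simps
  have z: "N +>\<^bsub>M\<^esub> \<zero>\<^bsub>M\<^esub> = N" using N.a_subset by simp
  show ?thesis
  proof (rule moduleI[OF M.is_cring], rule abelian_groupI)
    have "N +>\<^bsub>M\<^esub> \<zero>\<^bsub>M\<^esub> \<in> carrier (quot_module M N)" by (simp only: quot_module_simps) blast
    then show "\<zero>\<^bsub>quot_module M N\<^esub> \<in> carrier (quot_module M N)" by (simp only: z quot_module_simps(2))
    fix X assume "X \<in> carrier (quot_module M N)"
    then obtain x where x: "x \<in> carrier M" "X = N +>\<^bsub>M\<^esub> x" by auto
    have "(N +>\<^bsub>M\<^esub> \<zero>\<^bsub>M\<^esub>) \<oplus>\<^bsub>quot_module M N\<^esub> X = X"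
      unfolding x(2) using x(1) by (subst quot_module_simps(3)) simp_all
    then show "\<zero>\<^bsub>quot_module M N\<^esub> \<oplus>\<^bsub>quot_module M N\<^esub> X = X" by (simp only: z quot_module_simps(2))
    have "(N +>\<^bsub>M\<^esub> (\<ominus>\<^bsub>M\<^esub> x)) \<oplus>\<^bsub>quot_module M N\<^esub> X = N +>\<^bsub>M\<^esub> \<zero>\<^bsub>M\<^esub>"
      unfolding x(2) using x(1) by (subst quot_module_simps(3)) (simp_all add: M.l_neg)
    then show "\<exists>Y\<in>carrier (quot_module M N). Y \<oplus>\<^bsub>quot_module M N\<^esub> X = \<zero>\<^bsub>quot_module M N\<^esub>"
      using x(1) unfolding z quot_module_simps(1,2) by blast
  qed (auto simp: M.a_ac M.smult_r_distr M.smult_l_distr M.smult_assoc1)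
qed

lemma linear_map_quot: "linear_map R M (quot_module M N) (\<lambda>x. N +>\<^bsub>M\<^esub> x)"
  by (rule linear_mapI) (auto simp: quot_module_simps)

lemma coset_eq_zero: "x \<in> N \<Longrightarrow> N +>\<^bsub>M\<^esub> x = \<zero>\<^bsub>quot_module M N\<^esub>"
  using N.a_subset N.a_rcos_const by (auto simp: quot_module_simps)

end

text \<open>The universal property of a module given by the generators \<open>S\<close> and the relations \<open>Z\<close>.\<close>

context
  fixes R :: "('r, 'm) ring_scheme" and S :: "'i set" and Z :: "('i \<Rightarrow> 'r) set"
  assumes cring: "cring R" and Z: "Z \<subseteq> carrier (free_module R S)"
begin

interpretation F: module R "free_module R S" by (rule module_free_module) (rule cring)

lemma submodule_rels: "submodule (submod_span R (free_module R S) Z) R (free_module R S)"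
  by (rule submodule_span[OF F.module_axioms Z])

lemma module_presented: "module R (quot_module (free_module R S) (submod_span R (free_module R S) Z))"
  by (rule module_quot_module[OF F.module_axioms submodule_rels])

lemma presented_gen_closed:
  "x \<in> S \<Longrightarrow> submod_span R (free_module R S) Z +>\<^bsub>free_module R S\<^esub> free_gen R x
    \<in> carrier (quot_module (free_module R S) (submod_span R (free_module R S) Z))"
  by (simp add: quot_module_simps(1)[OF F.module_axioms submodule_rels] free_gen_closed[OF cring])

lemma span_presented:
  "submod_span R (quot_module (free_module R S) (submod_span R (free_module R S) Z))
     ((\<lambda>x. submod_span R (free_module R S) Z +>\<^bsub>free_module R S\<^esub> free_gen R x) ` S)
   = carrier (quot_module (free_module R S) (submod_span R (free_module R S) Z))"
proof -
  have "free_gen R ` S \<subseteq> carrier (free_module R S)" using free_gen_closed[OF cring] by auto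
  from span_linear_image[OF F.module_axioms module_presented
      linear_map_quot[OF F.module_axioms submodule_rels] this]
  show ?thesis
    by (simp add: span_free_gen[OF cring] image_image
        quot_module_simps(1)[OF F.module_axioms submodule_rels])
qed

context
  fixes P :: "('r, 'c, 'k) module_scheme" and g :: "'i \<Rightarrow> 'c"
  assumes P: "module R P" and g: "g \<in> S \<rightarrow> carrier P"
    and kills: "\<And>z. z \<in> Z \<Longrightarrow> free_ext R P g z = \<zero>\<^bsub>P\<^esub>"
begin

interpretation P: module R P by (rule P)

lemma quot_ext_coset:
  assumes "f \<in> carrier (free_module R S)"
  shows "quot_ext R P g (submod_span R (free_module R S) Z +>\<^bsub>free_module R S\<^esub> f) = free_ext R P g f"
proof -
  let ?N = "submod_span R (free_module R S) Z"
  have lin: "linear_map R (free_module R S) P (free_ext R P g)"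
    by (rule linear_map_free_ext[OF P g])
  have z: "submodule {\<zero>\<^bsub>P\<^esub>} R P" by (rule P.submoduleI) auto
  have k: "free_ext R P g n = \<zero>\<^bsub>P\<^esub>" if "n \<in> ?N" for n
    using linear_map_span_into[OF F.module_axioms P lin z Z _ that] kills by blast
  have N: "?N \<subseteq> carrier (free_module R S)" by (rule span_subset_carrier[OF F.module_axioms Z])
  have const: "free_ext R P g (n \<oplus>\<^bsub>free_module R S\<^esub> f) = free_ext R P g f" if "n \<in> ?N" for n
    using linear_mapD(2)[OF lin subsetD[OF N that] assms] linear_mapD(1)[OF lin assms] k[OF that]
    by simp
  have "free_ext R P g ` (?N +>\<^bsub>free_module R S\<^esub> f)
      = (\<lambda>n. free_ext R P g (n \<oplus>\<^bsub>free_module R S\<^esub> f)) ` ?N"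
    unfolding a_r_coset_def' by blast
  also have "\<dots> = (\<lambda>n. free_ext R P g f) ` ?N"
    by (intro image_cong refl const)
  also have "\<dots> = {free_ext R P g f}"
    using submodule_zero_closed[OF submodule_rels] by blast
  finally have "free_ext R P g ` (?N +>\<^bsub>free_module R S\<^esub> f) = {free_ext R P g f}" .
  then show ?thesis by (simp add: quot_ext_def)
qed

lemma quot_ext_gen:
  "x \<in> S \<Longrightarrow>
    quot_ext R P g (submod_span R (free_module R S) Z +>\<^bsub>free_module R S\<^esub> free_gen R x) = g x"
  using quot_ext_coset free_gen_closed[OF cring] free_ext_free_gen[OF P g] by metis

lemma linear_map_quot_ext:
  "linear_map R (quot_module (free_module R S) (submod_span R (free_module R S) Z)) P (quot_ext R P g)"
proof -
  note q = quot_module_simps[OF F.module_axioms submodule_rels]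
  have lin: "linear_map R (free_module R S) P (free_ext R P g)"
    by (rule linear_map_free_ext[OF P g])
  show ?thesis
  proof (rule linear_mapI, goal_cases)
    case (1 X)
    then obtain f where f: "f \<in> carrier (free_module R S)"
      "X = submod_span R (free_module R S) Z +>\<^bsub>free_module R S\<^esub> f" unfolding q by blast
    then show ?case using linear_mapD(1)[OF lin] by (simp add: quot_ext_coset)
  next
    case (2 X Y)
    then obtain f h where f: "f \<in> carrier (free_module R S)" "h \<in> carrier (free_module R S)"
      "X = submod_span R (free_module R S) Z +>\<^bsub>free_module R S\<^esub> f"
      "Y = submod_span R (free_module R S) Z +>\<^bsub>free_module R S\<^esub> h" unfolding q by blast
    then show ?case
      using linear_mapD(2)[OF lin f(1,2)] F.a_closed[OF f(1,2)]
      by (simp add: q(3) quot_ext_coset del: free_module_simps)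
  next
    case (3 r X)
    then obtain f where f: "f \<in> carrier (free_module R S)"
      "X = submod_span R (free_module R S) Z +>\<^bsub>free_module R S\<^esub> f" unfolding q by blast
    then show ?case
      using linear_mapD(3)[OF lin 3(1) f(1)] F.smult_closed[OF 3(1) f(1)] 3(1)
      by (simp add: q(4) quot_ext_coset del: free_module_simps)
  qed
qed

text \<open>The image of the map induced by \<open>g\<close> is the span of the values of \<open>g\<close> on the generators.\<close>

lemma quot_ext_image_carrier:
  "quot_ext R P g ` carrier (quot_module (free_module R S) (submod_span R (free_module R S) Z))
    = submod_span R P (g ` S)"
proof -
  let ?Q = "quot_module (free_module R S) (submod_span R (free_module R S) Z)"
  let ?G = "(\<lambda>x. submod_span R (free_module R S) Z +>\<^bsub>free_module R S\<^esub> free_gen R x) ` S"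
  have "?G \<subseteq> carrier ?Q" using presented_gen_closed by auto
  from span_linear_image[OF module_presented P linear_map_quot_ext this]
  have "quot_ext R P g ` carrier ?Q = submod_span R P (quot_ext R P g ` ?G)"
    by (simp only: span_presented)
  also have "quot_ext R P g ` ?G = g ` S"
    unfolding image_image by (intro image_cong refl quot_ext_gen)
  finally show ?thesis .
qed

end

end


section \<open>Tensor powers\<close>

text \<open>Maps on words of length \<open>k\<close> that are linear in each letter.  Values on other lists are
  not constrained.\<close>

definition multilinear ::
  "('r, 'm) ring_scheme \<Rightarrow> nat \<Rightarrow> ('r, 'b, 'n) module_scheme \<Rightarrow> ('r, 'c, 'k) module_scheme \<Rightarrow>
    ('b list \<Rightarrow> 'c) \<Rightarrow> bool"
  where "multilinear R k M P g \<longleftrightarrow> g \<in> words M k \<rightarrow> carrier P \<and>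
    (\<forall>xs ys. set xs \<subseteq> carrier M \<longrightarrow> set ys \<subseteq> carrier M \<longrightarrow> length xs + length ys + 1 = k \<longrightarrow>
      linear_map R M P (\<lambda>a. g (xs @ [a] @ ys)))"

lemma multilinearI:
  assumes "\<And>xs. xs \<in> words M k \<Longrightarrow> g xs \<in> carrier P"
    and "\<And>xs ys. \<lbrakk>set xs \<subseteq> carrier M; set ys \<subseteq> carrier M; length xs + length ys + 1 = k\<rbrakk> \<Longrightarrow>
      linear_map R M P (\<lambda>a. g (xs @ [a] @ ys))"
  shows "multilinear R k M P g"
  using assms by (simp add: multilinear_def)

lemma multilinearD:
  assumes "multilinear R k M P g"
  shows "xs \<in> words M k \<Longrightarrow> g xs \<in> carrier P"
    and "\<lbrakk>set xs \<subseteq> carrier M; set ys \<subseteq> carrier M; length xs + length ys + 1 = k\<rbrakk> \<Longrightarrow>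
      linear_map R M P (\<lambda>a. g (xs @ [a] @ ys))"
  using assms by (auto simp: multilinear_def)

lemma multilinear_compose:
  assumes "multilinear R k M P g" "linear_map R P Q h"
  shows "multilinear R k M Q (\<lambda>xs. h (g xs))"
  using multilinearD[OF assms(1)] linear_mapD(1)[OF assms(2)]
  by (intro multilinearI linear_map_compose[OF _ assms(2)]) simp_all

lemma multilinear_smult:
  assumes "module R P" "multilinear R k M P g" "r \<in> carrier R"
  shows "multilinear R k M P (\<lambda>xs. r \<odot>\<^bsub>P\<^esub> g xs)"
  by (rule multilinear_compose[OF assms(2) linear_map_smult[OF assms(1) linear_map_id assms(3)]])

lemma multilinear_finsum:
  assumes "module R P" "finite I" "\<And>i. i \<in> I \<Longrightarrow> multilinear R k M P (g i)"
  shows "multilinear R k M P (\<lambda>xs. \<Oplus>\<^bsub>P\<^esub>i\<in>I. g i xs)"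
proof (rule multilinearI)
  interpret P: module R P by (rule assms(1))
  show "(\<Oplus>\<^bsub>P\<^esub>i\<in>I. g i xs) \<in> carrier P" if "xs \<in> words M k" for xs
    using multilinearD(1)[OF assms(3) that] by (intro P.finsum_closed Pi_I)
  show "linear_map R M P (\<lambda>a. \<Oplus>\<^bsub>P\<^esub>i\<in>I. g i (xs @ [a] @ ys))"
    if "set xs \<subseteq> carrier M" "set ys \<subseteq> carrier M" "length xs + length ys + 1 = k" for xs ys
    by (intro linear_map_finsum[OF assms(1,2)] multilinearD(2)[OF assms(3)] that)
qed

lemma words_appendI:
  "\<lbrakk>set xs \<subseteq> carrier M; set ys \<subseteq> carrier M; length xs + length ys = k\<rbrakk> \<Longrightarrow> xs @ ys \<in> words M k"
  by (simp add: words_def)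

context
  fixes R :: "('r, 'm) ring_scheme" and M :: "('r, 'b, 'n) module_scheme" and k :: nat
  assumes M: "module R M"
begin

interpretation M: module R M by (rule M)

interpretation F: module R "free_words R k M" by (rule module_free_module[OF M.is_cring])

lemma multilinear_rels_subset: "multilinear_rels R k M \<subseteq> carrier (free_words R k M)"
proof -
  have g: "free_gen R (xs @ zs @ ys) \<in> carrier (free_words R k M)"
    if "set xs \<subseteq> carrier M" "set ys \<subseteq> carrier M" "set zs \<subseteq> carrier M"
      "length xs + length ys + length zs = k" for xs ys zs
    using that by (intro free_gen_closed[OF M.is_cring] words_appendI) simp_all
  show ?thesis
    unfolding multilinear_rels_def
  proof (intro Un_least subsetI; clarify)
    fix xs ys a b assume *: "set xs \<subseteq> carrier M" "set ys \<subseteq> carrier M" "a \<in> carrier M" "b \<in> carrier M"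
      "k = length xs + length ys + 1"
    show "free_gen R (xs @ [a \<oplus>\<^bsub>M\<^esub> b] @ ys)
        \<ominus>\<^bsub>free_words R (length xs + length ys + 1) M\<^esub> free_gen R (xs @ [a] @ ys)
        \<ominus>\<^bsub>free_words R (length xs + length ys + 1) M\<^esub> free_gen R (xs @ [b] @ ys)
        \<in> carrier (free_words R (length xs + length ys + 1) M)"
      unfolding *(5)[symmetric] using *(3,4) by (intro F.minus_closed g *(1,2)) (simp_all add: *(5))
  next
    fix xs ys a r assume *: "set xs \<subseteq> carrier M" "set ys \<subseteq> carrier M" "a \<in> carrier M" "r \<in> carrier R"
      "k = length xs + length ys + 1"
    show "free_gen R (xs @ [r \<odot>\<^bsub>M\<^esub> a] @ ys)
        \<ominus>\<^bsub>free_words R (length xs + length ys + 1) M\<^esub> r \<odot>\<^bsub>free_words R (length xs + length ys + 1) M\<^esub>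
          free_gen R (xs @ [a] @ ys) \<in> carrier (free_words R (length xs + length ys + 1) M)"
      unfolding *(5)[symmetric] using *(3,4) by (intro F.minus_closed F.smult_closed g *(1,2)) (simp_all add: *(5))
  qed
qed

lemma balanced_rels_subset:
  assumes "\<And>m a. \<lbrakk>m \<in> carrier M; a \<in> A\<rbrakk> \<Longrightarrow> lact a m \<in> carrier M"
    and "\<And>m a. \<lbrakk>m \<in> carrier M; a \<in> A\<rbrakk> \<Longrightarrow> ract m a \<in> carrier M"
  shows "balanced_rels R A lact ract k M \<subseteq> carrier (free_words R k M)"
proof -
  have g: "free_gen R (xs @ zs @ ys) \<in> carrier (free_words R k M)"
    if "set xs \<subseteq> carrier M" "set ys \<subseteq> carrier M" "set zs \<subseteq> carrier M"
      "length xs + length ys + length zs = k" for xs ys zs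
    using that by (intro free_gen_closed[OF M.is_cring] words_appendI) simp_all
  show ?thesis
    unfolding balanced_rels_def
  proof (intro subsetI; clarify)
    fix xs ys m m' a assume *: "set xs \<subseteq> carrier M" "set ys \<subseteq> carrier M" "m \<in> carrier M" "m' \<in> carrier M"
      "a \<in> A" "k = length xs + length ys + 2"
    show "free_gen R (xs @ [ract m a, m'] @ ys)
        \<ominus>\<^bsub>free_words R (length xs + length ys + 2) M\<^esub> free_gen R (xs @ [m, lact a m'] @ ys)
        \<in> carrier (free_words R (length xs + length ys + 2) M)"
      unfolding *(6)[symmetric] using *(3-5) by (intro F.minus_closed g *(1,2)) (simp_all add: *(6) assms)
  qed
qed

context
  fixes P :: "('r, 'c, 'k) module_scheme" and g :: "'b list \<Rightarrow> 'c"
  assumes P: "module R P" and g: "multilinear R k M P g"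
begin

interpretation P: module R P by (rule P)

lemma multilinear_Pi: "g \<in> words M k \<rightarrow> carrier P"
  using g by (simp add: multilinear_def)

lemma linear_free_ext_words: "linear_map R (free_words R k M) P (free_ext R P g)"
  by (rule linear_map_free_ext[OF P multilinear_Pi])

lemma free_ext_free_gen_words:
  assumes "set xs \<subseteq> carrier M" "set ys \<subseteq> carrier M" "set zs \<subseteq> carrier M"
    "length xs + length ys + length zs = k"
  shows "free_gen R (xs @ zs @ ys) \<in> carrier (free_words R k M)"
    "free_ext R P g (free_gen R (xs @ zs @ ys)) = g (xs @ zs @ ys)"
    "g (xs @ zs @ ys) \<in> carrier P"
proof -
  have w: "xs @ zs @ ys \<in> words M k" using assms by (intro words_appendI) simp_all
  show "free_gen R (xs @ zs @ ys) \<in> carrier (free_words R k M)"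
    by (rule free_gen_closed[OF M.is_cring w])
  show "free_ext R P g (free_gen R (xs @ zs @ ys)) = g (xs @ zs @ ys)"
    by (rule free_ext_free_gen[OF P multilinear_Pi w])
  show "g (xs @ zs @ ys) \<in> carrier P" by (rule multilinearD(1)[OF g w])
qed

text \<open>A multilinear map factors through the tensor power, and if it is balanced also through
  the tensor power over \<open>A\<close>.\<close>

lemma multilinear_kills_rels:
  assumes "z \<in> multilinear_rels R k M"
  shows "free_ext R P g z = \<zero>\<^bsub>P\<^esub>"
proof -
  note lin = linear_free_ext_words
  note minus = linear_map_minus[OF F.module_axioms P lin]
  from assms consider
    (add) xs ys a b where "z = free_gen R (xs @ [a \<oplus>\<^bsub>M\<^esub> b] @ ys)
        \<ominus>\<^bsub>free_words R k M\<^esub> free_gen R (xs @ [a] @ ys)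
        \<ominus>\<^bsub>free_words R k M\<^esub> free_gen R (xs @ [b] @ ys)"
      "set xs \<subseteq> carrier M" "set ys \<subseteq> carrier M" "a \<in> carrier M" "b \<in> carrier M"
      "length xs + length ys + 1 = k"
  | (smult) xs ys a r where "z = free_gen R (xs @ [r \<odot>\<^bsub>M\<^esub> a] @ ys)
        \<ominus>\<^bsub>free_words R k M\<^esub> r \<odot>\<^bsub>free_words R k M\<^esub> free_gen R (xs @ [a] @ ys)"
      "set xs \<subseteq> carrier M" "set ys \<subseteq> carrier M" "a \<in> carrier M" "r \<in> carrier R"
      "length xs + length ys + 1 = k"
    unfolding multilinear_rels_def by blast
  then show ?thesis
  proof cases
    case add
    note gl = linear_mapD(2)[OF multilinearD(2)[OF g add(2,3,6)] add(4,5)]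
    have G: "free_gen R (xs @ [c] @ ys) \<in> carrier (free_words R k M)"
      "free_ext R P g (free_gen R (xs @ [c] @ ys)) = g (xs @ [c] @ ys)"
      "g (xs @ [c] @ ys) \<in> carrier P" if "c \<in> carrier M" for c
      using that add(6) by (intro free_ext_free_gen_words add(2,3); simp)+
    have ab: "a \<oplus>\<^bsub>M\<^esub> b \<in> carrier M" using add(4,5) by simp
    have "free_ext R P g z
        = g (xs @ [a \<oplus>\<^bsub>M\<^esub> b] @ ys) \<ominus>\<^bsub>P\<^esub> g (xs @ [a] @ ys) \<ominus>\<^bsub>P\<^esub> g (xs @ [b] @ ys)"
      unfolding add(1) minus[OF F.minus_closed[OF G(1)[OF ab] G(1)[OF add(4)]] G(1)[OF add(5)]]
        minus[OF G(1)[OF ab] G(1)[OF add(4)]] G(2)[OF ab] G(2)[OF add(4)] G(2)[OF add(5)] ..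
    also have "\<dots> = \<zero>\<^bsub>P\<^esub>"
      unfolding gl using G(3)[OF add(4)] G(3)[OF add(5)]
      by (subst P.minus_minus_eq) (simp_all add: a_minus_def P.r_neg)
    finally show ?thesis .
  next
    case smult
    note gl = linear_mapD(3)[OF multilinearD(2)[OF g smult(2,3,6)] smult(5,4)]
    have G: "free_gen R (xs @ [c] @ ys) \<in> carrier (free_words R k M)"
      "free_ext R P g (free_gen R (xs @ [c] @ ys)) = g (xs @ [c] @ ys)"
      "g (xs @ [c] @ ys) \<in> carrier P" if "c \<in> carrier M" for c
      using that smult(6) by (intro free_ext_free_gen_words smult(2,3); simp)+
    have ra: "r \<odot>\<^bsub>M\<^esub> a \<in> carrier M" using smult(4,5) by simp
    have "free_ext R P g z = g (xs @ [r \<odot>\<^bsub>M\<^esub> a] @ ys) \<ominus>\<^bsub>P\<^esub> r \<odot>\<^bsub>P\<^esub> g (xs @ [a] @ ys)"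
      unfolding smult(1) minus[OF G(1)[OF ra] F.smult_closed[OF smult(5) G(1)[OF smult(4)]]]
        linear_mapD(3)[OF lin smult(5) G(1)[OF smult(4)]] G(2)[OF ra] G(2)[OF smult(4)] ..
    also have "\<dots> = \<zero>\<^bsub>P\<^esub>"
      unfolding gl a_minus_def using G(3)[OF smult(4)] smult(5) by (simp add: P.r_neg)
    finally show ?thesis .
  qed
qed

lemma multilinear_kills_balanced:
  assumes "z \<in> balanced_rels R A lact ract k M"
    and "\<And>m a. \<lbrakk>m \<in> carrier M; a \<in> A\<rbrakk> \<Longrightarrow> lact a m \<in> carrier M"
    and "\<And>m a. \<lbrakk>m \<in> carrier M; a \<in> A\<rbrakk> \<Longrightarrow> ract m a \<in> carrier M"
    and "\<And>xs ys m m' a. \<lbrakk>set xs \<subseteq> carrier M; set ys \<subseteq> carrier M; m \<in> carrier M; m' \<in> carrier M;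
        a \<in> A; length xs + length ys + 2 = k\<rbrakk> \<Longrightarrow>
      g (xs @ [ract m a, m'] @ ys) = g (xs @ [m, lact a m'] @ ys)"
  shows "free_ext R P g z = \<zero>\<^bsub>P\<^esub>"
proof -
  note lin = linear_free_ext_words
  from assms(1) obtain xs ys m m' a where z: "z = free_gen R (xs @ [ract m a, m'] @ ys)
        \<ominus>\<^bsub>free_words R k M\<^esub> free_gen R (xs @ [m, lact a m'] @ ys)"
    and *: "set xs \<subseteq> carrier M" "set ys \<subseteq> carrier M" "m \<in> carrier M" "m' \<in> carrier M"
      "a \<in> A" "length xs + length ys + 2 = k"
    unfolding balanced_rels_def by blast
  have 1: "set [ract m a, m'] \<subseteq> carrier M" "length xs + length ys + length [ract m a, m'] = k"
    and 2: "set [m, lact a m'] \<subseteq> carrier M" "length xs + length ys + length [m, lact a m'] = k"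
    using assms(2,3) * by simp_all
  note G1 = free_ext_free_gen_words[OF *(1,2) 1] and G2 = free_ext_free_gen_words[OF *(1,2) 2]
  have "free_ext R P g z = g (xs @ [ract m a, m'] @ ys) \<ominus>\<^bsub>P\<^esub> g (xs @ [m, lact a m'] @ ys)"
    unfolding z linear_map_minus[OF F.module_axioms P lin G1(1) G2(1)] G1(2) G2(2) ..
  then show ?thesis
    unfolding assms(4)[OF *] a_minus_def using P.r_neg[OF G2(3)] by simp
qed

lemma linear_map_tensor_ext: "linear_map R (tensor_power R k M) P (quot_ext R P g)"
  unfolding tensor_power_def tensor_rels_def
  by (rule linear_map_quot_ext[OF M.is_cring multilinear_rels_subset P multilinear_Pi
        multilinear_kills_rels])

lemma tensor_ext_gen:
  "xs \<in> words M k \<Longrightarrow> quot_ext R P g (tensor_rels R k M +>\<^bsub>free_words R k M\<^esub> free_gen R xs) = g xs"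
  unfolding tensor_rels_def
  by (rule quot_ext_gen[OF M.is_cring multilinear_rels_subset P multilinear_Pi
        multilinear_kills_rels])

end

lemma module_tensor_power: "module R (tensor_power R k M)"
  unfolding tensor_power_def tensor_rels_def
  by (rule module_presented[OF M.is_cring multilinear_rels_subset])

lemma tensor_gen_closed:
  "xs \<in> words M k \<Longrightarrow>
    tensor_rels R k M +>\<^bsub>free_words R k M\<^esub> free_gen R xs \<in> carrier (tensor_power R k M)"
  unfolding tensor_power_def tensor_rels_def
  by (rule presented_gen_closed[OF M.is_cring multilinear_rels_subset])

lemma span_tensor_power:
  "submod_span R (tensor_power R k M)
     ((\<lambda>xs. tensor_rels R k M +>\<^bsub>free_words R k M\<^esub> free_gen R xs) ` words M k)
   = carrier (tensor_power R k M)"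
  unfolding tensor_power_def tensor_rels_def
  by (rule span_presented[OF M.is_cring multilinear_rels_subset])

lemma multilinear_tensor_gen:
  "multilinear R k M (tensor_power R k M)
    (\<lambda>xs. tensor_rels R k M +>\<^bsub>free_words R k M\<^esub> free_gen R xs)"
proof (rule multilinearI)
  interpret Q: module R "tensor_power R k M" by (rule module_tensor_power)
  let ?q = "\<lambda>f. tensor_rels R k M +>\<^bsub>free_words R k M\<^esub> f"
  fix xs ys assume *: "set xs \<subseteq> carrier M" "set ys \<subseteq> carrier M" "length xs + length ys + 1 = k"
  have N: "submodule (tensor_rels R k M) R (free_words R k M)"
    unfolding tensor_rels_def by (rule submodule_span[OF F.module_axioms multilinear_rels_subset])
  have lin: "linear_map R (free_words R k M) (tensor_power R k M) ?q"
    unfolding tensor_power_def by (rule linear_map_quot[OF F.module_axioms N])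
  note minus = linear_map_minus[OF F.module_axioms Q.module_axioms lin]
  have z: "?q f = \<zero>\<^bsub>tensor_power R k M\<^esub>" if "f \<in> multilinear_rels R k M" for f
    unfolding tensor_power_def
    by (rule coset_eq_zero[OF F.module_axioms N]) (simp add: tensor_rels_def span_inc that)
  have G: "free_gen R (xs @ [c] @ ys) \<in> carrier (free_words R k M)" if "c \<in> carrier M" for c
    using that * by (intro free_gen_closed[OF M.is_cring]) (simp add: words_def)
  have Q: "?q (free_gen R (xs @ [c] @ ys)) \<in> carrier (tensor_power R k M)" if "c \<in> carrier M" for c
    by (rule linear_mapD(1)[OF lin G[OF that]])
  show "linear_map R M (tensor_power R k M) (\<lambda>a. ?q (free_gen R (xs @ [a] @ ys)))"
  proof (rule linear_mapI)
    fix a b assume a: "a \<in> carrier M" and b: "b \<in> carrier M"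
    have ab: "a \<oplus>\<^bsub>M\<^esub> b \<in> carrier M" using a b by simp
    have "?q (free_gen R (xs @ [a \<oplus>\<^bsub>M\<^esub> b] @ ys) \<ominus>\<^bsub>free_words R k M\<^esub> free_gen R (xs @ [a] @ ys)
        \<ominus>\<^bsub>free_words R k M\<^esub> free_gen R (xs @ [b] @ ys)) = \<zero>\<^bsub>tensor_power R k M\<^esub>"
      by (rule z) (use * a b in \<open>unfold multilinear_rels_def, blast\<close>)
    then have "?q (free_gen R (xs @ [a \<oplus>\<^bsub>M\<^esub> b] @ ys)) \<ominus>\<^bsub>tensor_power R k M\<^esub>
        ?q (free_gen R (xs @ [a] @ ys)) \<ominus>\<^bsub>tensor_power R k M\<^esub> ?q (free_gen R (xs @ [b] @ ys))
        = \<zero>\<^bsub>tensor_power R k M\<^esub>"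
      by (simp only: minus[OF F.minus_closed[OF G[OF ab] G[OF a]] G[OF b]] minus[OF G[OF ab] G[OF a]])
    then show "?q (free_gen R (xs @ [a \<oplus>\<^bsub>M\<^esub> b] @ ys)) =
        ?q (free_gen R (xs @ [a] @ ys)) \<oplus>\<^bsub>tensor_power R k M\<^esub> ?q (free_gen R (xs @ [b] @ ys))"
      unfolding Q.minus_minus_eq[OF Q[OF ab] Q[OF a] Q[OF b]]
      by (rule Q.minus_eq_zeroD[OF Q[OF ab] Q.a_closed[OF Q[OF a] Q[OF b]]])
  next
    fix r a assume r: "r \<in> carrier R" and a: "a \<in> carrier M"
    have ra: "r \<odot>\<^bsub>M\<^esub> a \<in> carrier M" using r a by simp
    have "?q (free_gen R (xs @ [r \<odot>\<^bsub>M\<^esub> a] @ ys) \<ominus>\<^bsub>free_words R k M\<^esub>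
        r \<odot>\<^bsub>free_words R k M\<^esub> free_gen R (xs @ [a] @ ys)) = \<zero>\<^bsub>tensor_power R k M\<^esub>"
      by (rule z) (use * a r in \<open>unfold multilinear_rels_def, blast\<close>)
    then have "?q (free_gen R (xs @ [r \<odot>\<^bsub>M\<^esub> a] @ ys)) \<ominus>\<^bsub>tensor_power R k M\<^esub>
        r \<odot>\<^bsub>tensor_power R k M\<^esub> ?q (free_gen R (xs @ [a] @ ys)) = \<zero>\<^bsub>tensor_power R k M\<^esub>"
      by (simp only: minus[OF G[OF ra] F.smult_closed[OF r G[OF a]]] linear_mapD(3)[OF lin r G[OF a]])
    then show "?q (free_gen R (xs @ [r \<odot>\<^bsub>M\<^esub> a] @ ys)) =
        r \<odot>\<^bsub>tensor_power R k M\<^esub> ?q (free_gen R (xs @ [a] @ ys))"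
      by (rule Q.minus_eq_zeroD[OF Q[OF ra] Q.smult_closed[OF r Q[OF a]]])
  qed (rule Q)
qed (rule tensor_gen_closed)

end


section \<open>The graded algebra of tensors\<close>

text \<open>A commutative algebra \<open>A\<close> over \<open>R\<close>, with short names for the structure of \<open>T\<^sup>*(A)\<close>.  Injectivity
  of the structure map is assumed only where the structure map of \<open>T\<^sup>*(A)\<close> is discussed.\<close>

locale algebra_tensors =
  fixes R :: "('r, 'm) ring_scheme" and A :: "('r, 'a, 'n) module_scheme"
  assumes algebra: "algebra R A"
begin

sublocale R: cring R by (rule algebra.R_cring[OF algebra])
sublocale A: cring A by (rule algebra.M_cring[OF algebra])

lemma module_A: "module R A" by (rule algebra.module[OF algebra])

lemma linear_mult_right:
  assumes "c \<in> carrier A"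
  shows "linear_map R A A (\<lambda>a. a \<otimes>\<^bsub>A\<^esub> c)"
  using assms by (intro linear_mapI) (simp_all add: A.l_distr algebra.smult_assoc2[OF algebra])

sublocale T: module R "TA R A n" for n
  unfolding TA_def by (rule module_tensor_power[OF module_A])

abbreviation "T \<equiv> TA R A"
abbreviation "pure \<equiv> TA_pure R A"
abbreviation "cup \<equiv> TA_cup R A"
abbreviation "diff \<equiv> TA_diff R A"
abbreviation "cup1 \<equiv> TA_cup1 R A"

lemmas T_module = T.module_axioms

lemma pure_closed: "xs \<in> words A (n + 1) \<Longrightarrow> pure n xs \<in> carrier (T n)"
  unfolding TA_def TA_pure_def by (rule tensor_gen_closed[OF module_A])

lemma pure_image_subset: "pure n ` words A (n + 1) \<subseteq> carrier (T n)"
  using pure_closed by blast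

lemma span_pure: "submod_span R (T n) (pure n ` words A (n + 1)) = carrier (T n)"
  using span_tensor_power[OF module_A] unfolding TA_def TA_pure_def .

lemma multilinear_pure: "multilinear R (n + 1) A (T n) (pure n)"
  using multilinear_tensor_gen[OF module_A] unfolding TA_def TA_pure_def .

lemma linear_T_ext:
  "\<lbrakk>module R P; multilinear R (n + 1) A P g\<rbrakk> \<Longrightarrow> linear_map R (T n) P (quot_ext R P g)"
  unfolding TA_def by (rule linear_map_tensor_ext[OF module_A])

lemma T_ext_pure:
  "\<lbrakk>module R P; multilinear R (n + 1) A P g; xs \<in> words A (n + 1)\<rbrakk> \<Longrightarrow>
    quot_ext R P g (pure n xs) = g xs"
  unfolding TA_pure_def by (rule tensor_ext_gen[OF module_A])

lemma linear_T_eqI: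
  assumes "module R P" "linear_map R (T n) P f" "linear_map R (T n) P g"
    and "\<And>xs. xs \<in> words A (n + 1) \<Longrightarrow> f (pure n xs) = g (pure n xs)"
    and "X \<in> carrier (T n)"
  shows "f X = g X"
proof (rule linear_map_eq_on_span[OF T_module assms(1-3) pure_image_subset])
  show "X \<in> submod_span R (T n) (pure n ` words A (n + 1))" unfolding span_pure by (rule assms(5))
qed (use assms(4) in auto)

lemma linear_T_intoI:
  assumes "module R P" "linear_map R (T n) P f" "submodule H R P"
    and "\<And>xs. xs \<in> words A (n + 1) \<Longrightarrow> f (pure n xs) \<in> H"
    and "X \<in> carrier (T n)"
  shows "f X \<in> H"
proof (rule linear_map_span_into[OF T_module assms(1-3) pure_image_subset])
  show "X \<in> submod_span R (T n) (pure n ` words A (n + 1))" unfolding span_pure by (rule assms(5))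
qed (use assms(4) in auto)

lemma bilinear_T_eqI:
  assumes "module R P" "bilinear_map R (T p) (T q) P f" "bilinear_map R (T p) (T q) P g"
    and "\<And>xs ys. \<lbrakk>xs \<in> words A (p + 1); ys \<in> words A (q + 1)\<rbrakk> \<Longrightarrow>
      f (pure p xs) (pure q ys) = g (pure p xs) (pure q ys)"
    and "X \<in> carrier (T p)" "Y \<in> carrier (T q)"
  shows "f X Y = g X Y"
proof (rule bilinear_map_eq_on_span[OF T_module T_module assms(1-3) pure_image_subset pure_image_subset])
  show "X \<in> submod_span R (T p) (pure p ` words A (p + 1))" unfolding span_pure by (rule assms(5))
  show "Y \<in> submod_span R (T q) (pure q ` words A (q + 1))" unfolding span_pure by (rule assms(6))
qed (use assms(4) in auto)

text \<open>Extension in two variables.  The inner extension is linear in \<open>Y\<close>; its multilinearity in the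
  word \<open>xs\<close> holds for pure \<open>Y\<close> by assumption, and hence for all \<open>Y\<close> because these span.\<close>

lemma T_ext2:
  assumes P: "module R P"
    and right: "\<And>xs. xs \<in> words A (p + 1) \<Longrightarrow> multilinear R (q + 1) A P (g xs)"
    and left: "\<And>ys. ys \<in> words A (q + 1) \<Longrightarrow> multilinear R (p + 1) A P (\<lambda>xs. g xs ys)"
  shows "bilinear_map R (T p) (T q) P (\<lambda>X Y. quot_ext R P (\<lambda>xs. quot_ext R P (g xs) Y) X)"
    and "\<lbrakk>xs \<in> words A (p + 1); ys \<in> words A (q + 1)\<rbrakk> \<Longrightarrow>
      quot_ext R P (\<lambda>xs. quot_ext R P (g xs) (pure q ys)) (pure p xs) = g xs ys"
proof -
  interpret P: module R P by (rule P)
  define h where "h xs = quot_ext R P (g xs)" for xs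
  have h_lin: "linear_map R (T q) P (h xs)" if "xs \<in> words A (p + 1)" for xs
    unfolding h_def by (rule linear_T_ext[OF P right[OF that]])
  have h_pure: "h xs (pure q ys) = g xs ys" if "xs \<in> words A (p + 1)" "ys \<in> words A (q + 1)" for xs ys
    unfolding h_def by (rule T_ext_pure[OF P right[OF that(1)] that(2)])
  have h_mult: "multilinear R (p + 1) A P (\<lambda>xs. h xs Y)" if Y: "Y \<in> carrier (T q)" for Y
  proof (rule multilinearI)
    show "h xs Y \<in> carrier P" if "xs \<in> words A (p + 1)" for xs
      by (rule linear_mapD(1)[OF h_lin[OF that] Y])
  next
    fix us vs assume uv: "set us \<subseteq> carrier A" "set vs \<subseteq> carrier A" "length us + length vs + 1 = p + 1"
    have w: "us @ [a] @ vs \<in> words A (p + 1)" if "a \<in> carrier A" for a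
      using that uv by (simp add: words_def)
    note gl = linear_mapD[OF multilinearD(2)[OF left uv]]
    show "linear_map R A P (\<lambda>a. h (us @ [a] @ vs) Y)"
    proof (rule linear_mapI)
      show "h (us @ [a] @ vs) Y \<in> carrier P" if "a \<in> carrier A" for a
        by (rule linear_mapD(1)[OF h_lin[OF w[OF that]] Y])
    next
      fix a b assume ab: "a \<in> carrier A" "b \<in> carrier A"
      have ab': "a \<oplus>\<^bsub>A\<^esub> b \<in> carrier A" using ab by simp
      show "h (us @ [a \<oplus>\<^bsub>A\<^esub> b] @ vs) Y = h (us @ [a] @ vs) Y \<oplus>\<^bsub>P\<^esub> h (us @ [b] @ vs) Y"
      proof (rule linear_T_eqI[OF P h_lin[OF w[OF ab']] _ _ Y])
        show "linear_map R (T q) P (\<lambda>Y. h (us @ [a] @ vs) Y \<oplus>\<^bsub>P\<^esub> h (us @ [b] @ vs) Y)"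
          by (rule linear_map_add[OF P h_lin[OF w[OF ab(1)]] h_lin[OF w[OF ab(2)]]])
      next
        fix ys assume ys: "ys \<in> words A (q + 1)"
        show "h (us @ [a \<oplus>\<^bsub>A\<^esub> b] @ vs) (pure q ys)
            = h (us @ [a] @ vs) (pure q ys) \<oplus>\<^bsub>P\<^esub> h (us @ [b] @ vs) (pure q ys)"
          unfolding h_pure[OF w[OF ab'] ys] h_pure[OF w[OF ab(1)] ys] h_pure[OF w[OF ab(2)] ys]
          by (rule gl(2)[OF ys ab])
      qed
    next
      fix r a assume r: "r \<in> carrier R" and a: "a \<in> carrier A"
      have ra: "r \<odot>\<^bsub>A\<^esub> a \<in> carrier A" using r a by (rule module.smult_closed[OF module_A])
      show "h (us @ [r \<odot>\<^bsub>A\<^esub> a] @ vs) Y = r \<odot>\<^bsub>P\<^esub> h (us @ [a] @ vs) Y"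
      proof (rule linear_T_eqI[OF P h_lin[OF w[OF ra]] _ _ Y])
        show "linear_map R (T q) P (\<lambda>Y. r \<odot>\<^bsub>P\<^esub> h (us @ [a] @ vs) Y)"
          by (rule linear_map_smult[OF P h_lin[OF w[OF a]] r])
      next
        fix ys assume ys: "ys \<in> words A (q + 1)"
        show "h (us @ [r \<odot>\<^bsub>A\<^esub> a] @ vs) (pure q ys) = r \<odot>\<^bsub>P\<^esub> h (us @ [a] @ vs) (pure q ys)"
          unfolding h_pure[OF w[OF ra] ys] h_pure[OF w[OF a] ys] by (rule gl(3)[OF ys r a])
      qed
    qed
  qed
  show "bilinear_map R (T p) (T q) P (\<lambda>X Y. quot_ext R P (\<lambda>xs. quot_ext R P (g xs) Y) X)"
    unfolding bilinear_map_def h_def[symmetric]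
  proof (intro conjI ballI)
    fix Y assume Y: "Y \<in> carrier (T q)"
    show "linear_map R (T p) P (quot_ext R P (\<lambda>xs. h xs Y))"
      by (rule linear_T_ext[OF P h_mult[OF Y]])
  next
    fix X assume X: "X \<in> carrier (T p)"
    show "linear_map R (T q) P (\<lambda>Y. quot_ext R P (\<lambda>xs. h xs Y) X)"
    proof (rule linear_mapI)
      show "quot_ext R P (\<lambda>xs. h xs Y) X \<in> carrier P" if "Y \<in> carrier (T q)" for Y
        by (rule linear_mapD(1)[OF linear_T_ext[OF P h_mult[OF that]] X])
    next
      fix Y Z assume YZ: "Y \<in> carrier (T q)" "Z \<in> carrier (T q)"
      have s: "Y \<oplus>\<^bsub>T q\<^esub> Z \<in> carrier (T q)" using YZ by (rule T.a_closed)
      show "quot_ext R P (\<lambda>xs. h xs (Y \<oplus>\<^bsub>T q\<^esub> Z)) X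
          = quot_ext R P (\<lambda>xs. h xs Y) X \<oplus>\<^bsub>P\<^esub> quot_ext R P (\<lambda>xs. h xs Z) X"
      proof (rule linear_T_eqI[OF P linear_T_ext[OF P h_mult[OF s]]
            linear_map_add[OF P linear_T_ext[OF P h_mult[OF YZ(1)]] linear_T_ext[OF P h_mult[OF YZ(2)]]] _ X])
        fix xs assume xs: "xs \<in> words A (p + 1)"
        show "quot_ext R P (\<lambda>xs. h xs (Y \<oplus>\<^bsub>T q\<^esub> Z)) (pure p xs)
            = quot_ext R P (\<lambda>xs. h xs Y) (pure p xs) \<oplus>\<^bsub>P\<^esub> quot_ext R P (\<lambda>xs. h xs Z) (pure p xs)"
          unfolding T_ext_pure[OF P h_mult[OF s] xs] T_ext_pure[OF P h_mult[OF YZ(1)] xs]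
            T_ext_pure[OF P h_mult[OF YZ(2)] xs]
          by (rule linear_mapD(2)[OF h_lin[OF xs] YZ])
      qed
    next
      fix r Y assume r: "r \<in> carrier R" and Y: "Y \<in> carrier (T q)"
      have s: "r \<odot>\<^bsub>T q\<^esub> Y \<in> carrier (T q)" using r Y by (rule T.smult_closed)
      show "quot_ext R P (\<lambda>xs. h xs (r \<odot>\<^bsub>T q\<^esub> Y)) X = r \<odot>\<^bsub>P\<^esub> quot_ext R P (\<lambda>xs. h xs Y) X"
      proof (rule linear_T_eqI[OF P linear_T_ext[OF P h_mult[OF s]]
            linear_map_smult[OF P linear_T_ext[OF P h_mult[OF Y]] r] _ X])
        fix xs assume xs: "xs \<in> words A (p + 1)"
        show "quot_ext R P (\<lambda>xs. h xs (r \<odot>\<^bsub>T q\<^esub> Y)) (pure p xs)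
            = r \<odot>\<^bsub>P\<^esub> quot_ext R P (\<lambda>xs. h xs Y) (pure p xs)"
          unfolding T_ext_pure[OF P h_mult[OF s] xs] T_ext_pure[OF P h_mult[OF Y] xs]
          by (rule linear_mapD(3)[OF h_lin[OF xs] r Y])
      qed
    qed
  qed
  assume xs: "xs \<in> words A (p + 1)" and ys: "ys \<in> words A (q + 1)"
  show "quot_ext R P (\<lambda>xs. quot_ext R P (g xs) (pure q ys)) (pure p xs) = g xs ys"
    unfolding h_def[symmetric] T_ext_pure[OF P h_mult[OF pure_closed[OF ys]] xs]
    by (rule h_pure[OF xs ys])
qed


text \<open>
  A function from letters to words is a slot if the letter \<open>a\<close> enters the word in exactly one place,
  multiplied by a fixed \<open>c\<close>.  All operations on words that occur below are slots in each letter of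
  each argument.  Slots are stable under cup products with a fixed word, and composing such an operation with
  \<open>pure\<close> gives a multilinear map (\<open>multilinear_slot\<close>).
\<close>

definition slot :: "('a \<Rightarrow> 'a list) \<Rightarrow> bool"
  where "slot f \<longleftrightarrow> (\<exists>us vs c. set us \<subseteq> carrier A \<and> set vs \<subseteq> carrier A \<and> c \<in> carrier A \<and>
    (\<forall>a\<in>carrier A. f a = us @ [a \<otimes>\<^bsub>A\<^esub> c] @ vs))"

lemma slotI:
  assumes "set us \<subseteq> carrier A" "set vs \<subseteq> carrier A" "c \<in> carrier A"
    "\<And>a. a \<in> carrier A \<Longrightarrow> f a = us @ [a \<otimes>\<^bsub>A\<^esub> c] @ vs"
  shows "slot f"
  unfolding slot_def using assms by blast

lemma slot_base:
  assumes "set us \<subseteq> carrier A" "set vs \<subseteq> carrier A"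
  shows "slot (\<lambda>a. us @ [a] @ vs)"
  by (rule slotI[OF assms A.one_closed]) simp

lemma slot_cup_left:
  assumes "slot f" "set ys \<subseteq> carrier A" "ys \<noteq> []"
  shows "slot (\<lambda>a. cup_word A (f a) ys)"
proof -
  from assms(1) obtain us vs c where f: "set us \<subseteq> carrier A" "set vs \<subseteq> carrier A" "c \<in> carrier A"
    "\<And>a. a \<in> carrier A \<Longrightarrow> f a = us @ [a \<otimes>\<^bsub>A\<^esub> c] @ vs"
    unfolding slot_def by blast
  from assms(3) obtain b ws where ys: "ys = b # ws" by (cases ys) auto
  show ?thesis
  proof (cases vs rule: rev_cases)
    case Nil
    then show ?thesis
      using f(1-3) assms(2) ys
      by (intro slotI[of us ws "c \<otimes>\<^bsub>A\<^esub> b"]) (simp_all add: f(4) cup_word_def A.m_assoc)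
  next
    case (snoc vs' v)
    then show ?thesis
      using f(1-3) assms(2) ys
      by (intro slotI[of us "vs' @ [v \<otimes>\<^bsub>A\<^esub> b] @ ws" c]) (simp_all add: f(4) cup_word_def butlast_append)
  qed
qed

lemma slot_cup_right:
  assumes "slot f" "set xs \<subseteq> carrier A" "xs \<noteq> []"
  shows "slot (\<lambda>a. cup_word A xs (f a))"
proof -
  from assms(1) obtain us vs c where f: "set us \<subseteq> carrier A" "set vs \<subseteq> carrier A" "c \<in> carrier A"
    "\<And>a. a \<in> carrier A \<Longrightarrow> f a = us @ [a \<otimes>\<^bsub>A\<^esub> c] @ vs"
    unfolding slot_def by blast
  from assms(3) obtain b ws where xs: "xs = ws @ [b]" by (cases xs rule: rev_cases) auto
  show ?thesis
  proof (cases us)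
    case Nil
    then show ?thesis
      using f(1-3) assms(2) xs
      by (intro slotI[of ws vs "c \<otimes>\<^bsub>A\<^esub> b"]) (simp_all add: f(4) cup_word_def A.m_ac)
  next
    case (Cons u us')
    then show ?thesis
      using f(1-3) assms(2) xs
      by (intro slotI[of "ws @ [b \<otimes>\<^bsub>A\<^esub> u] @ us'" vs c]) (simp_all add: f(4) cup_word_def)
  qed
qed

lemma multilinear_slot:
  assumes "\<And>xs. xs \<in> words A k \<Longrightarrow> \<phi> xs \<in> words A (n + 1)"
    and "\<And>us vs. \<lbrakk>set us \<subseteq> carrier A; set vs \<subseteq> carrier A; length us + length vs + 1 = k\<rbrakk> \<Longrightarrow>
      slot (\<lambda>a. \<phi> (us @ [a] @ vs))"
  shows "multilinear R k A (T n) (\<lambda>xs. pure n (\<phi> xs))"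
proof (rule multilinearI)
  show "pure n (\<phi> xs) \<in> carrier (T n)" if "xs \<in> words A k" for xs
    by (rule pure_closed[OF assms(1)[OF that]])
  fix us vs assume uv: "set us \<subseteq> carrier A" "set vs \<subseteq> carrier A" "length us + length vs + 1 = k"
  from assms(2)[OF uv] obtain us' vs' c where \<phi>: "set us' \<subseteq> carrier A" "set vs' \<subseteq> carrier A"
    "c \<in> carrier A" "\<And>a. a \<in> carrier A \<Longrightarrow> \<phi> (us @ [a] @ vs) = us' @ [a \<otimes>\<^bsub>A\<^esub> c] @ vs'"
    unfolding slot_def by blast
  have "us @ [\<one>\<^bsub>A\<^esub>] @ vs \<in> words A k" using uv by (simp add: words_def)
  from assms(1)[OF this] have "length us' + length vs' + 1 = n + 1"
    using \<phi>(4)[OF A.one_closed] by (simp add: words_def)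
  from linear_map_compose[OF linear_mult_right[OF \<phi>(3)] multilinearD(2)[OF multilinear_pure \<phi>(1,2) this]]
  have lin: "linear_map R A (T n) (\<lambda>a. pure n (us' @ [a \<otimes>\<^bsub>A\<^esub> c] @ vs'))" .
  show "linear_map R A (T n) (\<lambda>a. pure n (\<phi> (us @ [a] @ vs)))"
  proof (rule linear_mapI)
    show "pure n (\<phi> (us @ [a] @ vs)) \<in> carrier (T n)" if "a \<in> carrier A" for a
      unfolding \<phi>(4)[OF that] by (rule linear_mapD(1)[OF lin that])
    show "pure n (\<phi> (us @ [a \<oplus>\<^bsub>A\<^esub> b] @ vs)) =
        pure n (\<phi> (us @ [a] @ vs)) \<oplus>\<^bsub>T n\<^esub> pure n (\<phi> (us @ [b] @ vs))"
      if "a \<in> carrier A" "b \<in> carrier A" for a b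
      unfolding \<phi>(4)[OF that(1)] \<phi>(4)[OF that(2)] \<phi>(4)[OF A.a_closed[OF that]]
      by (rule linear_mapD(2)[OF lin that])
    show "pure n (\<phi> (us @ [r \<odot>\<^bsub>A\<^esub> a] @ vs)) = r \<odot>\<^bsub>T n\<^esub> pure n (\<phi> (us @ [a] @ vs))"
      if "r \<in> carrier R" "a \<in> carrier A" for a r
      unfolding \<phi>(4)[OF that(2)] \<phi>(4)[OF module.smult_closed[OF module_A that]]
      by (rule linear_mapD(3)[OF lin that])
  qed
qed

lemma words_nonempty: "xs \<in> words A (k + 1) \<Longrightarrow> set xs \<subseteq> carrier A \<and> xs \<noteq> []"
  by (auto simp: words_def)

lemma cup_word_closed:
  assumes "xs \<in> words A (p + 1)" "ys \<in> words A (q + 1)"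
  shows "cup_word A xs ys \<in> words A (p + q + 1)"
proof -
  obtain us a where "xs = us @ [a]" using words_nonempty[OF assms(1)] by (cases xs rule: rev_cases) auto
  moreover obtain b vs where "ys = b # vs" using words_nonempty[OF assms(2)] by (cases ys) auto
  ultimately show ?thesis using assms by (simp add: words_def cup_word_def)
qed

lemma cup_word_assoc:
  assumes "xs \<in> words A (p + 1)" "ys \<in> words A (q + 1)" "zs \<in> words A (s + 1)"
  shows "cup_word A (cup_word A xs ys) zs = cup_word A xs (cup_word A ys zs)"
proof -
  obtain us a where x: "xs = us @ [a]" using words_nonempty[OF assms(1)] by (cases xs rule: rev_cases) auto
  obtain b vs where y: "ys = b # vs" using words_nonempty[OF assms(2)] by (cases ys) auto
  obtain c ws where z: "zs = c # ws" using words_nonempty[OF assms(3)] by (cases zs) auto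
  have "a \<in> carrier A" "b \<in> carrier A" "c \<in> carrier A" using assms x y z by (simp_all add: words_def)
  then show ?thesis
    unfolding x y z by (cases vs rule: rev_cases) (simp_all add: cup_word_def A.m_assoc butlast_append)
qed

lemma cup_bilinear: "bilinear_map R (T p) (T q) (T (p + q)) (cup p q)"
  and cup_pure: "\<lbrakk>xs \<in> words A (p + 1); ys \<in> words A (q + 1)\<rbrakk> \<Longrightarrow>
    cup p q (pure p xs) (pure q ys) = pure (p + q) (cup_word A xs ys)"
proof -
  have right: "multilinear R (q + 1) A (T (p + q)) (\<lambda>ys. pure (p + q) (cup_word A xs ys))"
    if "xs \<in> words A (p + 1)" for xs
    using words_nonempty[OF that]
    by (intro multilinear_slot cup_word_closed[OF that] slot_cup_right slot_base) blast+
  have left: "multilinear R (p + 1) A (T (p + q)) (\<lambda>xs. pure (p + q) (cup_word A xs ys))"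
    if "ys \<in> words A (q + 1)" for ys
    using words_nonempty[OF that]
    by (intro multilinear_slot cup_word_closed[OF _ that] slot_cup_left slot_base) blast+
  show "bilinear_map R (T p) (T q) (T (p + q)) (cup p q)"
    unfolding TA_cup_def by (rule T_ext2(1)[OF T_module right left])
  show "cup p q (pure p xs) (pure q ys) = pure (p + q) (cup_word A xs ys)"
    if "xs \<in> words A (p + 1)" "ys \<in> words A (q + 1)"
    unfolding TA_cup_def by (rule T_ext2(2)[OF T_module right left that])
qed

lemma cup_closed: "\<lbrakk>X \<in> carrier (T p); Y \<in> carrier (T q)\<rbrakk> \<Longrightarrow> cup p q X Y \<in> carrier (T (p + q))"
  by (rule bilinear_map_closed[OF cup_bilinear])

lemma cup_assoc:
  assumes X: "X \<in> carrier (T p)" and Y: "Y \<in> carrier (T q)" and Z: "Z \<in> carrier (T s)"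
  shows "cup (p + q) s (cup p q X Y) Z = cup p (q + s) X (cup q s Y Z)"
proof -
  \<comment> \<open>The identity is extended from pure tensors first in \<open>Z\<close>, then in \<open>X\<close> and \<open>Y\<close> jointly.\<close>
  have pure: "cup (p + q) s (cup p q (pure p xs) (pure q ys)) (pure s zs)
      = cup p (q + s) (pure p xs) (cup q s (pure q ys) (pure s zs))"
    if "xs \<in> words A (p + 1)" "ys \<in> words A (q + 1)" "zs \<in> words A (s + 1)" for xs ys zs
    unfolding cup_pure[OF that(1,2)] cup_pure[OF that(2,3)] cup_pure[OF cup_word_closed[OF that(1,2)] that(3)]
      cup_pure[OF that(1) cup_word_closed[OF that(2,3)]] cup_word_assoc[OF that] add.assoc ..
  have mod: "module R (T (p + q + s))" by (rule T_module)
  have *: "cup (p + q) s (cup p q (pure p xs) (pure q ys)) Z = cup p (q + s) (pure p xs) (cup q s (pure q ys) Z)"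
    if "xs \<in> words A (p + 1)" "ys \<in> words A (q + 1)" for xs ys
  proof (rule linear_T_eqI[OF mod _ _ _ Z])
    note x = pure_closed[OF that(1)] and y = pure_closed[OF that(2)]
    show "linear_map R (T s) (T (p + q + s)) (cup (p + q) s (cup p q (pure p xs) (pure q ys)))"
      by (rule bilinear_mapD(1)[OF cup_bilinear cup_closed[OF x y]])
    show "linear_map R (T s) (T (p + q + s)) (\<lambda>Z. cup p (q + s) (pure p xs) (cup q s (pure q ys) Z))"
      unfolding add.assoc
      by (rule linear_map_compose[OF bilinear_mapD(1)[OF cup_bilinear y] bilinear_mapD(1)[OF cup_bilinear x]])
  qed (rule pure[OF that])
  show ?thesis
  proof (rule bilinear_T_eqI[OF mod, where f="\<lambda>X Y. cup (p + q) s (cup p q X Y) Z"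
        and g="\<lambda>X Y. cup p (q + s) X (cup q s Y Z)", OF _ _ * X Y])
    show "bilinear_map R (T p) (T q) (T (p + q + s)) (\<lambda>X Y. cup (p + q) s (cup p q X Y) Z)"
      unfolding bilinear_map_def
      by (intro conjI ballI linear_map_compose[OF _ bilinear_mapD(2)[OF cup_bilinear Z]]
          bilinear_mapD[OF cup_bilinear])
    show "bilinear_map R (T p) (T q) (T (p + q + s)) (\<lambda>X Y. cup p (q + s) X (cup q s Y Z))"
      unfolding bilinear_map_def add.assoc
      by (intro conjI ballI linear_map_compose[OF bilinear_mapD(2)[OF cup_bilinear Z]
            bilinear_mapD(1)[OF cup_bilinear]] bilinear_mapD(2)[OF cup_bilinear] cup_closed Z)
  qed
qed

abbreviation "unity \<equiv> TA_unity R A"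

lemma unity_closed: "unity \<in> carrier (T 0)"
  unfolding TA_unity_def by (rule pure_closed) (simp add: words_def)

lemma unity_cup: "X \<in> carrier (T p) \<Longrightarrow> cup 0 p unity X = X"
proof (rule linear_T_eqI[OF T_module[of p], where f="cup 0 p unity" and g="\<lambda>X. X"])
  show "linear_map R (T p) (T p) (cup 0 p unity)"
    using bilinear_mapD(1)[OF cup_bilinear unity_closed, of p] by simp
  fix xs assume xs: "xs \<in> words A (p + 1)"
  then obtain a ws where "xs = a # ws" using words_nonempty by (cases xs) auto
  with xs have "cup_word A [\<one>\<^bsub>A\<^esub>] xs = xs" by (simp add: cup_word_def words_def)
  moreover have "[\<one>\<^bsub>A\<^esub>] \<in> words A (0 + 1)" by (simp add: words_def)
  ultimately show "cup 0 p unity (pure p xs) = pure p xs"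
    unfolding TA_unity_def using cup_pure[OF _ xs, of "[\<one>\<^bsub>A\<^esub>]" 0] by simp
qed (rule linear_map_id)

lemma cup_unity: "X \<in> carrier (T p) \<Longrightarrow> cup p 0 X unity = X"
proof (rule linear_T_eqI[OF T_module[of p], where f="\<lambda>X. cup p 0 X unity" and g="\<lambda>X. X"])
  show "linear_map R (T p) (T p) (\<lambda>X. cup p 0 X unity)"
    using bilinear_mapD(2)[OF cup_bilinear unity_closed, of p] by simp
  fix xs assume xs: "xs \<in> words A (p + 1)"
  then obtain a ws where "xs = ws @ [a]" using words_nonempty by (cases xs rule: rev_cases) auto
  with xs have "cup_word A xs [\<one>\<^bsub>A\<^esub>] = xs" by (simp add: cup_word_def words_def)
  moreover have "[\<one>\<^bsub>A\<^esub>] \<in> words A (0 + 1)" by (simp add: words_def)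
  ultimately show "cup p 0 (pure p xs) unity = pure p xs"
    unfolding TA_unity_def using cup_pure[OF xs, of "[\<one>\<^bsub>A\<^esub>]" 0] by simp
qed (rule linear_map_id)

text \<open>Evaluation of a one-letter tensor inverts \<open>a \<mapsto> pure 0 [a]\<close>.\<close>

lemma inj_pure_0: "inj_on (\<lambda>a. pure 0 [a]) (carrier A)"
proof (rule inj_on_inverseI)
  fix a assume a: "a \<in> carrier A"
  have "multilinear R (0 + 1) A A hd"
    by (intro multilinearI) (auto simp: words_def length_Suc_conv linear_map_id)
  from T_ext_pure[OF module_A this, of "[a]"] a
  show "quot_ext R A hd (pure 0 [a]) = a" by (simp add: words_def)
qed

lemma structure_map_inj:
  assumes "inj_on (\<lambda>r. r \<odot>\<^bsub>A\<^esub> \<one>\<^bsub>A\<^esub>) (carrier R)"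
  shows "inj_on (\<lambda>r. r \<odot>\<^bsub>T 0\<^esub> unity) (carrier R)"
proof -
  have "inj_on (\<lambda>r. pure 0 [r \<odot>\<^bsub>A\<^esub> \<one>\<^bsub>A\<^esub>]) (carrier R)"
    using module.smult_closed[OF module_A _ A.one_closed]
    by (intro comp_inj_on[OF assms inj_on_subset[OF inj_pure_0], unfolded comp_def]) blast
  moreover have "pure 0 [r \<odot>\<^bsub>A\<^esub> \<one>\<^bsub>A\<^esub>] = r \<odot>\<^bsub>T 0\<^esub> unity" if "r \<in> carrier R" for r
    using linear_mapD(3)[OF multilinearD(2)[OF multilinear_pure, of "[]" "[]" 0] that A.one_closed]
    by (simp add: TA_unity_def)
  ultimately show ?thesis by (simp cong: inj_on_cong)
qed

lemma sgn_pow_closed [simp]: "sgn_pow R i \<in> carrier R"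
  by (simp add: sgn_pow_def)

lemma sgn_pow_0: "sgn_pow R 0 = \<one>\<^bsub>R\<^esub>"
  by (simp add: sgn_pow_def)

lemma sgn_pow_Suc: "sgn_pow R (Suc i) = \<ominus>\<^bsub>R\<^esub> sgn_pow R i"
  by (simp add: sgn_pow_def R.r_minus)

lemma sgn_pow_add: "sgn_pow R (i + j) = sgn_pow R i \<otimes>\<^bsub>R\<^esub> sgn_pow R j"
  by (simp add: sgn_pow_def R.nat_pow_mult)

lemma sgn_smult:
  assumes "X \<in> carrier (T n)"
  shows "sgn_pow R 0 \<odot>\<^bsub>T n\<^esub> X = X"
    and "sgn_pow R 1 \<odot>\<^bsub>T n\<^esub> X = \<ominus>\<^bsub>T n\<^esub> X"
    and "sgn_pow R 2 \<odot>\<^bsub>T n\<^esub> X = X"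
    and "sgn_pow R 3 \<odot>\<^bsub>T n\<^esub> X = \<ominus>\<^bsub>T n\<^esub> X"
    and "sgn_pow R 4 \<odot>\<^bsub>T n\<^esub> X = X"
    and "sgn_pow R (Suc i) \<odot>\<^bsub>T n\<^esub> X = \<ominus>\<^bsub>T n\<^esub> (sgn_pow R i \<odot>\<^bsub>T n\<^esub> X)"
  using assms
  by (simp_all add: numeral_2_eq_2 numeral_3_eq_3 numeral_Bit0[of "num.Bit0 num.One"] sgn_pow_0 sgn_pow_Suc
      T.smult_l_minus)


section \<open>The differential\<close>

text \<open>The word \<open>a\<^sub>0 \<dots> a\<^sub>i\<^sub>-\<^sub>1 1 a\<^sub>i \<dots> a\<^sub>n\<close>.  For \<open>i > n\<close> the unit is appended at the end, so the result always
  has one letter more.\<close>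

definition insert_one :: "nat \<Rightarrow> 'a list \<Rightarrow> 'a list"
  where "insert_one i xs = take i xs @ [\<one>\<^bsub>A\<^esub>] @ drop i xs"

lemma insert_one_closed: "xs \<in> words A k \<Longrightarrow> insert_one i xs \<in> words A (k + 1)"
  using set_take_subset[of i xs] set_drop_subset[of i xs] by (auto simp: insert_one_def words_def)

lemma slot_insert_one:
  assumes "set us \<subseteq> carrier A" "set vs \<subseteq> carrier A"
  shows "slot (\<lambda>a. insert_one i (us @ [a] @ vs))"
proof (cases "i \<le> length us")
  case True
  then have "insert_one i (us @ [a] @ vs) = insert_one i us @ [a] @ vs" for a
    by (simp add: insert_one_def)
  moreover have "set (insert_one i us) \<subseteq> carrier A"
    using insert_one_closed[of us "length us" i] assms(1) by (simp add: words_def)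
  ultimately show ?thesis using slot_base[OF _ assms(2)] by simp
next
  case False
  define j where "j = i - length us - 1"
  then have i: "i = length us + Suc j" using False by simp
  have "insert_one i (us @ [a] @ vs) = us @ [a] @ insert_one j vs" for a
    by (simp add: insert_one_def i)
  moreover have "set (insert_one j vs) \<subseteq> carrier A"
    using insert_one_closed[of vs "length vs" j] assms(2) by (simp add: words_def)
  ultimately show ?thesis using slot_base[OF assms(1)] by simp
qed

lemma pure_insert_one_closed: "xs \<in> words A (n + 1) \<Longrightarrow> pure (n + 1) (insert_one i xs) \<in> carrier (T (n + 1))"
  by (intro pure_closed insert_one_closed)

lemma diff_linear: "linear_map R (T n) (T (n + 1)) (diff n)"
  and diff_pure: "xs \<in> words A (n + 1) \<Longrightarrow> diff n (pure n xs) =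
    (\<Oplus>\<^bsub>T (n + 1)\<^esub>i\<in>{0..n + 1}. sgn_pow R i \<odot>\<^bsub>T (n + 1)\<^esub> pure (n + 1) (insert_one i xs))"
proof -
  have "multilinear R (n + 1) A (T (n + 1)) (\<lambda>xs.
      \<Oplus>\<^bsub>T (n + 1)\<^esub>i\<in>{0..n + 1}. sgn_pow R i \<odot>\<^bsub>T (n + 1)\<^esub> pure (n + 1) (insert_one i xs))"
    by (intro multilinear_finsum[OF T_module] multilinear_smult[OF T_module] multilinear_slot
        insert_one_closed slot_insert_one) simp_all
  note ml = this[unfolded insert_one_def]
  show "linear_map R (T n) (T (n + 1)) (diff n)"
    unfolding TA_diff_def by (rule linear_T_ext[OF T_module ml])
  show "diff n (pure n xs) =
      (\<Oplus>\<^bsub>T (n + 1)\<^esub>i\<in>{0..n + 1}. sgn_pow R i \<odot>\<^bsub>T (n + 1)\<^esub> pure (n + 1) (insert_one i xs))"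
    if "xs \<in> words A (n + 1)"
    unfolding TA_diff_def insert_one_def by (rule T_ext_pure[OF T_module ml that])
qed

lemma diff_closed: "X \<in> carrier (T n) \<Longrightarrow> diff n X \<in> carrier (T (n + 1))"
  by (rule linear_mapD(1)[OF diff_linear])

lemma cup_word_insert_one:
  assumes "xs \<in> words A (p + 1)" "ys \<in> words A (q + 1)"
  shows "i \<le> p \<Longrightarrow> cup_word A (insert_one i xs) ys = insert_one i (cup_word A xs ys)"
    and "cup_word A (insert_one (p + 1) xs) ys = xs @ ys"
    and "cup_word A xs (insert_one 0 ys) = xs @ ys"
    and "cup_word A xs (insert_one (Suc j) ys) = insert_one (p + 1 + j) (cup_word A xs ys)"
proof -
  obtain us a where x: "xs = us @ [a]" using words_nonempty[OF assms(1)] by (cases xs rule: rev_cases) auto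
  obtain b vs where y: "ys = b # vs" using words_nonempty[OF assms(2)] by (cases ys) auto
  have l: "length us = p" using assms(1) x by (simp add: words_def)
  have ab: "a \<in> carrier A" "b \<in> carrier A" using assms x y by (simp_all add: words_def)
  show "i \<le> p \<Longrightarrow> cup_word A (insert_one i xs) ys = insert_one i (cup_word A xs ys)"
    by (simp add: x y l insert_one_def cup_word_def butlast_append)
  show "cup_word A (insert_one (p + 1) xs) ys = xs @ ys"
    using ab by (simp add: x y l insert_one_def cup_word_def butlast_append)
  show "cup_word A xs (insert_one 0 ys) = xs @ ys"
    using ab by (simp add: x y l insert_one_def cup_word_def)
  show "cup_word A xs (insert_one (Suc j) ys) = insert_one (p + 1 + j) (cup_word A xs ys)"
    using ab l by (simp add: x y insert_one_def cup_word_def)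
qed

lemma leibniz_pure:
  assumes xs: "xs \<in> words A (p + 1)" and ys: "ys \<in> words A (q + 1)"
  shows "diff (p + q) (cup p q (pure p xs) (pure q ys)) =
    cup (p + 1) q (diff p (pure p xs)) (pure q ys) \<oplus>\<^bsub>T (p + q + 1)\<^esub>
    sgn_pow R p \<odot>\<^bsub>T (p + q + 1)\<^esub> cup p (q + 1) (pure p xs) (diff q (pure q ys))"
proof -
  let ?T = "T (p + q + 1)"
  let ?zs = "cup_word A xs ys"
  have pq: "p + 1 + q = p + q + 1" "p + (q + 1) = p + q + 1" by simp_all
  define t where "t i = sgn_pow R i \<odot>\<^bsub>?T\<^esub> pure (p + q + 1) (insert_one i ?zs)" for i
  have t: "t i \<in> carrier ?T" for i
    unfolding t_def by (intro T.smult_closed sgn_pow_closed pure_insert_one_closed cup_word_closed[OF xs ys])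
  \<comment> \<open>The term with a unit inserted at the junction, absorbed by the cup product: it arises as the
    last summand of \<open>d xs \<union> ys\<close> and as the first of \<open>xs \<union> d ys\<close>, with opposite signs.\<close>
  define e where "e = pure (p + q + 1) (xs @ ys)"
  have e: "e \<in> carrier ?T"
    unfolding e_def using xs ys by (intro pure_closed) (simp add: words_def)
  have lhs: "diff (p + q) (cup p q (pure p xs) (pure q ys)) =
      (\<Oplus>\<^bsub>?T\<^esub>i\<in>{..p}. t i) \<oplus>\<^bsub>?T\<^esub> (\<Oplus>\<^bsub>?T\<^esub>j\<in>{..q}. t (p + 1 + j))"
    unfolding cup_pure[OF xs ys] diff_pure[OF cup_word_closed[OF xs ys]] t_def[symmetric] atLeast0AtMost
    using T.finsum_split[of t "p + q + 1" p q, OF t] unfolding pq .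

  define u where "u i = sgn_pow R i \<odot>\<^bsub>?T\<^esub> pure (p + q + 1) (cup_word A (insert_one i xs) ys)" for i
  have u: "u i \<in> carrier ?T" for i
    unfolding u_def
    using cup_word_closed[OF insert_one_closed[OF xs] ys, of i] unfolding pq
    by (intro T.smult_closed sgn_pow_closed pure_closed)
  have u_t: "u i = t i" if "i \<le> p" for i
    unfolding u_def t_def using cup_word_insert_one(1)[OF xs ys that] by simp
  have lin: "linear_map R (T (p + 1)) ?T (\<lambda>X. cup (p + 1) q X (pure q ys))"
    using bilinear_mapD(2)[OF cup_bilinear pure_closed[OF ys], of "p + 1"] unfolding pq .
  have d: "sgn_pow R i \<odot>\<^bsub>T (p + 1)\<^esub> pure (p + 1) (insert_one i xs) \<in> carrier (T (p + 1))" for i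
    by (intro T.smult_closed sgn_pow_closed pure_insert_one_closed xs)
  have "cup (p + 1) q (diff p (pure p xs)) (pure q ys) = (\<Oplus>\<^bsub>?T\<^esub>i\<in>{..p + 1}. u i)"
    unfolding diff_pure[OF xs] atLeast0AtMost
    unfolding linear_map_apply_finsum[OF T_module T_module lin finite_atMost Pi_I[OF d]]
      linear_mapD(3)[OF lin sgn_pow_closed pure_insert_one_closed[OF xs]]
      cup_pure[OF insert_one_closed[OF xs] ys, unfolded pq] u_def[symmetric] ..
  also have "\<dots> = (\<Oplus>\<^bsub>?T\<^esub>i\<in>{..p}. u i) \<oplus>\<^bsub>?T\<^esub> u (p + 1)"
    using T.finsum_Suc[of u p "p + q + 1"] u by (simp add: T.a_comm)
  also have "(\<Oplus>\<^bsub>?T\<^esub>i\<in>{..p}. u i) = (\<Oplus>\<^bsub>?T\<^esub>i\<in>{..p}. t i)"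
    using t u_t by (intro T.finsum_cong') auto
  also have "u (p + 1) = \<ominus>\<^bsub>?T\<^esub> (sgn_pow R p \<odot>\<^bsub>?T\<^esub> e)"
    unfolding u_def cup_word_insert_one(2)[OF xs ys] e_def[symmetric] using sgn_smult(6)[OF e] by simp
  finally have r1: "cup (p + 1) q (diff p (pure p xs)) (pure q ys) =
      (\<Oplus>\<^bsub>?T\<^esub>i\<in>{..p}. t i) \<oplus>\<^bsub>?T\<^esub> \<ominus>\<^bsub>?T\<^esub> (sgn_pow R p \<odot>\<^bsub>?T\<^esub> e)" .

  define v where "v j = pure (p + q + 1) (cup_word A xs (insert_one j ys))" for j
  have v: "v j \<in> carrier ?T" for j
    unfolding v_def
    using cup_word_closed[OF xs insert_one_closed[OF ys], of j] unfolding pq by (rule pure_closed)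
  have sv: "(\<lambda>j. sgn_pow R j \<odot>\<^bsub>?T\<^esub> v j) \<in> I \<rightarrow> carrier ?T" for I
    using v by simp
  have ssv: "(\<lambda>j. sgn_pow R (p + j) \<odot>\<^bsub>?T\<^esub> v j) \<in> I \<rightarrow> carrier ?T" for I
    using v by simp
  have lin: "linear_map R (T (q + 1)) ?T (cup p (q + 1) (pure p xs))"
    using bilinear_mapD(1)[OF cup_bilinear pure_closed[OF xs], of "q + 1"] unfolding pq .
  have d: "sgn_pow R i \<odot>\<^bsub>T (q + 1)\<^esub> pure (q + 1) (insert_one i ys) \<in> carrier (T (q + 1))" for i
    by (intro T.smult_closed sgn_pow_closed pure_insert_one_closed ys)
  have "cup p (q + 1) (pure p xs) (diff q (pure q ys)) = (\<Oplus>\<^bsub>?T\<^esub>j\<in>{..q + 1}. sgn_pow R j \<odot>\<^bsub>?T\<^esub> v j)"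
    unfolding diff_pure[OF ys] atLeast0AtMost
    unfolding linear_map_apply_finsum[OF T_module T_module lin finite_atMost Pi_I[OF d]]
      linear_mapD(3)[OF lin sgn_pow_closed pure_insert_one_closed[OF ys]]
      cup_pure[OF xs insert_one_closed[OF ys], unfolded pq] v_def[symmetric] ..
  then have "sgn_pow R p \<odot>\<^bsub>?T\<^esub> cup p (q + 1) (pure p xs) (diff q (pure q ys)) =
      (\<Oplus>\<^bsub>?T\<^esub>j\<in>{..q + 1}. sgn_pow R p \<odot>\<^bsub>?T\<^esub> (sgn_pow R j \<odot>\<^bsub>?T\<^esub> v j))"
    using T.finsum_smult_ldistr[OF _ sgn_pow_closed sv, of "{..q + 1}"] by simp
  also have "\<dots> = (\<Oplus>\<^bsub>?T\<^esub>j\<in>{..q + 1}. sgn_pow R (p + j) \<odot>\<^bsub>?T\<^esub> v j)"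
    unfolding sgn_pow_add using v by (simp add: T.smult_assoc1)
  also have "\<dots> = (\<Oplus>\<^bsub>?T\<^esub>j\<in>{..q}. sgn_pow R (p + Suc j) \<odot>\<^bsub>?T\<^esub> v (Suc j)) \<oplus>\<^bsub>?T\<^esub> sgn_pow R p \<odot>\<^bsub>?T\<^esub> v 0"
    using T.finsum_Suc2[OF ssv, of q] by simp
  also have "(\<Oplus>\<^bsub>?T\<^esub>j\<in>{..q}. sgn_pow R (p + Suc j) \<odot>\<^bsub>?T\<^esub> v (Suc j)) = (\<Oplus>\<^bsub>?T\<^esub>j\<in>{..q}. t (p + 1 + j))"
    unfolding v_def t_def cup_word_insert_one(4)[OF xs ys] by simp
  also have "v 0 = e"
    unfolding v_def cup_word_insert_one(3)[OF xs ys] e_def ..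
  finally have r2: "sgn_pow R p \<odot>\<^bsub>?T\<^esub> cup p (q + 1) (pure p xs) (diff q (pure q ys)) =
      (\<Oplus>\<^bsub>?T\<^esub>j\<in>{..q}. t (p + 1 + j)) \<oplus>\<^bsub>?T\<^esub> sgn_pow R p \<odot>\<^bsub>?T\<^esub> e" .
  have s: "(\<Oplus>\<^bsub>?T\<^esub>i\<in>{..p}. t i) \<in> carrier ?T" "(\<Oplus>\<^bsub>?T\<^esub>j\<in>{..q}. t (p + 1 + j)) \<in> carrier ?T"
      "sgn_pow R p \<odot>\<^bsub>?T\<^esub> e \<in> carrier ?T"
    using t e by (auto intro!: T.finsum_closed)
  show ?thesis
    unfolding lhs r1 r2 by (rule T.add_neg_add_cancel[OF s])
qed

lemma leibniz:
  assumes X: "X \<in> carrier (T p)" and Y: "Y \<in> carrier (T q)"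
  shows "diff (p + q) (cup p q X Y) =
    cup (p + 1) q (diff p X) Y \<oplus>\<^bsub>T (p + q + 1)\<^esub>
    sgn_pow R p \<odot>\<^bsub>T (p + q + 1)\<^esub> cup p (q + 1) X (diff q Y)"
proof (rule bilinear_T_eqI[OF T_module, where f="\<lambda>X Y. diff (p + q) (cup p q X Y)" and
      g="\<lambda>X Y. cup (p + 1) q (diff p X) Y \<oplus>\<^bsub>T (p + q + 1)\<^esub>
        sgn_pow R p \<odot>\<^bsub>T (p + q + 1)\<^esub> cup p (q + 1) X (diff q Y)", OF _ _ leibniz_pure X Y])
  have pq: "p + 1 + q = p + q + 1" "p + (q + 1) = p + q + 1" by simp_all
  show "bilinear_map R (T p) (T q) (T (p + q + 1)) (\<lambda>X Y. diff (p + q) (cup p q X Y))"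
    unfolding bilinear_map_def
    by (intro conjI ballI linear_map_compose[OF _ diff_linear] bilinear_mapD[OF cup_bilinear])
  have b1: "bilinear_map R (T (p + 1)) (T q) (T (p + q + 1)) (cup (p + 1) q)"
    using cup_bilinear[of "p + 1" q] unfolding pq .
  have b2: "bilinear_map R (T p) (T (q + 1)) (T (p + q + 1)) (cup p (q + 1))"
    using cup_bilinear[of p "q + 1"] unfolding pq .
  show "bilinear_map R (T p) (T q) (T (p + q + 1)) (\<lambda>X Y. cup (p + 1) q (diff p X) Y \<oplus>\<^bsub>T (p + q + 1)\<^esub>
        sgn_pow R p \<odot>\<^bsub>T (p + q + 1)\<^esub> cup p (q + 1) X (diff q Y))"
    unfolding bilinear_map_def
    by (intro conjI ballI linear_map_add[OF T_module] linear_map_smult[OF T_module] sgn_pow_closed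
        bilinear_mapD(1)[OF b1] bilinear_mapD(2)[OF b2] diff_closed
        linear_map_compose[OF diff_linear bilinear_mapD(2)[OF b1]]
        linear_map_compose[OF diff_linear bilinear_mapD(1)[OF b2]])
qed

text \<open>Both \<open>cup\<close> and \<open>diff\<close> carry their degrees as sums; the following forms use numerals.\<close>

lemma words_1E: assumes "xs \<in> words A (0 + 1)" obtains a where "xs = [a]" "a \<in> carrier A"
  using assms by (auto simp: words_def length_Suc_conv)

lemma words_2E:
  assumes "xs \<in> words A (1 + 1)" obtains a b where "xs = [a, b]" "a \<in> carrier A" "b \<in> carrier A"
  using assms by (auto simp: words_def length_Suc_conv)

lemma pure_small_closed:
  "a \<in> carrier A \<Longrightarrow> pure 0 [a] \<in> carrier (T 0)"
  "\<lbrakk>a \<in> carrier A; b \<in> carrier A\<rbrakk> \<Longrightarrow> pure 1 [a, b] \<in> carrier (T 1)"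
  "\<lbrakk>a \<in> carrier A; b \<in> carrier A; c \<in> carrier A\<rbrakk> \<Longrightarrow> pure 2 [a, b, c] \<in> carrier (T 2)"
  "\<lbrakk>a \<in> carrier A; b \<in> carrier A; c \<in> carrier A; e \<in> carrier A\<rbrakk> \<Longrightarrow> pure 3 [a, b, c, e] \<in> carrier (T 3)"
  by (rule pure_closed; simp add: words_def)+

lemma degree_sums: "0 + 1 = (1 :: nat)" "1 + 1 = (2 :: nat)" "2 + 1 = (3 :: nat)"
  "0 + 2 = (2 :: nat)" "1 + 2 = (3 :: nat)"
  by simp_all

lemma diff_pure_0:
  assumes "a \<in> carrier A"
  shows "diff 0 (pure 0 [a]) = pure 1 [\<one>\<^bsub>A\<^esub>, a] \<ominus>\<^bsub>T 1\<^esub> pure 1 [a, \<one>\<^bsub>A\<^esub>]"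
proof -
  have xs: "[a] \<in> words A (0 + 1)" using assms by (simp add: words_def)
  note cl = pure_insert_one_closed[OF xs, unfolded degree_sums]
  have "diff 0 (pure 0 [a]) = sgn_pow R 0 \<odot>\<^bsub>T 1\<^esub> pure 1 (insert_one 0 [a]) \<oplus>\<^bsub>T 1\<^esub>
      sgn_pow R 1 \<odot>\<^bsub>T 1\<^esub> pure 1 (insert_one 1 [a])"
    unfolding diff_pure[OF xs]
    by (subst T.finsum_upto_small(1)) (simp_all only: degree_sums T.smult_closed sgn_pow_closed cl)
  then show ?thesis
    unfolding sgn_smult(1,2)[OF cl] by (simp add: insert_one_def a_minus_def)
qed

lemma diff_pure_1:
  assumes "a \<in> carrier A" "b \<in> carrier A"
  shows "diff 1 (pure 1 [a, b]) =
    pure 2 [\<one>\<^bsub>A\<^esub>, a, b] \<ominus>\<^bsub>T 2\<^esub> pure 2 [a, \<one>\<^bsub>A\<^esub>, b] \<oplus>\<^bsub>T 2\<^esub> pure 2 [a, b, \<one>\<^bsub>A\<^esub>]"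
proof -
  have xs: "[a, b] \<in> words A (1 + 1)" using assms by (simp add: words_def)
  note cl = pure_insert_one_closed[OF xs, unfolded degree_sums]
  have "diff 1 (pure 1 [a, b]) = sgn_pow R 0 \<odot>\<^bsub>T 2\<^esub> pure 2 (insert_one 0 [a, b]) \<oplus>\<^bsub>T 2\<^esub>
      sgn_pow R 1 \<odot>\<^bsub>T 2\<^esub> pure 2 (insert_one 1 [a, b]) \<oplus>\<^bsub>T 2\<^esub>
      sgn_pow R 2 \<odot>\<^bsub>T 2\<^esub> pure 2 (insert_one 2 [a, b])"
    unfolding diff_pure[OF xs]
    by (subst T.finsum_upto_small(2)) (simp_all only: degree_sums T.smult_closed sgn_pow_closed cl)
  then show ?thesis
    unfolding sgn_smult(1-3)[OF cl] by (simp add: insert_one_def a_minus_def)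
qed

lemma diff_pure_2:
  assumes "a \<in> carrier A" "b \<in> carrier A" "c \<in> carrier A"
  shows "diff 2 (pure 2 [a, b, c]) =
    pure 3 [\<one>\<^bsub>A\<^esub>, a, b, c] \<ominus>\<^bsub>T 3\<^esub> pure 3 [a, \<one>\<^bsub>A\<^esub>, b, c] \<oplus>\<^bsub>T 3\<^esub> pure 3 [a, b, \<one>\<^bsub>A\<^esub>, c]
      \<ominus>\<^bsub>T 3\<^esub> pure 3 [a, b, c, \<one>\<^bsub>A\<^esub>]"
proof -
  have xs: "[a, b, c] \<in> words A (2 + 1)" using assms by (simp add: words_def)
  note cl = pure_insert_one_closed[OF xs, unfolded degree_sums]
  have "diff 2 (pure 2 [a, b, c]) = sgn_pow R 0 \<odot>\<^bsub>T 3\<^esub> pure 3 (insert_one 0 [a, b, c]) \<oplus>\<^bsub>T 3\<^esub>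
      sgn_pow R 1 \<odot>\<^bsub>T 3\<^esub> pure 3 (insert_one 1 [a, b, c]) \<oplus>\<^bsub>T 3\<^esub>
      sgn_pow R 2 \<odot>\<^bsub>T 3\<^esub> pure 3 (insert_one 2 [a, b, c]) \<oplus>\<^bsub>T 3\<^esub>
      sgn_pow R 3 \<odot>\<^bsub>T 3\<^esub> pure 3 (insert_one 3 [a, b, c])"
    unfolding diff_pure[OF xs]
    by (subst T.finsum_upto_small(3)) (simp_all only: degree_sums T.smult_closed sgn_pow_closed cl)
  then show ?thesis
    unfolding sgn_smult(1-4)[OF cl] by (simp add: insert_one_def a_minus_def)
qed

lemma diff_pure_one_right:
  assumes "a \<in> carrier A"
  shows "diff 1 (pure 1 [a, \<one>\<^bsub>A\<^esub>]) = pure 2 [\<one>\<^bsub>A\<^esub>, a, \<one>\<^bsub>A\<^esub>]"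
  using pure_small_closed(3)[of "\<one>\<^bsub>A\<^esub>" a "\<one>\<^bsub>A\<^esub>"] pure_small_closed(3)[of a "\<one>\<^bsub>A\<^esub>" "\<one>\<^bsub>A\<^esub>"] assms
  by (subst diff_pure_1) (simp_all add: a_minus_def T.a_assoc T.l_neg)

lemma diff_pure_one_left:
  assumes "a \<in> carrier A"
  shows "diff 1 (pure 1 [\<one>\<^bsub>A\<^esub>, a]) = pure 2 [\<one>\<^bsub>A\<^esub>, a, \<one>\<^bsub>A\<^esub>]"
  using pure_small_closed(3)[of "\<one>\<^bsub>A\<^esub>" a "\<one>\<^bsub>A\<^esub>"] pure_small_closed(3)[of "\<one>\<^bsub>A\<^esub>" "\<one>\<^bsub>A\<^esub>" a] assms
  by (subst diff_pure_1) (simp_all add: a_minus_def T.r_neg)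

lemma diff_diff_pure_0:
  assumes "a \<in> carrier A"
  shows "diff 1 (diff 0 (pure 0 [a])) = \<zero>\<^bsub>T 2\<^esub>"
proof -
  have lin: "linear_map R (T 1) (T 2) (diff 1)" using diff_linear[of 1] unfolding degree_sums .
  show ?thesis
    unfolding diff_pure_0[OF assms]
      linear_map_minus[OF T_module T_module lin pure_small_closed(2)[OF A.one_closed assms]
        pure_small_closed(2)[OF assms A.one_closed]]
      diff_pure_one_left[OF assms] diff_pure_one_right[OF assms]
    using T.r_neg[OF pure_small_closed(3)[OF A.one_closed assms A.one_closed]] by (simp only: a_minus_def)
qed

lemma diff_diff_pure_one:
  assumes "a \<in> carrier A"
  shows "diff 2 (diff 1 (pure 1 [a, \<one>\<^bsub>A\<^esub>])) = \<zero>\<^bsub>T 3\<^esub>"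
  unfolding diff_pure_one_right[OF assms] diff_pure_2[OF A.one_closed assms A.one_closed]
  using pure_small_closed(4)[of "\<one>\<^bsub>A\<^esub>" "\<one>\<^bsub>A\<^esub>" a "\<one>\<^bsub>A\<^esub>"] pure_small_closed(4)[of "\<one>\<^bsub>A\<^esub>" a "\<one>\<^bsub>A\<^esub>" "\<one>\<^bsub>A\<^esub>"] assms
  by (simp add: a_minus_def T.r_neg)

lemma diff_diff_cup:
  assumes X: "X \<in> carrier (T p)" and Y: "Y \<in> carrier (T q)"
    and dX: "diff (p + 1) (diff p X) = \<zero>\<^bsub>T (p + 2)\<^esub>" and dY: "diff (q + 1) (diff q Y) = \<zero>\<^bsub>T (q + 2)\<^esub>"
  shows "diff (p + q + 1) (diff (p + q) (cup p q X Y)) = \<zero>\<^bsub>T (p + q + 2)\<^esub>"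
proof -
  have pq: "p + 1 + q = p + q + 1" "p + (q + 1) = p + q + 1" "p + q + 1 + 1 = p + q + 2"
    "p + 1 + (q + 1) = p + q + 2" "p + 1 + 1 = p + 2" "q + 1 + 1 = q + 2" "p + 2 + q = p + q + 2"
    "p + (q + 2) = p + q + 2" by simp_all
  note dX' = diff_closed[OF X] and dY' = diff_closed[OF Y]
  let ?T = "T (p + q + 2)"
  have lin: "linear_map R (T (p + q + 1)) ?T (diff (p + q + 1))"
    using diff_linear[of "p + q + 1"] unfolding pq .
  have c1: "cup (p + 1) q (diff p X) Y \<in> carrier (T (p + q + 1))"
    using cup_closed[OF dX' Y] unfolding pq .
  have c2: "cup p (q + 1) X (diff q Y) \<in> carrier (T (p + q + 1))"
    using cup_closed[OF X dY'] unfolding pq .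
  have m: "cup (p + 1) (q + 1) (diff p X) (diff q Y) \<in> carrier ?T" (is "?m \<in> _")
    using cup_closed[OF dX' dY'] unfolding pq .
  have z1: "cup (p + 2) q \<zero>\<^bsub>T (p + 2)\<^esub> Y = \<zero>\<^bsub>?T\<^esub>"
    using linear_map_zero[OF T_module T_module bilinear_mapD(2)[OF cup_bilinear Y, of "p + 2"]] unfolding pq .
  have z2: "cup p (q + 2) X \<zero>\<^bsub>T (q + 2)\<^esub> = \<zero>\<^bsub>?T\<^esub>"
    using linear_map_zero[OF T_module T_module bilinear_mapD(1)[OF cup_bilinear X, of "q + 2"]] unfolding pq .
  have 1: "diff (p + q + 1) (cup (p + 1) q (diff p X) Y) = \<ominus>\<^bsub>?T\<^esub> (sgn_pow R p \<odot>\<^bsub>?T\<^esub> ?m)"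
    using leibniz[OF dX' Y] sgn_smult(6)[OF m, of p] m unfolding pq dX z1 by simp
  have 2: "diff (p + q + 1) (cup p (q + 1) X (diff q Y)) = ?m"
    using leibniz[OF X dY'] m unfolding pq dY z2 by simp
  show ?thesis
    unfolding leibniz[OF X Y] linear_mapD(2)[OF lin c1 T.smult_closed[OF sgn_pow_closed c2]]
      linear_mapD(3)[OF lin sgn_pow_closed c2] 1 2
    by (rule T.l_neg[OF T.smult_closed[OF sgn_pow_closed m]])
qed

lemma diff_diff_pure: "xs \<in> words A (n + 1) \<Longrightarrow> diff (n + 1) (diff n (pure n xs)) = \<zero>\<^bsub>T (n + 2)\<^esub>"
proof (induction n arbitrary: xs)
  case 0
  then show ?case using diff_diff_pure_0 by (elim words_1E) (simp add: numeral_2_eq_2)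
next
  case (Suc n)
  then obtain a ws where "xs = a # ws" by (cases xs) (auto simp: words_def)
  with Suc.prems have xs: "xs = a # ws" "a \<in> carrier A" "ws \<in> words A (n + 1)" "ws \<noteq> []"
    by (auto simp: words_def)
  \<comment> \<open>The first letter splits off: \<open>a \<otimes> ws = (a \<otimes> 1) \<union> ws\<close>.\<close>
  have a1: "[a, \<one>\<^bsub>A\<^esub>] \<in> words A (1 + 1)" using xs(2) by (simp add: words_def)
  have "cup_word A [a, \<one>\<^bsub>A\<^esub>] ws = xs"
    using xs by (cases ws) (auto simp: cup_word_def words_def)
  with cup_pure[OF a1 xs(3)] have eq: "cup 1 n (pure 1 [a, \<one>\<^bsub>A\<^esub>]) (pure n ws) = pure (1 + n) xs" by simp
  have dd: "diff (1 + 1) (diff 1 (pure 1 [a, \<one>\<^bsub>A\<^esub>])) = \<zero>\<^bsub>T (1 + 2)\<^esub>"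
    using diff_diff_pure_one[OF xs(2)] unfolding degree_sums .
  show ?case
    using diff_diff_cup[OF pure_closed[OF a1] pure_closed[OF xs(3)] dd Suc.IH[OF xs(3)]] unfolding eq by simp
qed

lemma diff_diff:
  assumes "X \<in> carrier (T n)"
  shows "diff (n + 1) (diff n X) = \<zero>\<^bsub>T (n + 2)\<^esub>"
proof -
  have n: "n + 1 + 1 = n + 2" by simp
  have "submodule {\<zero>\<^bsub>T (n + 2)\<^esub>} R (T (n + 2))" by (rule T.submoduleI) auto
  from linear_T_intoI[OF T_module linear_map_compose[OF diff_linear diff_linear[of "n + 1", unfolded n]] this _ assms]
  show ?thesis using diff_diff_pure by auto
qed


section \<open>The cup-one product\<close>

text \<open>The word of the \<open>i\<close>-th summand of the cup-one product, which is defined for all degrees although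
  only \<open>p = 1, 2\<close> and \<open>q = 1\<close> are used.\<close>

definition cup1_word :: "nat \<Rightarrow> 'a list \<Rightarrow> 'a list \<Rightarrow> 'a list"
  where "cup1_word i xs ys = cup_word A (cup_word A (take (i + 1) xs) ys) (drop (i + 1) xs)"

lemma take_drop_words:
  assumes "xs \<in> words A (p + 1)" "i < p"
  shows "take (i + 1) xs \<in> words A (i + 1)" "drop (i + 1) xs \<in> words A (p - i - 1 + 1)"
  using assms set_take_subset[of "i + 1" xs] set_drop_subset[of "i + 1" xs]
  by (auto simp: words_def)

lemma cup1_word_closed:
  assumes "xs \<in> words A (p + 1)" "ys \<in> words A (q + 1)" "i < p"
  shows "cup1_word i xs ys \<in> words A (p + q - 1 + 1)"
proof -
  note w = take_drop_words[OF assms(1,3)]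
  have "i + q + (p - i - 1) + 1 = p + q - 1 + 1" using assms(3) by simp
  with cup_word_closed[OF cup_word_closed[OF w(1) assms(2)] w(2)] show ?thesis
    unfolding cup1_word_def by simp
qed

lemma slot_cup1_left:
  assumes "set us \<subseteq> carrier A" "set vs \<subseteq> carrier A" "length us + length vs + 1 = p + 1" "i < p"
    and "set ys \<subseteq> carrier A" "ys \<noteq> []"
  shows "slot (\<lambda>a. cup1_word i (us @ [a] @ vs) ys)"
proof (cases "length us \<le> i")
  case True
  let ?k = "i - length us"
  have eq: "cup1_word i (us @ [a] @ vs) ys = cup_word A (cup_word A (us @ [a] @ take ?k vs) ys) (drop ?k vs)" for a
    using True by (simp add: cup1_word_def Suc_diff_le)
  have "set (take ?k vs) \<subseteq> carrier A" "set (drop ?k vs) \<subseteq> carrier A" "drop ?k vs \<noteq> []"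
    using assms(2-4) True set_take_subset[of ?k vs] set_drop_subset[of ?k vs] by auto
  then show ?thesis
    unfolding eq using assms by (intro slot_cup_left slot_base)
next
  case False
  have eq: "cup1_word i (us @ [a] @ vs) ys = cup_word A (cup_word A (take (i + 1) us) ys) (drop (i + 1) us @ [a] @ vs)" for a
    using False by (simp add: cup1_word_def)
  have "take (i + 1) us \<in> words A (i + 1)"
    using False assms(1) set_take_subset[of "i + 1" us] by (auto simp: words_def)
  moreover have "ys \<in> words A (length ys - 1 + 1)" using assms(5,6) by (simp add: words_def)
  ultimately have "cup_word A (take (i + 1) us) ys \<in> words A (i + (length ys - 1) + 1)"
    by (rule cup_word_closed)
  from words_nonempty[OF this] show ?thesis
    unfolding eq using assms(1,2) set_drop_subset[of "i + 1" us]
    by (intro slot_cup_right slot_base) auto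
qed

lemma slot_cup1_right:
  assumes "xs \<in> words A (p + 1)" "i < p" "set us \<subseteq> carrier A" "set vs \<subseteq> carrier A"
  shows "slot (\<lambda>a. cup1_word i xs (us @ [a] @ vs))"
  unfolding cup1_word_def
  using words_nonempty[OF take_drop_words(1)[OF assms(1,2)]]
    words_nonempty[OF take_drop_words(2)[OF assms(1,2)]]
  by (intro slot_cup_left slot_cup_right slot_base assms(3,4)) simp_all

lemma cup1_bilinear: "bilinear_map R (T p) (T q) (T (p + q - 1)) (cup1 p q)"
  and cup1_pure: "\<lbrakk>xs \<in> words A (p + 1); ys \<in> words A (q + 1)\<rbrakk> \<Longrightarrow>
    cup1 p q (pure p xs) (pure q ys) =
      (\<Oplus>\<^bsub>T (p + q - 1)\<^esub>i\<in>{0..<p}. sgn_pow R ((p - i) * (q + 1)) \<odot>\<^bsub>T (p + q - 1)\<^esub>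
        pure (p + q - 1) (cup1_word i xs ys))"
proof -
  let ?T = "T (p + q - 1)"
  let ?g = "\<lambda>xs ys. \<Oplus>\<^bsub>?T\<^esub>i\<in>{0..<p}. sgn_pow R ((p - i) * (q + 1)) \<odot>\<^bsub>?T\<^esub>
    pure (p + q - 1) (cup1_word i xs ys)"
  have right: "multilinear R (q + 1) A ?T (?g xs)" if xs: "xs \<in> words A (p + 1)" for xs
    using cup1_word_closed[OF xs] slot_cup1_right[OF xs]
    by (intro multilinear_finsum[OF T_module] multilinear_smult[OF T_module] multilinear_slot) simp_all
  have left: "multilinear R (p + 1) A ?T (\<lambda>xs. ?g xs ys)" if ys: "ys \<in> words A (q + 1)" for ys
    using cup1_word_closed[OF _ ys] slot_cup1_left[of _ _ p _ ys] words_nonempty[OF ys]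
    by (intro multilinear_finsum[OF T_module] multilinear_smult[OF T_module] multilinear_slot) simp_all
  show "bilinear_map R (T p) (T q) ?T (cup1 p q)"
    unfolding TA_cup1_def cup1_word_def[symmetric] by (rule T_ext2(1)[OF T_module right left])
  show "cup1 p q (pure p xs) (pure q ys) = ?g xs ys"
    if "xs \<in> words A (p + 1)" "ys \<in> words A (q + 1)"
    unfolding TA_cup1_def cup1_word_def[symmetric] by (rule T_ext2(2)[OF T_module right left that])
qed

lemma cup_bilinear_1_1: "bilinear_map R (T 1) (T 1) (T 2) (cup 1 1)"
  using cup_bilinear[of 1 1] unfolding degree_sums .

lemma diff_linear_1: "linear_map R (T 1) (T 2) (diff 1)"
  using diff_linear[of 1] unfolding degree_sums .

lemma cup1_bilinear_1_1: "bilinear_map R (T 1) (T 1) (T 1) (cup1 1 1)"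
  using cup1_bilinear[of 1 1] unfolding diff_add_inverse2 .

lemma cup1_bilinear_2_1: "bilinear_map R (T 2) (T 1) (T 2) (cup1 2 1)"
  using cup1_bilinear[of 2 1] unfolding diff_add_inverse2 .

lemma cup_pure_1_1:
  assumes "a \<in> carrier A" "b \<in> carrier A" "x \<in> carrier A" "y \<in> carrier A"
  shows "cup 1 1 (pure 1 [a, b]) (pure 1 [x, y]) = pure 2 [a, b \<otimes>\<^bsub>A\<^esub> x, y]"
proof -
  have "[a, b] \<in> words A (1 + 1)" "[x, y] \<in> words A (1 + 1)"
    using assms by (simp_all add: words_def)
  from cup_pure[OF this] show ?thesis unfolding degree_sums by (simp add: cup_word_def)
qed

lemma cup1_pure_1_1:
  assumes "a \<in> carrier A" "b \<in> carrier A" "x \<in> carrier A" "y \<in> carrier A"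
  shows "cup1 1 1 (pure 1 [a, b]) (pure 1 [x, y]) = pure 1 [a \<otimes>\<^bsub>A\<^esub> x, y \<otimes>\<^bsub>A\<^esub> b]"
proof -
  have w: "[a, b] \<in> words A (1 + 1)" "[x, y] \<in> words A (1 + 1)"
    using assms by (simp_all add: words_def)
  have c: "pure 1 (cup1_word 0 [a, b] [x, y]) \<in> carrier (T 1)"
    using pure_closed[OF cup1_word_closed[OF w, of 0]] by simp
  have "cup1 1 1 (pure 1 [a, b]) (pure 1 [x, y]) = sgn_pow R 2 \<odot>\<^bsub>T 1\<^esub> pure 1 (cup1_word 0 [a, b] [x, y])"
    using cup1_pure[OF w] c by (simp add: T.finsum_insert flip: numeral_2_eq_2)
  also have "\<dots> = pure 1 (cup1_word 0 [a, b] [x, y])" by (rule sgn_smult(3)[OF c])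
  also have "cup1_word 0 [a, b] [x, y] = [a \<otimes>\<^bsub>A\<^esub> x, y \<otimes>\<^bsub>A\<^esub> b]"
    by (simp add: cup1_word_def cup_word_def)
  finally show ?thesis .
qed

lemma cup1_pure_2_1:
  assumes "a \<in> carrier A" "b \<in> carrier A" "c \<in> carrier A" "x \<in> carrier A" "y \<in> carrier A"
  shows "cup1 2 1 (pure 2 [a, b, c]) (pure 1 [x, y]) =
    pure 2 [a \<otimes>\<^bsub>A\<^esub> x, y \<otimes>\<^bsub>A\<^esub> b, c] \<oplus>\<^bsub>T 2\<^esub> pure 2 [a, b \<otimes>\<^bsub>A\<^esub> x, y \<otimes>\<^bsub>A\<^esub> c]"
proof -
  have w: "[a, b, c] \<in> words A (2 + 1)" "[x, y] \<in> words A (1 + 1)"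
    using assms by (simp_all add: words_def)
  have c: "pure 2 (cup1_word 0 [a, b, c] [x, y]) \<in> carrier (T 2)" "pure 2 (cup1_word 1 [a, b, c] [x, y]) \<in> carrier (T 2)"
    using pure_closed[OF cup1_word_closed[OF w, of 0]] pure_closed[OF cup1_word_closed[OF w, of 1]] by simp_all
  have "{0..<2} = {0, 1::nat}" by auto
  then have "cup1 2 1 (pure 2 [a, b, c]) (pure 1 [x, y]) = sgn_pow R 4 \<odot>\<^bsub>T 2\<^esub> pure 2 (cup1_word 0 [a, b, c] [x, y])
      \<oplus>\<^bsub>T 2\<^esub> sgn_pow R 2 \<odot>\<^bsub>T 2\<^esub> pure 2 (cup1_word 1 [a, b, c] [x, y])"
    using cup1_pure[OF w] c by (simp add: T.finsum_insert flip: numeral_2_eq_2)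
  also have "\<dots> = pure 2 (cup1_word 0 [a, b, c] [x, y]) \<oplus>\<^bsub>T 2\<^esub> pure 2 (cup1_word 1 [a, b, c] [x, y])"
    unfolding sgn_smult(3)[OF c(2)] sgn_smult(5)[OF c(1)] ..
  also have "cup1_word 0 [a, b, c] [x, y] = [a \<otimes>\<^bsub>A\<^esub> x, y \<otimes>\<^bsub>A\<^esub> b, c]"
    by (simp add: cup1_word_def cup_word_def)
  also have "cup1_word 1 [a, b, c] [x, y] = [a, b \<otimes>\<^bsub>A\<^esub> x, y \<otimes>\<^bsub>A\<^esub> c]"
    by (simp add: cup1_word_def cup_word_def)
  finally show ?thesis .
qed

text \<open>To compare two expressions in elements of \<open>T 1\<close> that are linear in each of them, it suffices
  to compare them on the tensors \<open>a \<otimes> b\<close>.\<close>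

lemma linear_T1_eqI:
  assumes "module R P" "linear_map R (T 1) P f" "linear_map R (T 1) P g"
    and "\<And>a b. \<lbrakk>a \<in> carrier A; b \<in> carrier A\<rbrakk> \<Longrightarrow> f (pure 1 [a, b]) = g (pure 1 [a, b])"
    and "X \<in> carrier (T 1)"
  shows "f X = g X"
proof (rule linear_T_eqI[OF assms(1-3) _ assms(5)])
  fix xs assume "xs \<in> words A (1 + 1)"
  then obtain a b where "xs = [a, b]" "a \<in> carrier A" "b \<in> carrier A" by (rule words_2E)
  then show "f (pure 1 xs) = g (pure 1 xs)" by (simp only: assms(4))
qed

lemma bilinear_T1_eqI:
  assumes "module R P" "bilinear_map R (T 1) (T 1) P f" "bilinear_map R (T 1) (T 1) P g"
    and "\<And>a b x y. \<lbrakk>a \<in> carrier A; b \<in> carrier A; x \<in> carrier A; y \<in> carrier A\<rbrakk> \<Longrightarrow>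
      f (pure 1 [a, b]) (pure 1 [x, y]) = g (pure 1 [a, b]) (pure 1 [x, y])"
    and "X \<in> carrier (T 1)" "Y \<in> carrier (T 1)"
  shows "f X Y = g X Y"
proof (rule bilinear_T_eqI[OF assms(1-3) _ assms(5,6)])
  fix xs ys assume xs: "xs \<in> words A (1 + 1)" and ys: "ys \<in> words A (1 + 1)"
  from xs obtain a b where "xs = [a, b]" "a \<in> carrier A" "b \<in> carrier A" by (rule words_2E)
  moreover from ys obtain x y where "ys = [x, y]" "x \<in> carrier A" "y \<in> carrier A" by (rule words_2E)
  ultimately show "f (pure 1 xs) (pure 1 ys) = g (pure 1 xs) (pure 1 ys)" by (simp only: assms(4))
qed

lemma cup1_comm:
  assumes "X \<in> carrier (T 1)" "Y \<in> carrier (T 1)"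
  shows "cup1 1 1 X Y = cup1 1 1 Y X"
proof (rule bilinear_T1_eqI[OF T_module cup1_bilinear_1_1 _ _ assms, where g="\<lambda>X Y. cup1 1 1 Y X"])
  show "bilinear_map R (T 1) (T 1) (T 1) (\<lambda>X Y. cup1 1 1 Y X)"
    using cup1_bilinear_1_1 by (auto simp: bilinear_map_def)
qed (simp only: cup1_pure_1_1 A.m_comm)

lemma cup1_assoc:
  assumes "X \<in> carrier (T 1)" "Y \<in> carrier (T 1)" "Z \<in> carrier (T 1)"
  shows "cup1 1 1 (cup1 1 1 X Y) Z = cup1 1 1 X (cup1 1 1 Y Z)"
proof -
  note b = cup1_bilinear_1_1
  note D1 = bilinear_mapD(1)[OF b] and D2 = bilinear_mapD(2)[OF b] and cl = bilinear_map_closed[OF b]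
  have *: "cup1 1 1 (cup1 1 1 (pure 1 [a, b]) (pure 1 [x, y])) Z = cup1 1 1 (pure 1 [a, b]) (cup1 1 1 (pure 1 [x, y]) Z)"
    if m: "a \<in> carrier A" "b \<in> carrier A" "x \<in> carrier A" "y \<in> carrier A" for a b x y
  proof (rule linear_T1_eqI[OF T_module D1[OF cl] linear_map_compose[OF D1 D1] _ assms(3)])
    show "cup1 1 1 (cup1 1 1 (pure 1 [a, b]) (pure 1 [x, y])) (pure 1 [v, w])
      = cup1 1 1 (pure 1 [a, b]) (cup1 1 1 (pure 1 [x, y]) (pure 1 [v, w]))"
      if "v \<in> carrier A" "w \<in> carrier A" for v w
      using that m by (simp only: cup1_pure_1_1 A.m_closed A.m_assoc)
  qed (intro pure_small_closed m)+
  show ?thesis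
  proof (rule bilinear_T1_eqI[OF T_module, where f="\<lambda>X Y. cup1 1 1 (cup1 1 1 X Y) Z"
        and g="\<lambda>X Y. cup1 1 1 X (cup1 1 1 Y Z)", OF _ _ * assms(1,2)])
    show "bilinear_map R (T 1) (T 1) (T 1) (\<lambda>X Y. cup1 1 1 (cup1 1 1 X Y) Z)"
      unfolding bilinear_map_def by (intro conjI ballI linear_map_compose[OF _ D2[OF assms(3)]] D1 D2)
    show "bilinear_map R (T 1) (T 1) (T 1) (\<lambda>X Y. cup1 1 1 X (cup1 1 1 Y Z))"
      unfolding bilinear_map_def by (intro conjI ballI linear_map_compose[OF D2[OF assms(3)] D1] D2 cl assms(3))
  qed
qed

lemma hirsch:
  assumes "X \<in> carrier (T 1)" "Y \<in> carrier (T 1)" "Z \<in> carrier (T 1)"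
  shows "cup1 2 1 (cup 1 1 X Y) Z = cup 1 1 X (cup1 1 1 Y Z) \<oplus>\<^bsub>T 2\<^esub> cup 1 1 (cup1 1 1 X Z) Y"
proof -
  note b = cup1_bilinear_1_1
  note D1 = bilinear_mapD(1)[OF b] and D2 = bilinear_mapD(2)[OF b] and cl = bilinear_map_closed[OF b]
  note c = cup_bilinear_1_1
  note C1 = bilinear_mapD(1)[OF c] and C2 = bilinear_mapD(2)[OF c] and ccl = bilinear_map_closed[OF c]
  note E1 = bilinear_mapD(1)[OF cup1_bilinear_2_1] and E2 = bilinear_mapD(2)[OF cup1_bilinear_2_1]
  have *: "cup1 2 1 (cup 1 1 (pure 1 [a, b]) (pure 1 [x, y])) Z
      = cup 1 1 (pure 1 [a, b]) (cup1 1 1 (pure 1 [x, y]) Z) \<oplus>\<^bsub>T 2\<^esub> cup 1 1 (cup1 1 1 (pure 1 [a, b]) Z) (pure 1 [x, y])"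
    if m: "a \<in> carrier A" "b \<in> carrier A" "x \<in> carrier A" "y \<in> carrier A" for a b x y
  proof (rule linear_T1_eqI[OF T_module E1[OF ccl]
        linear_map_add[OF T_module linear_map_compose[OF D1 C1] linear_map_compose[OF D1 C2]] _ assms(3)])
    fix v w assume vw: "v \<in> carrier A" "w \<in> carrier A"
    note m = m vw A.m_closed
    have "cup1 2 1 (cup 1 1 (pure 1 [a, b]) (pure 1 [x, y])) (pure 1 [v, w])
        = pure 2 [a \<otimes>\<^bsub>A\<^esub> v, w \<otimes>\<^bsub>A\<^esub> (b \<otimes>\<^bsub>A\<^esub> x), y] \<oplus>\<^bsub>T 2\<^esub> pure 2 [a, b \<otimes>\<^bsub>A\<^esub> x \<otimes>\<^bsub>A\<^esub> v, w \<otimes>\<^bsub>A\<^esub> y]"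
      by (simp only: cup_pure_1_1 cup1_pure_2_1 m)
    also have "\<dots> = pure 2 [a, b \<otimes>\<^bsub>A\<^esub> (x \<otimes>\<^bsub>A\<^esub> v), w \<otimes>\<^bsub>A\<^esub> y] \<oplus>\<^bsub>T 2\<^esub> pure 2 [a \<otimes>\<^bsub>A\<^esub> v, w \<otimes>\<^bsub>A\<^esub> b \<otimes>\<^bsub>A\<^esub> x, y]"
      by (subst T.a_comm) (simp_all only: A.m_assoc m pure_small_closed)
    also have "\<dots> = cup 1 1 (pure 1 [a, b]) (cup1 1 1 (pure 1 [x, y]) (pure 1 [v, w]))
        \<oplus>\<^bsub>T 2\<^esub> cup 1 1 (cup1 1 1 (pure 1 [a, b]) (pure 1 [v, w])) (pure 1 [x, y])"
      by (simp only: cup_pure_1_1 cup1_pure_1_1 m)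
    finally show "cup1 2 1 (cup 1 1 (pure 1 [a, b]) (pure 1 [x, y])) (pure 1 [v, w])
        = cup 1 1 (pure 1 [a, b]) (cup1 1 1 (pure 1 [x, y]) (pure 1 [v, w]))
        \<oplus>\<^bsub>T 2\<^esub> cup 1 1 (cup1 1 1 (pure 1 [a, b]) (pure 1 [v, w])) (pure 1 [x, y])" .
  qed (intro pure_small_closed m)+
  show ?thesis
  proof (rule bilinear_T1_eqI[OF T_module, where f="\<lambda>X Y. cup1 2 1 (cup 1 1 X Y) Z"
        and g="\<lambda>X Y. cup 1 1 X (cup1 1 1 Y Z) \<oplus>\<^bsub>T 2\<^esub> cup 1 1 (cup1 1 1 X Z) Y", OF _ _ * assms(1,2)])
    show "bilinear_map R (T 1) (T 1) (T 2) (\<lambda>X Y. cup1 2 1 (cup 1 1 X Y) Z)"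
      unfolding bilinear_map_def by (intro conjI ballI linear_map_compose[OF _ E2[OF assms(3)]] C1 C2)
    show "bilinear_map R (T 1) (T 1) (T 2) (\<lambda>X Y. cup 1 1 X (cup1 1 1 Y Z) \<oplus>\<^bsub>T 2\<^esub> cup 1 1 (cup1 1 1 X Z) Y)"
      unfolding bilinear_map_def
      by (intro conjI ballI linear_map_add[OF T_module] linear_map_compose[OF D2[OF assms(3)] C1]
          linear_map_compose[OF D2[OF assms(3)] C2] C1 C2 cl assms(3))
  qed
qed


section \<open>The letterwise product\<close>

text \<open>The bilinear product \<open>(a\<^sub>0 \<otimes> \<dots> \<otimes> a\<^sub>n) \<circ> (b\<^sub>0 \<otimes> \<dots> \<otimes> b\<^sub>n) = a\<^sub>0b\<^sub>0 \<otimes> \<dots> \<otimes> a\<^sub>nb\<^sub>n\<close> on \<open>T\<^sup>n(A)\<close>.\<close>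

definition T_circ :: "nat \<Rightarrow> ('a list \<Rightarrow> 'r) set \<Rightarrow> ('a list \<Rightarrow> 'r) set \<Rightarrow> ('a list \<Rightarrow> 'r) set"
  where "T_circ n X Y = quot_ext R (T n) (\<lambda>xs. quot_ext R (T n) (\<lambda>ys. pure n (map2 (mult A) xs ys)) Y) X"

lemma map2_mult_closed:
  "\<lbrakk>xs \<in> words A k; ys \<in> words A k\<rbrakk> \<Longrightarrow> map2 (mult A) xs ys \<in> words A k"
  by (auto simp: words_def set_zip subset_iff)

lemma map2_mult_comm:
  assumes "xs \<in> words A k" "ys \<in> words A k"
  shows "map2 (mult A) xs ys = map2 (mult A) ys xs"
proof (rule nth_equalityI)
  fix i assume "i < length (map2 (mult A) xs ys)"
  then have "i < length xs" "i < length ys" by simp_all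
  moreover from this have "xs ! i \<in> carrier A" "ys ! i \<in> carrier A"
    using assms by (auto simp: words_def)
  ultimately show "map2 (mult A) xs ys ! i = map2 (mult A) ys xs ! i" by (simp add: A.m_comm)
qed simp

lemma slot_map2:
  assumes "set us \<subseteq> carrier A" "set vs \<subseteq> carrier A" "length us + length vs + 1 = k" "ys \<in> words A k"
  shows "slot (\<lambda>a. map2 (mult A) (us @ [a] @ vs) ys)"
proof -
  let ?n = "length us"
  have n: "?n < length ys" using assms(3,4) by (simp add: words_def)
  have ys: "ys = take ?n ys @ [ys ! ?n] @ drop (Suc ?n) ys"
    using id_take_nth_drop[OF n] by simp
  have c: "set (take ?n ys) \<subseteq> carrier A" "set (drop (Suc ?n) ys) \<subseteq> carrier A" "ys ! ?n \<in> carrier A"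
    using assms(4) n set_take_subset[of ?n ys] set_drop_subset[of "Suc ?n" ys] by (auto simp: words_def)
  show ?thesis
  proof (rule slotI[of "map2 (mult A) us (take ?n ys)" "map2 (mult A) vs (drop (Suc ?n) ys)" "ys ! ?n"])
    have "map2 (mult A) (us @ [a] @ vs) (take ?n ys @ [ys ! ?n] @ drop (Suc ?n) ys) =
      map2 (mult A) us (take ?n ys) @ [a \<otimes>\<^bsub>A\<^esub> ys ! ?n] @ map2 (mult A) vs (drop (Suc ?n) ys)" for a
      using n by simp
    then show "map2 (mult A) (us @ [a] @ vs) ys =
      map2 (mult A) us (take ?n ys) @ [a \<otimes>\<^bsub>A\<^esub> ys ! ?n] @ map2 (mult A) vs (drop (Suc ?n) ys)" for a
      by (simp only: ys[symmetric])
    have "map2 (mult A) us (take ?n ys) \<in> words A ?n"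
      using n c(1) assms(1) by (intro map2_mult_closed) (simp_all add: words_def)
    then show "set (map2 (mult A) us (take ?n ys)) \<subseteq> carrier A" by (simp add: words_def)
    have "map2 (mult A) vs (drop (Suc ?n) ys) \<in> words A (length vs)"
      using assms(2-4) c(2) by (intro map2_mult_closed) (auto simp: words_def)
    then show "set (map2 (mult A) vs (drop (Suc ?n) ys)) \<subseteq> carrier A" by (simp add: words_def)
  qed (rule c(3))
qed

lemma T_circ_bilinear: "bilinear_map R (T n) (T n) (T n) (T_circ n)"
  and T_circ_pure: "\<lbrakk>xs \<in> words A (n + 1); ys \<in> words A (n + 1)\<rbrakk> \<Longrightarrow>
    T_circ n (pure n xs) (pure n ys) = pure n (map2 (mult A) xs ys)"
proof -
  have left: "multilinear R (n + 1) A (T n) (\<lambda>xs. pure n (map2 (mult A) xs ys))"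
    if "ys \<in> words A (n + 1)" for ys
    using map2_mult_closed[OF _ that] slot_map2[OF _ _ _ that] by (intro multilinear_slot)
  have right: "multilinear R (n + 1) A (T n) (\<lambda>ys. pure n (map2 (mult A) xs ys))"
    if xs: "xs \<in> words A (n + 1)" for xs
  proof (rule multilinear_slot)
    fix us vs assume uv: "set us \<subseteq> carrier A" "set vs \<subseteq> carrier A" "length us + length vs + 1 = n + 1"
    obtain us' vs' c where *: "set us' \<subseteq> carrier A" "set vs' \<subseteq> carrier A" "c \<in> carrier A"
      "\<And>a. a \<in> carrier A \<Longrightarrow> map2 (mult A) (us @ [a] @ vs) xs = us' @ [a \<otimes>\<^bsub>A\<^esub> c] @ vs'"
      using slot_map2[OF uv xs] unfolding slot_def by blast
    show "slot (\<lambda>a. map2 (mult A) xs (us @ [a] @ vs))"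
    proof (rule slotI[OF *(1-3)])
      fix a assume a: "a \<in> carrier A"
      have "us @ [a] @ vs \<in> words A (n + 1)" using uv a by (simp add: words_def)
      then show "map2 (mult A) xs (us @ [a] @ vs) = us' @ [a \<otimes>\<^bsub>A\<^esub> c] @ vs'"
        using map2_mult_comm[OF xs] *(4)[OF a] by simp
    qed
  qed (rule map2_mult_closed[OF that])
  show "bilinear_map R (T n) (T n) (T n) (T_circ n)"
    unfolding T_circ_def by (rule T_ext2(1)[OF T_module right left])
  show "T_circ n (pure n xs) (pure n ys) = pure n (map2 (mult A) xs ys)"
    if "xs \<in> words A (n + 1)" "ys \<in> words A (n + 1)"
    unfolding T_circ_def by (rule T_ext2(2)[OF T_module right left that])
qed

lemma T_circ_pure_2:
  assumes "a \<in> carrier A" "b \<in> carrier A" "c \<in> carrier A" "x \<in> carrier A" "y \<in> carrier A" "z \<in> carrier A"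
  shows "T_circ 2 (pure 2 [a, b, c]) (pure 2 [x, y, z]) = pure 2 [a \<otimes>\<^bsub>A\<^esub> x, b \<otimes>\<^bsub>A\<^esub> y, c \<otimes>\<^bsub>A\<^esub> z]"
proof -
  have "[a, b, c] \<in> words A (2 + 1)" "[x, y, z] \<in> words A (2 + 1)"
    using assms by (simp_all add: words_def)
  from T_circ_pure[OF this] show ?thesis by simp
qed

text \<open>Both sides are \<open>u\<^sub>0w\<^sub>0 \<otimes> u\<^sub>1v\<^sub>0w\<^sub>1z\<^sub>0 \<otimes> v\<^sub>1z\<^sub>1\<close> on pure tensors; this uses the commutativity of \<open>A\<close>.\<close>

lemma T_circ_cup:
  assumes "U \<in> carrier (T 1)" "V \<in> carrier (T 1)" "W \<in> carrier (T 1)" "Z \<in> carrier (T 1)"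
  shows "T_circ 2 (cup 1 1 U V) (cup 1 1 W Z) = cup 1 1 (cup1 1 1 U W) (cup1 1 1 V Z)"
proof -
  note b = cup1_bilinear_1_1
  note D1 = bilinear_mapD(1)[OF b] and D2 = bilinear_mapD(2)[OF b] and cl = bilinear_map_closed[OF b]
  note c = cup_bilinear_1_1
  note C1 = bilinear_mapD(1)[OF c] and C2 = bilinear_mapD(2)[OF c] and ccl = bilinear_map_closed[OF c]
  note E1 = bilinear_mapD(1)[OF T_circ_bilinear] and E2 = bilinear_mapD(2)[OF T_circ_bilinear]
  have *: "T_circ 2 (cup 1 1 (pure 1 [a, b]) (pure 1 [x, y])) (cup 1 1 W Z)
      = cup 1 1 (cup1 1 1 (pure 1 [a, b]) W) (cup1 1 1 (pure 1 [x, y]) Z)"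
    if m: "a \<in> carrier A" "b \<in> carrier A" "x \<in> carrier A" "y \<in> carrier A" for a b x y
  proof (rule bilinear_T1_eqI[OF T_module, where f="\<lambda>W Z. T_circ 2 (cup 1 1 (pure 1 [a, b]) (pure 1 [x, y])) (cup 1 1 W Z)"
        and g="\<lambda>W Z. cup 1 1 (cup1 1 1 (pure 1 [a, b]) W) (cup1 1 1 (pure 1 [x, y]) Z)", OF _ _ _ assms(3,4)])
    note p = pure_small_closed(2)[OF m(1,2)] pure_small_closed(2)[OF m(3,4)]
    show "bilinear_map R (T 1) (T 1) (T 2) (\<lambda>W Z. T_circ 2 (cup 1 1 (pure 1 [a, b]) (pure 1 [x, y])) (cup 1 1 W Z))"
      unfolding bilinear_map_def by (intro conjI ballI linear_map_compose[OF _ E1[OF ccl[OF p]]] C1 C2)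
    show "bilinear_map R (T 1) (T 1) (T 2) (\<lambda>W Z. cup 1 1 (cup1 1 1 (pure 1 [a, b]) W) (cup1 1 1 (pure 1 [x, y]) Z))"
      unfolding bilinear_map_def
      by (intro conjI ballI linear_map_compose[OF D1[OF p(1)] C2] linear_map_compose[OF D1[OF p(2)] C1] cl p)
  next
    fix u v w z assume "u \<in> carrier A" "v \<in> carrier A" "w \<in> carrier A" "z \<in> carrier A"
    with m show "T_circ 2 (cup 1 1 (pure 1 [a, b]) (pure 1 [x, y])) (cup 1 1 (pure 1 [u, v]) (pure 1 [w, z]))
        = cup 1 1 (cup1 1 1 (pure 1 [a, b]) (pure 1 [u, v])) (cup1 1 1 (pure 1 [x, y]) (pure 1 [w, z]))"
      by (simp only: cup_pure_1_1 cup1_pure_1_1 T_circ_pure_2 A.m_closed A.m_ac)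
  qed
  show ?thesis
  proof (rule bilinear_T1_eqI[OF T_module, where f="\<lambda>U V. T_circ 2 (cup 1 1 U V) (cup 1 1 W Z)"
        and g="\<lambda>U V. cup 1 1 (cup1 1 1 U W) (cup1 1 1 V Z)", OF _ _ * assms(1,2)])
    show "bilinear_map R (T 1) (T 1) (T 2) (\<lambda>U V. T_circ 2 (cup 1 1 U V) (cup 1 1 W Z))"
      unfolding bilinear_map_def
      by (intro conjI ballI linear_map_compose[OF _ E2[OF ccl[OF assms(3,4)]]] C1 C2)
    show "bilinear_map R (T 1) (T 1) (T 2) (\<lambda>U V. cup 1 1 (cup1 1 1 U W) (cup1 1 1 V Z))"
      unfolding bilinear_map_def
      by (intro conjI ballI linear_map_compose[OF D2[OF assms(3)] C2] linear_map_compose[OF D2[OF assms(4)] C1] cl assms(3,4))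
  qed
qed

text \<open>The formula for \<open>d(X \<union>\<^sub>1 Y)\<close> holds on all of \<open>T\<^sup>1(A)\<close>.\<close>

lemma diff_cup1:
  assumes "X \<in> carrier (T 1)" "Y \<in> carrier (T 1)"
  shows "diff 1 (cup1 1 1 X Y) =
    \<ominus>\<^bsub>T 2\<^esub> cup 1 1 X Y \<ominus>\<^bsub>T 2\<^esub> cup 1 1 Y X
    \<oplus>\<^bsub>T 2\<^esub> cup1 2 1 (diff 1 X) Y \<oplus>\<^bsub>T 2\<^esub> cup1 2 1 (diff 1 Y) X
    \<ominus>\<^bsub>T 2\<^esub> T_circ 2 (diff 1 X) (diff 1 Y)"
proof (rule bilinear_T1_eqI[OF T_module, where f="\<lambda>X Y. diff 1 (cup1 1 1 X Y)" and
      g="\<lambda>X Y. \<ominus>\<^bsub>T 2\<^esub> cup 1 1 X Y \<ominus>\<^bsub>T 2\<^esub> cup 1 1 Y X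
        \<oplus>\<^bsub>T 2\<^esub> cup1 2 1 (diff 1 X) Y \<oplus>\<^bsub>T 2\<^esub> cup1 2 1 (diff 1 Y) X
        \<ominus>\<^bsub>T 2\<^esub> T_circ 2 (diff 1 X) (diff 1 Y)", OF _ _ _ assms])
  note b = cup1_bilinear_1_1
  note D1 = bilinear_mapD(1)[OF b] and D2 = bilinear_mapD(2)[OF b]
  note c = cup_bilinear_1_1
  note C1 = bilinear_mapD(1)[OF c] and C2 = bilinear_mapD(2)[OF c]
  note F1 = bilinear_mapD(1)[OF cup1_bilinear_2_1] and F2 = bilinear_mapD(2)[OF cup1_bilinear_2_1]
  note E1 = bilinear_mapD(1)[OF T_circ_bilinear[of 2]] and E2 = bilinear_mapD(2)[OF T_circ_bilinear[of 2]]
  note d = diff_linear_1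
  note dcl = linear_mapD(1)[OF d]
  show "bilinear_map R (T 1) (T 1) (T 2) (\<lambda>X Y. diff 1 (cup1 1 1 X Y))"
    unfolding bilinear_map_def by (intro conjI ballI linear_map_compose[OF _ d] D1 D2)
  show "bilinear_map R (T 1) (T 1) (T 2) (\<lambda>X Y. \<ominus>\<^bsub>T 2\<^esub> cup 1 1 X Y \<ominus>\<^bsub>T 2\<^esub> cup 1 1 Y X
        \<oplus>\<^bsub>T 2\<^esub> cup1 2 1 (diff 1 X) Y \<oplus>\<^bsub>T 2\<^esub> cup1 2 1 (diff 1 Y) X
        \<ominus>\<^bsub>T 2\<^esub> T_circ 2 (diff 1 X) (diff 1 Y))"
    unfolding bilinear_map_def
    by (intro conjI ballI linear_map_add[OF T_module] linear_map_diff[OF T_module] linear_map_uminus[OF T_module]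
        linear_map_compose[OF d E1] linear_map_compose[OF d E2] linear_map_compose[OF d F2] C1 C2 F1 dcl)
  fix a b x y assume m: "a \<in> carrier A" "b \<in> carrier A" "x \<in> carrier A" "y \<in> carrier A"
  let ?X = "pure 1 [a, b]" and ?Y = "pure 1 [x, y]"
  note m' = m A.m_closed A.one_closed
  let ?x1 = "pure 2 [\<one>\<^bsub>A\<^esub>, a \<otimes>\<^bsub>A\<^esub> x, b \<otimes>\<^bsub>A\<^esub> y]" and ?x2 = "pure 2 [a \<otimes>\<^bsub>A\<^esub> x, \<one>\<^bsub>A\<^esub>, b \<otimes>\<^bsub>A\<^esub> y]"
    and ?x3 = "pure 2 [a \<otimes>\<^bsub>A\<^esub> x, b \<otimes>\<^bsub>A\<^esub> y, \<one>\<^bsub>A\<^esub>]"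
    and ?m1 = "pure 2 [x, a \<otimes>\<^bsub>A\<^esub> y, b]" and ?m2 = "pure 2 [a, b \<otimes>\<^bsub>A\<^esub> x, y]"
    and ?p1 = "pure 2 [a \<otimes>\<^bsub>A\<^esub> x, y, b]" and ?p2 = "pure 2 [a, x, b \<otimes>\<^bsub>A\<^esub> y]"
    and ?p3 = "pure 2 [a \<otimes>\<^bsub>A\<^esub> x, b, y]" and ?p4 = "pure 2 [x, a, b \<otimes>\<^bsub>A\<^esub> y]"
  have cX: "pure 2 [\<one>\<^bsub>A\<^esub>, a, b] \<in> carrier (T 2)" "pure 2 [a, \<one>\<^bsub>A\<^esub>, b] \<in> carrier (T 2)" "pure 2 [a, b, \<one>\<^bsub>A\<^esub>] \<in> carrier (T 2)"
    and cY: "pure 2 [\<one>\<^bsub>A\<^esub>, x, y] \<in> carrier (T 2)" "pure 2 [x, \<one>\<^bsub>A\<^esub>, y] \<in> carrier (T 2)" "pure 2 [x, y, \<one>\<^bsub>A\<^esub>] \<in> carrier (T 2)"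
    by (intro pure_small_closed m')+
  have p: "?x1 \<in> carrier (T 2)" "?x2 \<in> carrier (T 2)" "?x3 \<in> carrier (T 2)" "?m1 \<in> carrier (T 2)" "?m2 \<in> carrier (T 2)"
    "?p1 \<in> carrier (T 2)" "?p2 \<in> carrier (T 2)" "?p3 \<in> carrier (T 2)" "?p4 \<in> carrier (T 2)"
    by (intro pure_small_closed m')+
  have pX: "?X \<in> carrier (T 1)" "?Y \<in> carrier (T 1)" by (intro pure_small_closed m)+
  note dX = diff_pure_1[OF m(1,2)] and dY = diff_pure_1[OF m(3,4)]
  have split: "f (x1 \<ominus>\<^bsub>T 2\<^esub> x2 \<oplus>\<^bsub>T 2\<^esub> x3) = f x1 \<ominus>\<^bsub>T 2\<^esub> f x2 \<oplus>\<^bsub>T 2\<^esub> f x3"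
    if "linear_map R (T 2) (T 2) f" "x1 \<in> carrier (T 2)" "x2 \<in> carrier (T 2)" "x3 \<in> carrier (T 2)" for f x1 x2 x3
    using linear_mapD(2)[OF that(1) T.minus_closed[OF that(2,3)] that(4)]
      linear_map_minus[OF T_module T_module that(1-3)] by simp
  have "diff 1 (cup1 1 1 ?X ?Y) = ?x1 \<ominus>\<^bsub>T 2\<^esub> ?x2 \<oplus>\<^bsub>T 2\<^esub> ?x3"
    using m by (simp only: cup1_pure_1_1 diff_pure_1 A.m_closed A.m_comm[of y b])
  moreover have "cup 1 1 ?X ?Y = ?m2"
    by (simp only: cup_pure_1_1 m)
  moreover have "cup 1 1 ?Y ?X = ?m1"
    by (simp only: cup_pure_1_1 m A.m_comm[of y a])
  moreover have "cup1 2 1 (diff 1 ?X) ?Y =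
      (?m1 \<oplus>\<^bsub>T 2\<^esub> ?x1) \<ominus>\<^bsub>T 2\<^esub> (?p1 \<oplus>\<^bsub>T 2\<^esub> ?p2) \<oplus>\<^bsub>T 2\<^esub> (?x3 \<oplus>\<^bsub>T 2\<^esub> ?m2)"
    unfolding dX split[OF F2[OF pX(2)] cX]
    using m by (simp only: cup1_pure_2_1 A.one_closed A.l_one A.r_one A.m_comm[of y a] A.m_comm[of y b])
  moreover have "cup1 2 1 (diff 1 ?Y) ?X =
      (?m2 \<oplus>\<^bsub>T 2\<^esub> ?x1) \<ominus>\<^bsub>T 2\<^esub> (?p3 \<oplus>\<^bsub>T 2\<^esub> ?p4) \<oplus>\<^bsub>T 2\<^esub> (?x3 \<oplus>\<^bsub>T 2\<^esub> ?m1)"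
    unfolding dY split[OF F2[OF pX(1)] cY]
    using m by (simp only: cup1_pure_2_1 A.one_closed A.l_one A.r_one A.m_comm[of x a] A.m_comm[of y a] A.m_comm[of y b])
  moreover have "T_circ 2 (diff 1 ?X) (diff 1 ?Y) =
      (?x1 \<ominus>\<^bsub>T 2\<^esub> ?p4 \<oplus>\<^bsub>T 2\<^esub> ?m1) \<ominus>\<^bsub>T 2\<^esub> (?p2 \<ominus>\<^bsub>T 2\<^esub> ?x2 \<oplus>\<^bsub>T 2\<^esub> ?p1) \<oplus>\<^bsub>T 2\<^esub> (?m2 \<ominus>\<^bsub>T 2\<^esub> ?p3 \<oplus>\<^bsub>T 2\<^esub> ?x3)"
    unfolding dX split[OF E2[OF dcl[OF pX(2)]] cX]
    unfolding dY split[OF E1[OF cX(1)] cY] split[OF E1[OF cX(2)] cY] split[OF E1[OF cX(3)] cY]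
    using m by (simp only: T_circ_pure_2 A.one_closed A.l_one A.r_one A.m_comm[of y a])
  ultimately show "diff 1 (cup1 1 1 ?X ?Y) =
    \<ominus>\<^bsub>T 2\<^esub> cup 1 1 ?X ?Y \<ominus>\<^bsub>T 2\<^esub> cup 1 1 ?Y ?X
    \<oplus>\<^bsub>T 2\<^esub> cup1 2 1 (diff 1 ?X) ?Y \<oplus>\<^bsub>T 2\<^esub> cup1 2 1 (diff 1 ?Y) ?X
    \<ominus>\<^bsub>T 2\<^esub> T_circ 2 (diff 1 ?X) (diff 1 ?Y)"
    using T.cup1_cancellation[OF p] by (simp only:)
qed


section \<open>Differential forms\<close>

lemma linear_mult_left:
  assumes "c \<in> carrier A"
  shows "linear_map R A A (\<lambda>a. c \<otimes>\<^bsub>A\<^esub> a)"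
proof -
  have comm: "c \<otimes>\<^bsub>A\<^esub> a = a \<otimes>\<^bsub>A\<^esub> c" if "a \<in> carrier A" for a
    using assms that by (rule A.m_comm)
  show ?thesis
    using linear_mapD[OF linear_mult_right[OF assms]]
    by (intro linear_mapI) (simp_all add: comm module.smult_closed[OF module_A])
qed

lemma mult_map_linear: "linear_map R (T 1) A (mult_map R A)"
  and mult_map_pure: "\<lbrakk>a \<in> carrier A; b \<in> carrier A\<rbrakk> \<Longrightarrow> mult_map R A (pure 1 [a, b]) = a \<otimes>\<^bsub>A\<^esub> b"
proof -
  have ml: "multilinear R (1 + 1) A A (\<lambda>xs. xs ! 0 \<otimes>\<^bsub>A\<^esub> xs ! 1)"
  proof (rule multilinearI)
    show "xs ! 0 \<otimes>\<^bsub>A\<^esub> xs ! 1 \<in> carrier A" if "xs \<in> words A (1 + 1)" for xs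
      by (rule words_2E[OF that]) simp
    fix us vs assume *: "set us \<subseteq> carrier A" "set vs \<subseteq> carrier A" "length us + length vs + 1 = 1 + (1::nat)"
    show "linear_map R A A (\<lambda>a. (us @ [a] @ vs) ! 0 \<otimes>\<^bsub>A\<^esub> (us @ [a] @ vs) ! 1)"
    proof (cases us)
      case Nil
      then obtain b where "vs = [b]" "b \<in> carrier A" using * by (auto simp: length_Suc_conv)
      then show ?thesis using Nil linear_mult_right by simp
    next
      case (Cons b us')
      then have "us = [b]" "vs = []" "b \<in> carrier A" using * by auto
      then show ?thesis using linear_mult_left by simp
    qed
  qed
  show "linear_map R (T 1) A (mult_map R A)"
    unfolding mult_map_def by (rule linear_T_ext[OF module_A ml])
  show "mult_map R A (pure 1 [a, b]) = a \<otimes>\<^bsub>A\<^esub> b" if "a \<in> carrier A" "b \<in> carrier A"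
    unfolding mult_map_def using that by (subst T_ext_pure[OF module_A ml]) (simp_all add: words_def)
qed

abbreviation "Omega_one \<equiv> carrier (Omega1 R A)"

lemma Omega_one_eq: "Omega_one = {X \<in> carrier (T 1). mult_map R A X = \<zero>\<^bsub>A\<^esub>}"
  by (simp add: Omega1_def a_kernel_def')

lemma Omega1_ops: "add (Omega1 R A) = add (T 1)" "smult (Omega1 R A) = smult (T 1)"
  by (simp_all add: Omega1_def)

lemma submodule_Omega_one: "submodule Omega_one R (T 1)"
proof -
  have "submodule {\<zero>\<^bsub>A\<^esub>} R A"
    by (rule module.submoduleI[OF module_A]) (simp_all add: module.smult_r_null[OF module_A])
  from submodule_vimage[OF T_module module_A mult_map_linear this] show ?thesis
    by (simp add: Omega_one_eq)
qed

lemma Omega_one_closed: "w \<in> Omega_one \<Longrightarrow> w \<in> carrier (T 1)"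
  by (simp add: Omega_one_eq)

lemma module_Omega1: "module R (Omega1 R A)"
  using submodule.submodule_is_module[OF submodule_Omega_one T_module] by (simp add: Omega1_def)

lemma cup_bilinear_0_1: "bilinear_map R (T 0) (T 1) (T 1) (cup 0 1)"
  using cup_bilinear[of 0 1] by simp

lemma cup_bilinear_1_0: "bilinear_map R (T 1) (T 0) (T 1) (cup 1 0)"
  using cup_bilinear[of 1 0] by simp

lemma cup_pure_0_1:
  assumes "c \<in> carrier A" "a \<in> carrier A" "b \<in> carrier A"
  shows "cup 0 1 (pure 0 [c]) (pure 1 [a, b]) = pure 1 [c \<otimes>\<^bsub>A\<^esub> a, b]"
    and "cup 1 0 (pure 1 [a, b]) (pure 0 [c]) = pure 1 [a, b \<otimes>\<^bsub>A\<^esub> c]"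
proof -
  have w: "[c] \<in> words A (0 + 1)" "[a, b] \<in> words A (1 + 1)"
    using assms by (simp_all add: words_def)
  show "cup 0 1 (pure 0 [c]) (pure 1 [a, b]) = pure 1 [c \<otimes>\<^bsub>A\<^esub> a, b]"
    using cup_pure[OF w] by (simp add: cup_word_def)
  show "cup 1 0 (pure 1 [a, b]) (pure 0 [c]) = pure 1 [a, b \<otimes>\<^bsub>A\<^esub> c]"
    using cup_pure[OF w(2,1)] by (simp add: cup_word_def)
qed

text \<open>The kernel of the multiplication map is a sub-bimodule, and it is closed under \<open>\<union>\<^sub>1\<close>.\<close>

lemma Omega_one_left:
  assumes "X \<in> carrier (T 0)" "w \<in> Omega_one"
  shows "cup 0 1 X w \<in> Omega_one"
proof -
  have w: "w \<in> carrier (T 1)" "mult_map R A w = \<zero>\<^bsub>A\<^esub>" using assms(2) by (simp_all add: Omega_one_eq)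
  have *: "cup 0 1 (pure 0 [c]) w \<in> Omega_one" if c: "c \<in> carrier A" for c
  proof -
    note C = bilinear_mapD(1)[OF cup_bilinear_0_1 pure_small_closed(1)[OF c]]
    have "mult_map R A (cup 0 1 (pure 0 [c]) w) = mult_map R A w \<otimes>\<^bsub>A\<^esub> c"
    proof (rule linear_T1_eqI[OF module_A linear_map_compose[OF C mult_map_linear]
          linear_map_compose[OF mult_map_linear linear_mult_right[OF c]] _ w(1)])
      fix a b assume "a \<in> carrier A" "b \<in> carrier A"
      then show "mult_map R A (cup 0 1 (pure 0 [c]) (pure 1 [a, b])) = mult_map R A (pure 1 [a, b]) \<otimes>\<^bsub>A\<^esub> c"
        using c by (simp only: cup_pure_0_1 mult_map_pure A.m_closed A.m_ac)
    qed
    then show ?thesis using linear_mapD(1)[OF C w(1)] w(2) c by (simp add: Omega_one_eq)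
  qed
  show ?thesis
    by (rule linear_T_intoI[OF T_module bilinear_mapD(2)[OF cup_bilinear_0_1 w(1)] submodule_Omega_one _ assms(1)])
      (elim words_1E, simp only: *)
qed

lemma Omega_one_right:
  assumes "X \<in> carrier (T 0)" "w \<in> Omega_one"
  shows "cup 1 0 w X \<in> Omega_one"
proof -
  have w: "w \<in> carrier (T 1)" "mult_map R A w = \<zero>\<^bsub>A\<^esub>" using assms(2) by (simp_all add: Omega_one_eq)
  have *: "cup 1 0 w (pure 0 [c]) \<in> Omega_one" if c: "c \<in> carrier A" for c
  proof -
    note C = bilinear_mapD(2)[OF cup_bilinear_1_0 pure_small_closed(1)[OF c]]
    have "mult_map R A (cup 1 0 w (pure 0 [c])) = mult_map R A w \<otimes>\<^bsub>A\<^esub> c"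
    proof (rule linear_T1_eqI[OF module_A linear_map_compose[OF C mult_map_linear]
          linear_map_compose[OF mult_map_linear linear_mult_right[OF c]] _ w(1)])
      fix a b assume "a \<in> carrier A" "b \<in> carrier A"
      then show "mult_map R A (cup 1 0 (pure 1 [a, b]) (pure 0 [c])) = mult_map R A (pure 1 [a, b]) \<otimes>\<^bsub>A\<^esub> c"
        using c by (simp only: cup_pure_0_1 mult_map_pure A.m_closed A.m_ac)
    qed
    then show ?thesis using linear_mapD(1)[OF C w(1)] w(2) c by (simp add: Omega_one_eq)
  qed
  show ?thesis
    by (rule linear_T_intoI[OF T_module bilinear_mapD(1)[OF cup_bilinear_1_0 w(1)] submodule_Omega_one _ assms(1)])
      (elim words_1E, simp only: *)
qed

lemma Omega_one_cup1:
  assumes "u \<in> Omega_one" "w \<in> Omega_one"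
  shows "cup1 1 1 u w \<in> Omega_one"
proof -
  have uw: "u \<in> carrier (T 1)" "w \<in> carrier (T 1)" "mult_map R A u = \<zero>\<^bsub>A\<^esub>" "mult_map R A w = \<zero>\<^bsub>A\<^esub>"
    using assms by (simp_all add: Omega_one_eq)
  note mcl = linear_mapD(1)[OF mult_map_linear]
  have "mult_map R A (cup1 1 1 u w) = mult_map R A u \<otimes>\<^bsub>A\<^esub> mult_map R A w"
  proof (rule bilinear_T1_eqI[OF module_A, where f="\<lambda>u w. mult_map R A (cup1 1 1 u w)"
        and g="\<lambda>u w. mult_map R A u \<otimes>\<^bsub>A\<^esub> mult_map R A w", OF _ _ _ uw(1,2)])
    show "bilinear_map R (T 1) (T 1) A (\<lambda>u w. mult_map R A (cup1 1 1 u w))"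
      unfolding bilinear_map_def
      by (intro conjI ballI linear_map_compose[OF _ mult_map_linear] bilinear_mapD[OF cup1_bilinear_1_1])
    show "bilinear_map R (T 1) (T 1) A (\<lambda>u w. mult_map R A u \<otimes>\<^bsub>A\<^esub> mult_map R A w)"
      unfolding bilinear_map_def
      by (intro conjI ballI linear_map_compose[OF mult_map_linear linear_mult_left]
          linear_map_compose[OF mult_map_linear linear_mult_right] mcl)
    fix a b x y assume "a \<in> carrier A" "b \<in> carrier A" "x \<in> carrier A" "y \<in> carrier A"
    then show "mult_map R A (cup1 1 1 (pure 1 [a, b]) (pure 1 [x, y]))
        = mult_map R A (pure 1 [a, b]) \<otimes>\<^bsub>A\<^esub> mult_map R A (pure 1 [x, y])"
      by (simp only: cup1_pure_1_1 mult_map_pure A.m_closed A.m_ac)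
  qed
  then show ?thesis
    using bilinear_map_closed[OF cup1_bilinear_1_1 uw(1,2)] uw(3,4) by (simp add: Omega_one_eq)
qed

lemma diff_0_in_Omega_one:
  assumes "X \<in> carrier (T 0)"
  shows "diff 0 X \<in> Omega_one"
proof (rule linear_T_intoI[OF T_module _ submodule_Omega_one _ assms])
  show lin: "linear_map R (T 0) (T 1) (diff 0)" using diff_linear[of 0] unfolding degree_sums .
  fix xs assume "xs \<in> words A (0 + 1)"
  then obtain a where a: "xs = [a]" "a \<in> carrier A" by (rule words_1E)
  note cl = pure_small_closed(2)[OF A.one_closed a(2)] pure_small_closed(2)[OF a(2) A.one_closed]
  have "mult_map R A (diff 0 (pure 0 xs)) = a \<ominus>\<^bsub>A\<^esub> a"
    unfolding a(1) diff_pure_0[OF a(2)] linear_map_minus[OF T_module module_A mult_map_linear cl]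
    using a(2) by (simp only: mult_map_pure A.one_closed A.l_one A.r_one)
  also have "\<dots> = \<zero>\<^bsub>A\<^esub>" using a(2) by (simp add: a_minus_def A.r_neg)
  finally show "diff 0 (pure 0 xs) \<in> Omega_one"
    using linear_mapD(1)[OF lin pure_small_closed(1)[OF a(2)]] a(1) by (simp add: Omega_one_eq)
qed

lemma form_prod_closed:
  "set ws \<subseteq> Omega_one \<Longrightarrow> form_prod R A ws \<in> carrier (T (length ws))"
proof (induction ws)
  case Nil
  then show ?case using unity_closed by simp
next
  case (Cons w ws)
  then have "w \<in> carrier (T 1)" "form_prod R A ws \<in> carrier (T (length ws))"
    using Omega_one_closed by simp_all
  from cup_closed[OF this] show ?case by simp
qed

lemma form_prod_single: "w \<in> Omega_one \<Longrightarrow> form_prod R A [w] = w"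
  using cup_unity[OF Omega_one_closed] by simp

lemma form_prod_append:
  "\<lbrakk>set us \<subseteq> Omega_one; set vs \<subseteq> Omega_one\<rbrakk> \<Longrightarrow>
    cup (length us) (length vs) (form_prod R A us) (form_prod R A vs) = form_prod R A (us @ vs)"
proof (induction us)
  case Nil
  then show ?case using unity_cup[OF form_prod_closed] by simp
next
  case (Cons w us)
  then have w: "w \<in> carrier (T 1)" and us: "set us \<subseteq> Omega_one" using Omega_one_closed by simp_all
  show ?case
    using cup_assoc[OF w form_prod_closed[OF us] form_prod_closed[OF Cons.prems(2)]] Cons.IH[OF us Cons.prems(2)]
    by simp
qed

text \<open>The span of the products of \<open>n\<close> elements of \<open>\<Omega>\<^sup>1(A)\<close>, which is the image of the \<open>n\<close>-fold tensor
  power of \<open>\<Omega>\<^sup>1(A)\<close> over \<open>A\<close> in \<open>T\<^sup>n(A)\<close> (\<open>Omega_incl_image\<close>).  It equals \<open>\<Omega>\<^sup>n(A)\<close> for \<open>n > 0\<close>, whereas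
  \<open>form_span 0\<close> is only \<open>R\<cdot>1\<close>.\<close>

definition form_span :: "nat \<Rightarrow> ('a list \<Rightarrow> 'r) set set"
  where "form_span n = submod_span R (T n) (form_prod R A ` words (Omega1 R A) n)"

lemma form_prods_subset: "form_prod R A ` words (Omega1 R A) n \<subseteq> carrier (T n)"
  using form_prod_closed by (auto simp: words_def)

lemma submodule_form_span: "submodule (form_span n) R (T n)"
  unfolding form_span_def by (rule submodule_span[OF T_module form_prods_subset])

lemma form_span_closed: "X \<in> form_span n \<Longrightarrow> X \<in> carrier (T n)"
  using module.submoduleE(1)[OF T_module submodule_form_span] by blast

lemma form_prod_in_span: "\<lbrakk>set ws \<subseteq> Omega_one; length ws = n\<rbrakk> \<Longrightarrow> form_prod R A ws \<in> form_span n"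
  unfolding form_span_def by (intro span_inc imageI) (simp add: words_def)

lemma linear_form_span_into:
  assumes "linear_map R (T n) (T m) f" "submodule H R (T m)"
    and "\<And>ws. \<lbrakk>set ws \<subseteq> Omega_one; length ws = n\<rbrakk> \<Longrightarrow> f (form_prod R A ws) \<in> H"
    and "X \<in> form_span n"
  shows "f X \<in> H"
  using assms(4) unfolding form_span_def
  by (rule linear_map_span_into[OF T_module T_module assms(1,2) form_prods_subset, rotated])
    (auto simp: words_def assms(3))

lemma form_span_1: "form_span 1 = Omega_one"
proof
  show "form_span 1 \<subseteq> Omega_one"
    unfolding form_span_def
  proof (rule span_minimal[OF _ submodule_Omega_one], clarify)
    fix ws assume "ws \<in> words (Omega1 R A) 1"
    then obtain w where "ws = [w]" "w \<in> Omega_one" by (auto simp: words_def length_Suc_conv)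
    then show "form_prod R A ws \<in> Omega_one" using form_prod_single by (simp del: form_prod.simps)
  qed
  show "Omega_one \<subseteq> form_span 1"
  proof
    fix w assume "w \<in> Omega_one"
    then show "w \<in> form_span 1"
      using form_prod_in_span[of "[w]" 1] form_prod_single by (simp del: form_prod.simps)
  qed
qed

lemma multilinear_form_prod: "multilinear R n (Omega1 R A) (T n) (form_prod R A)"
proof (rule multilinearI)
  show "form_prod R A ws \<in> carrier (T n)" if "ws \<in> words (Omega1 R A) n" for ws
    using that form_prod_closed by (auto simp: words_def)
  fix us vs assume *: "set us \<subseteq> Omega_one" "set vs \<subseteq> Omega_one" "length us + length vs + 1 = n"
  note us = form_prod_closed[OF *(1)] and vs = form_prod_closed[OF *(2)]
  have n: "length us + (1 + length vs) = n" using *(3) by simp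
  have eq: "form_prod R A (us @ [w] @ vs) =
      cup (length us) (1 + length vs) (form_prod R A us) (cup 1 (length vs) w (form_prod R A vs))"
    if "w \<in> Omega_one" for w
    using form_prod_append[OF *(1), of "w # vs"] that *(2) by simp
  have "linear_map R (T 1) (T n) (\<lambda>w. cup (length us) (1 + length vs) (form_prod R A us) (cup 1 (length vs) w (form_prod R A vs)))"
    using linear_map_compose[OF bilinear_mapD(2)[OF cup_bilinear vs, of 1] bilinear_mapD(1)[OF cup_bilinear us]]
    unfolding n .
  note lin = linear_mapD[OF this]
  show "linear_map R (Omega1 R A) (T n) (\<lambda>w. form_prod R A (us @ [w] @ vs))"
  proof (rule linear_mapI)
    fix x assume x: "x \<in> Omega_one"
    show "form_prod R A (us @ [x] @ vs) \<in> carrier (T n)"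
      unfolding eq[OF x] by (rule lin(1)[OF Omega_one_closed[OF x]])
    show "form_prod R A (us @ [x \<oplus>\<^bsub>Omega1 R A\<^esub> y] @ vs)
        = form_prod R A (us @ [x] @ vs) \<oplus>\<^bsub>T n\<^esub> form_prod R A (us @ [y] @ vs)" if y: "y \<in> Omega_one" for y
    proof -
      have "x \<oplus>\<^bsub>T 1\<^esub> y \<in> Omega_one" by (rule module.submoduleE(5)[OF T_module submodule_Omega_one x y])
      then show ?thesis
        using eq[OF x] eq[OF y] eq[of "x \<oplus>\<^bsub>T 1\<^esub> y"] lin(2)[OF Omega_one_closed[OF x] Omega_one_closed[OF y]]
        by (simp only: Omega1_ops)
    qed
    show "form_prod R A (us @ [r \<odot>\<^bsub>Omega1 R A\<^esub> x] @ vs) = r \<odot>\<^bsub>T n\<^esub> form_prod R A (us @ [x] @ vs)"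
      if r: "r \<in> carrier R" for r
    proof -
      have "r \<odot>\<^bsub>T 1\<^esub> x \<in> Omega_one" by (rule module.submoduleE(4)[OF T_module submodule_Omega_one r x])
      then show ?thesis
        using eq[OF x] eq[of "r \<odot>\<^bsub>T 1\<^esub> x"] lin(3)[OF r Omega_one_closed[OF x]]
        by (simp only: Omega1_ops)
    qed
  qed
qed

lemma form_prod_balanced:
  assumes "set us \<subseteq> Omega_one" "set vs \<subseteq> Omega_one" "m \<in> Omega_one" "m' \<in> Omega_one" "a \<in> carrier A"
  shows "form_prod R A (us @ [cup 1 0 m (pure 0 [a]), m'] @ vs) = form_prod R A (us @ [m, cup 0 1 (pure 0 [a]) m'] @ vs)"
proof -
  note a = pure_small_closed(1)[OF assms(5)]
  note vs = form_prod_closed[OF assms(2)]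
  note m = Omega_one_closed[OF assms(3)] and m' = Omega_one_closed[OF assms(4)]
  have F: "cup 1 (length vs) m' (form_prod R A vs) \<in> carrier (T (1 + length vs))"
    by (rule cup_closed[OF m' vs])
  have "form_prod R A ([cup 1 0 m (pure 0 [a]), m'] @ vs) = form_prod R A ([m, cup 0 1 (pure 0 [a]) m'] @ vs)"
    using cup_assoc[OF m a F] cup_assoc[OF a m' vs] by simp
  moreover have "set ([cup 1 0 m (pure 0 [a]), m'] @ vs) \<subseteq> Omega_one"
    "set ([m, cup 0 1 (pure 0 [a]) m'] @ vs) \<subseteq> Omega_one"
    using assms Omega_one_left[OF a assms(4)] Omega_one_right[OF a assms(3)] by simp_all
  ultimately show ?thesis
    using form_prod_append[OF assms(1), of "[cup 1 0 m (pure 0 [a]), m'] @ vs"]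
      form_prod_append[OF assms(1), of "[m, cup 0 1 (pure 0 [a]) m'] @ vs"]
    by (simp del: form_prod.simps)
qed

lemma Omega_incl_image: "Omega_incl R A n ` carrier (Omega1_power R A n) = form_span n"
proof -
  let ?lact = "\<lambda>a w. cup 0 1 (pure 0 [a]) w" and ?ract = "\<lambda>w a. cup 1 0 w (pure 0 [a])"
  let ?Z = "multilinear_rels R n (Omega1 R A) \<union> balanced_rels R (carrier A) ?lact ?ract n (Omega1 R A)"
  have l: "?lact a m \<in> Omega_one" and r: "?ract m a \<in> Omega_one" if "m \<in> Omega_one" "a \<in> carrier A" for m a
    using Omega_one_left[OF pure_small_closed(1)[OF that(2)] that(1)]
      Omega_one_right[OF pure_small_closed(1)[OF that(2)] that(1)] .
  have Z: "?Z \<subseteq> carrier (free_words R n (Omega1 R A))"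
    by (intro Un_least multilinear_rels_subset[OF module_Omega1] balanced_rels_subset[OF module_Omega1] l r)
  have kills: "free_ext R (T n) (form_prod R A) z = \<zero>\<^bsub>T n\<^esub>" if "z \<in> ?Z" for z
    using that
  proof
    assume "z \<in> multilinear_rels R n (Omega1 R A)"
    then show ?thesis by (rule multilinear_kills_rels[OF module_Omega1 T_module multilinear_form_prod])
  next
    assume "z \<in> balanced_rels R (carrier A) ?lact ?ract n (Omega1 R A)"
    then show ?thesis
      by (rule multilinear_kills_balanced[OF module_Omega1 T_module multilinear_form_prod])
        (rule l r form_prod_balanced; assumption)+
  qed
  show ?thesis
    unfolding Omega_incl_def Omega1_power_def bimod_tensor_power_def form_span_def
    by (rule quot_ext_image_carrier[OF R.is_cring Z T_module multilinear_Pi[OF module_Omega1 T_module multilinear_form_prod] kills])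
qed

lemma form_span_cup:
  assumes "X \<in> form_span p" "Y \<in> form_span q"
  shows "cup p q X Y \<in> form_span (p + q)"
proof (rule linear_form_span_into[OF _ submodule_form_span _ assms(1), where f="\<lambda>X. cup p q X Y"])
  show "linear_map R (T p) (T (p + q)) (\<lambda>X. cup p q X Y)"
    by (rule bilinear_mapD(2)[OF cup_bilinear form_span_closed[OF assms(2)]])
  fix us assume us: "set us \<subseteq> Omega_one" "length us = p"
  show "cup p q (form_prod R A us) Y \<in> form_span (p + q)"
  proof (rule linear_form_span_into[OF _ submodule_form_span _ assms(2)])
    show "linear_map R (T q) (T (p + q)) (cup p q (form_prod R A us))"
      using bilinear_mapD(1)[OF cup_bilinear form_prod_closed[OF us(1)]] us(2) by simp
    fix vs assume vs: "set vs \<subseteq> Omega_one" "length vs = q"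
    show "cup p q (form_prod R A us) (form_prod R A vs) \<in> form_span (p + q)"
      using form_prod_append[OF us(1) vs(1)] form_prod_in_span[of "us @ vs"] us vs by simp
  qed
qed

lemma form_span_left:
  assumes "X \<in> carrier (T 0)" "Y \<in> form_span q" "0 < q"
  shows "cup 0 q X Y \<in> form_span q"
proof (rule linear_form_span_into[OF _ submodule_form_span _ assms(2)])
  show "linear_map R (T q) (T q) (cup 0 q X)"
    using bilinear_mapD(1)[OF cup_bilinear assms(1), of q] by simp
  fix vs assume vs: "set vs \<subseteq> Omega_one" "length vs = q"
  then obtain w ws where w: "vs = w # ws" "w \<in> Omega_one" "set ws \<subseteq> Omega_one" "q = 1 + length ws"
    using assms(3) by (cases vs) auto
  have "cup 0 q X (form_prod R A vs) = form_prod R A (cup 0 1 X w # ws)"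
    using cup_assoc[OF assms(1) Omega_one_closed[OF w(2)] form_prod_closed[OF w(3)]] w(1,4) by simp
  then show "cup 0 q X (form_prod R A vs) \<in> form_span q"
    using form_prod_in_span[of "cup 0 1 X w # ws"] Omega_one_left[OF assms(1) w(2)] w(3,4) by simp
qed

lemma form_span_right:
  assumes "X \<in> carrier (T 0)" "Y \<in> form_span q" "0 < q"
  shows "cup q 0 Y X \<in> form_span q"
proof (rule linear_form_span_into[OF _ submodule_form_span _ assms(2), where f="\<lambda>Y. cup q 0 Y X"])
  show "linear_map R (T q) (T q) (\<lambda>Y. cup q 0 Y X)"
    using bilinear_mapD(2)[OF cup_bilinear assms(1), of q] by simp
  fix vs assume vs: "set vs \<subseteq> Omega_one" "length vs = q"
  then obtain w ws where w: "vs = ws @ [w]" "w \<in> Omega_one" "set ws \<subseteq> Omega_one" "q = length ws + 1"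
    using assms(3) by (cases vs rule: rev_cases) auto
  have wX: "cup 1 0 w X \<in> Omega_one" by (rule Omega_one_right[OF assms(1) w(2)])
  have "form_prod R A vs = cup (length ws) 1 (form_prod R A ws) w"
    using form_prod_append[OF w(3), of "[w]"] form_prod_single[OF w(2)] w(1,2) by simp
  moreover have "form_prod R A (ws @ [cup 1 0 w X]) = cup (length ws) 1 (form_prod R A ws) (cup 1 0 w X)"
    using form_prod_append[OF w(3), of "[cup 1 0 w X]"] form_prod_single[OF wX] wX by simp
  ultimately have "cup q 0 (form_prod R A vs) X = form_prod R A (ws @ [cup 1 0 w X])"
    using cup_assoc[OF form_prod_closed[OF w(3)] Omega_one_closed[OF w(2)] assms(1)] w(4) by simp
  then show "cup q 0 (form_prod R A vs) X \<in> form_span q"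
    using form_prod_in_span[of "ws @ [cup 1 0 w X]"] wX w(3,4) by simp
qed

text \<open>An element \<open>w\<close> of \<open>\<Omega>\<^sup>1(A)\<close> is fixed by \<open>a \<otimes> b \<mapsto> a \<otimes> b - ab \<otimes> 1 = a db\<close>, and
  \<open>d(a db) = da db\<close>.\<close>

lemma diff_Omega_one:
  assumes "w \<in> Omega_one"
  shows "diff 1 w \<in> form_span 2"
proof -
  \<comment> \<open>The projection \<open>a \<otimes> b \<mapsto> a \<otimes> b - ab \<otimes> 1\<close>, whose correction term vanishes on \<open>\<Omega>\<^sup>1(A)\<close>.\<close>
  define h where "h X = X \<ominus>\<^bsub>T 1\<^esub> pure 1 [mult_map R A X, \<one>\<^bsub>A\<^esub>]" for X
  have lin1: "linear_map R A (T 1) (\<lambda>a. pure 1 [a, \<one>\<^bsub>A\<^esub>])"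
    using multilinearD(2)[OF multilinear_pure[of 1], of "[]" "[\<one>\<^bsub>A\<^esub>]"] by simp
  have lin: "linear_map R (T 1) (T 1) h"
    unfolding h_def
    by (rule linear_map_diff[OF T_module linear_map_id linear_map_compose[OF mult_map_linear lin1]])
  have w: "w \<in> carrier (T 1)" "mult_map R A w = \<zero>\<^bsub>A\<^esub>" using assms by (simp_all add: Omega_one_eq)
  have "h w = w"
    unfolding h_def w(2) linear_map_zero[OF module_A T_module lin1] using w(1) by (simp add: a_minus_def)
  moreover have "diff 1 (h w) \<in> form_span 2"
  proof (rule linear_T_intoI[OF T_module linear_map_compose[OF lin diff_linear_1] submodule_form_span _ w(1)])
    fix xs assume "xs \<in> words A (1 + 1)"
    then obtain a b where xs: "xs = [a, b]" "a \<in> carrier A" "b \<in> carrier A" by (rule words_2E)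
    note a = pure_small_closed(1)[OF xs(2)] and b = pure_small_closed(1)[OF xs(3)]
    note db = diff_0_in_Omega_one[OF b] and da = diff_0_in_Omega_one[OF a]
    have "cup 0 1 (pure 0 [a]) (diff 0 (pure 0 [b])) =
        cup 0 1 (pure 0 [a]) (pure 1 [\<one>\<^bsub>A\<^esub>, b]) \<ominus>\<^bsub>T 1\<^esub> cup 0 1 (pure 0 [a]) (pure 1 [b, \<one>\<^bsub>A\<^esub>])"
      unfolding diff_pure_0[OF xs(3)]
      by (rule linear_map_minus[OF T_module T_module bilinear_mapD(1)[OF cup_bilinear_0_1 a]])
        (intro pure_small_closed xs A.one_closed)+
    also have "\<dots> = h (pure 1 xs)"
      unfolding h_def xs(1) using xs(2,3) by (simp only: cup_pure_0_1 mult_map_pure A.one_closed A.r_one)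
    finally have "diff 1 (h (pure 1 xs)) = diff (0 + 1) (cup 0 1 (pure 0 [a]) (diff 0 (pure 0 [b])))"
      by simp
    also have "\<dots> = cup 1 1 (diff 0 (pure 0 [a])) (diff 0 (pure 0 [b])) \<oplus>\<^bsub>T 2\<^esub>
        sgn_pow R 0 \<odot>\<^bsub>T 2\<^esub> cup 0 2 (pure 0 [a]) \<zero>\<^bsub>T 2\<^esub>"
      using leibniz[OF a Omega_one_closed[OF db]] unfolding degree_sums diff_diff_pure_0[OF xs(3)] .
    also have "cup 0 2 (pure 0 [a]) \<zero>\<^bsub>T 2\<^esub> = \<zero>\<^bsub>T 2\<^esub>"
      using linear_map_zero[OF T_module T_module bilinear_mapD(1)[OF cup_bilinear a, of 2]]
      unfolding degree_sums .
    also have "cup 1 1 (diff 0 (pure 0 [a])) (diff 0 (pure 0 [b])) \<oplus>\<^bsub>T 2\<^esub> sgn_pow R 0 \<odot>\<^bsub>T 2\<^esub> \<zero>\<^bsub>T 2\<^esub>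
        = cup 1 1 (diff 0 (pure 0 [a])) (diff 0 (pure 0 [b]))"
      using bilinear_map_closed[OF cup_bilinear_1_1 Omega_one_closed[OF da] Omega_one_closed[OF db]] by simp
    finally show "diff 1 (h (pure 1 xs)) \<in> form_span 2"
      using form_span_cup[of "diff 0 (pure 0 [a])" 1 "diff 0 (pure 0 [b])" 1] da db
      unfolding form_span_1 degree_sums by simp
  qed
  ultimately show ?thesis by simp
qed

lemma diff_form_prod:
  "set ws \<subseteq> Omega_one \<Longrightarrow> diff (length ws) (form_prod R A ws) \<in> form_span (length ws + 1)"
proof (induction ws)
  case Nil
  show ?case using diff_0_in_Omega_one[OF unity_closed] form_span_1 by simp
next
  case (Cons w ws)
  let ?n = "length ws"
  have n: "1 + ?n + 1 = 2 + ?n" "1 + (?n + 1) = 2 + ?n" by simp_all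
  have w: "w \<in> Omega_one" and ws: "set ws \<subseteq> Omega_one" using Cons.prems by simp_all
  have 1: "cup 2 ?n (diff 1 w) (form_prod R A ws) \<in> form_span (2 + ?n)"
    by (rule form_span_cup[OF diff_Omega_one[OF w] form_prod_in_span[OF ws refl]])
  have 2: "cup 1 (?n + 1) w (diff ?n (form_prod R A ws)) \<in> form_span (2 + ?n)"
    using form_span_cup[OF _ Cons.IH[OF ws], of w 1] w unfolding form_span_1 n by simp
  have "diff (1 + ?n) (cup 1 ?n w (form_prod R A ws)) \<in> form_span (2 + ?n)"
    unfolding leibniz[OF Omega_one_closed[OF w] form_prod_closed[OF ws]] n degree_sums
    by (intro module.submoduleE(5)[OF T_module submodule_form_span]
        module.submoduleE(4)[OF T_module submodule_form_span] sgn_pow_closed 1 2)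
  then show ?case by simp
qed

lemma diff_form_span:
  assumes "X \<in> form_span n"
  shows "diff n X \<in> form_span (n + 1)"
  by (rule linear_form_span_into[OF diff_linear submodule_form_span _ assms])
    (use diff_form_prod in auto)

lemma form_prod_pair: "\<lbrakk>u \<in> Omega_one; v \<in> Omega_one\<rbrakk> \<Longrightarrow> form_prod R A [u, v] = cup 1 1 u v"
  using form_prod_single[of v] by simp

lemma form_words_2E:
  assumes "set ws \<subseteq> Omega_one" "length ws = 2"
  obtains u v where "ws = [u, v]" "u \<in> Omega_one" "v \<in> Omega_one"
proof -
  from assms(2) obtain u v where ws: "ws = [u, v]" by (auto simp: numeral_2_eq_2 length_Suc_conv)
  from assms(1) have "u \<in> Omega_one" "v \<in> Omega_one" unfolding ws by simp_all
  with ws show thesis by (rule that)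
qed

lemma cup1_form_span_2:
  assumes "X \<in> form_span 2" "z \<in> Omega_one"
  shows "cup1 2 1 X z \<in> form_span 2"
proof (rule linear_form_span_into[OF _ submodule_form_span _ assms(1), where f="\<lambda>X. cup1 2 1 X z"])
  note z = Omega_one_closed[OF assms(2)]
  show "linear_map R (T 2) (T 2) (\<lambda>X. cup1 2 1 X z)"
    by (rule bilinear_mapD(2)[OF cup1_bilinear_2_1 z])
  fix ws assume ws: "set ws \<subseteq> Omega_one" "length ws = 2"
  then obtain u v where uv: "ws = [u, v]" "u \<in> Omega_one" "v \<in> Omega_one" by (rule form_words_2E)
  have in2: "cup 1 1 x y \<in> form_span 2" if "x \<in> Omega_one" "y \<in> Omega_one" for x y
    using form_span_cup[of x 1 y 1] that unfolding form_span_1 degree_sums by simp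
  show "cup1 2 1 (form_prod R A ws) z \<in> form_span 2"
    unfolding uv(1) form_prod_pair[OF uv(2,3)]
      hirsch[OF Omega_one_closed[OF uv(2)] Omega_one_closed[OF uv(3)] z]
    by (intro module.submoduleE(5)[OF T_module submodule_form_span] in2 Omega_one_cup1 uv assms(2))
qed

lemma T_circ_form_span_2:
  assumes "X \<in> form_span 2" "Y \<in> form_span 2"
  shows "T_circ 2 X Y \<in> form_span 2"
proof (rule linear_form_span_into[OF _ submodule_form_span _ assms(1), where f="\<lambda>X. T_circ 2 X Y"])
  show "linear_map R (T 2) (T 2) (\<lambda>X. T_circ 2 X Y)"
    by (rule bilinear_mapD(2)[OF T_circ_bilinear form_span_closed[OF assms(2)]])
  fix ws assume ws: "set ws \<subseteq> Omega_one" "length ws = 2"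
  then obtain u v where uv: "ws = [u, v]" "u \<in> Omega_one" "v \<in> Omega_one" by (rule form_words_2E)
  show "T_circ 2 (form_prod R A ws) Y \<in> form_span 2"
  proof (rule linear_form_span_into[OF _ submodule_form_span _ assms(2)])
    show "linear_map R (T 2) (T 2) (T_circ 2 (form_prod R A ws))"
      using bilinear_mapD(1)[OF T_circ_bilinear] form_prod_closed[OF ws(1)] ws(2) by simp
    fix ws' assume ws': "set ws' \<subseteq> Omega_one" "length ws' = 2"
    then obtain x y where xy: "ws' = [x, y]" "x \<in> Omega_one" "y \<in> Omega_one" by (rule form_words_2E)
    have "T_circ 2 (form_prod R A ws) (form_prod R A ws') = cup 1 1 (cup1 1 1 u x) (cup1 1 1 v y)"
      unfolding uv(1) xy(1) form_prod_pair[OF uv(2,3)] form_prod_pair[OF xy(2,3)]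
      by (intro T_circ_cup Omega_one_closed uv xy)
    then show "T_circ 2 (form_prod R A ws) (form_prod R A ws') \<in> form_span 2"
      using form_span_cup[of "cup1 1 1 u x" 1 "cup1 1 1 v y" 1] Omega_one_cup1 uv xy
      unfolding form_span_1 degree_sums by simp
  qed
qed

section \<open>The cup-one dga of differential forms\<close>

abbreviation "Om \<equiv> Omega R A"

lemma carrier_Omega: "carrier (Om n) = (if n = 0 then carrier (T 0) else form_span n)"
  by (simp add: Omega_def Omega_incl_image)

lemma carrier_Omega_0: "carrier (Om 0) = carrier (T 0)"
  by (simp add: carrier_Omega)

lemma carrier_Omega_1: "carrier (Om 1) = Omega_one"
  using form_span_1 by (simp add: carrier_Omega)

lemma carrier_Omega_2: "carrier (Om 2) = form_span 2"
  by (simp add: carrier_Omega)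

lemma submodule_Omega: "submodule (carrier (Om n)) R (T n)"
  using submodule_form_span[of n] T.carrier_is_submodule[of 0] by (simp add: carrier_Omega)

lemma Omega_closed: "X \<in> carrier (Om n) \<Longrightarrow> X \<in> carrier (T n)"
  using T.submoduleE(1)[OF submodule_Omega] by blast

lemma Omega_subset: "carrier (Om n) \<subseteq> carrier (T n)"
  using Omega_closed by blast

lemma Omega_update: "(T n)\<lparr>carrier := carrier (Om n)\<rparr> = Om n"
  by (simp add: Omega_def)

lemma Omega_ops: "add (Om n) = add (T n)" "smult (Om n) = smult (T n)" "zero (Om n) = zero (T n)"
  by (simp_all add: Omega_def)

lemma module_Omega: "module R (Om n)"
  using submodule.submodule_is_module[OF submodule_Omega[of n] T_module] unfolding Omega_update .

lemma Omega_a_inv: "X \<in> carrier (Om n) \<Longrightarrow> \<ominus>\<^bsub>Om n\<^esub> X = \<ominus>\<^bsub>T n\<^esub> X"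
  using submodule_a_inv[OF T_module submodule_Omega[of n]] unfolding Omega_update .

lemma Omega_cup:
  assumes "X \<in> carrier (Om p)" "Y \<in> carrier (Om q)"
  shows "cup p q X Y \<in> carrier (Om (p + q))"
proof (cases "p = 0")
  case p: True
  show ?thesis
  proof (cases "q = 0")
    case True
    then show ?thesis using p assms cup_closed[of X 0 Y 0] by (simp add: carrier_Omega)
  next
    case False
    then show ?thesis using p assms form_span_left[of X Y q] by (simp add: carrier_Omega)
  qed
next
  case p: False
  show ?thesis
  proof (cases "q = 0")
    case True
    then show ?thesis using p assms form_span_right[of Y X p] by (simp add: carrier_Omega)
  next
    case False
    then show ?thesis using p assms form_span_cup[of X p Y q] by (simp add: carrier_Omega)
  qed
qed

lemma Omega_diff:
  assumes "X \<in> carrier (Om n)"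
  shows "diff n X \<in> carrier (Om (n + 1))"
proof (cases "n = 0")
  case True
  then show ?thesis
    using assms diff_0_in_Omega_one[of X] form_span_1 by (simp add: carrier_Omega)
next
  case False
  then show ?thesis using assms diff_form_span[of X n] by (simp add: carrier_Omega)
qed

lemma Omega_cup_bilinear: "bilinear_map R (Om p) (Om q) (Om (p + q)) (cup p q)"
  using bilinear_map_restrict[OF cup_bilinear Omega_subset Omega_subset Omega_cup]
  unfolding Omega_update .

lemma Omega_diff_linear: "linear_map R (Om n) (Om (n + 1)) (diff n)"
  using linear_map_restrict[OF diff_linear Omega_subset Omega_diff] unfolding Omega_update .

lemma Omega_cup1_bilinear:
  "bilinear_map R (Om 1) (Om 1) (Om 1) (cup1 1 1)"
  "bilinear_map R (Om 2) (Om 1) (Om 2) (cup1 2 1)"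
proof -
  have "cup1 1 1 X Y \<in> carrier (Om 1)" if "X \<in> carrier (Om 1)" "Y \<in> carrier (Om 1)" for X Y
    using that unfolding carrier_Omega_1 by (rule Omega_one_cup1)
  from bilinear_map_restrict[OF cup1_bilinear_1_1 Omega_subset Omega_subset this]
  show "bilinear_map R (Om 1) (Om 1) (Om 1) (cup1 1 1)" unfolding Omega_update .
  have "cup1 2 1 X Y \<in> carrier (Om 2)" if "X \<in> carrier (Om 2)" "Y \<in> carrier (Om 1)" for X Y
    using that unfolding carrier_Omega_1 carrier_Omega_2 by (rule cup1_form_span_2)
  from bilinear_map_restrict[OF cup1_bilinear_2_1 Omega_subset Omega_subset this]
  show "bilinear_map R (Om 2) (Om 1) (Om 2) (cup1 2 1)" unfolding Omega_update .
qed

text \<open>Every \<open>2\<close>-form is a sum of products of \<open>1\<close>-forms, so \<open>D\<^sup>2(\<Omega>\<^sup>*(A)) = \<Omega>\<^sup>2(A)\<close>.\<close>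

lemma decomposables2_Omega: "decomposables2 R Om cup = Om 2"
proof -
  let ?S = "{cup 1 1 a b | a b. a \<in> carrier (Om 1) \<and> b \<in> carrier (Om 1)}"
  have cup2: "cup 1 1 a b \<in> carrier (Om 2)" if "a \<in> carrier (Om 1)" "b \<in> carrier (Om 1)" for a b
    using Omega_cup[OF that] unfolding degree_sums .
  have S: "?S \<subseteq> carrier (Om 2)" using cup2 by blast
  have "submodule (submod_span R (Om 2) ?S) R ((T 2)\<lparr>carrier := carrier (Om 2)\<rparr>)"
    unfolding Omega_update by (rule submodule_span[OF module_Omega S])
  then have sub: "submodule (submod_span R (Om 2) ?S) R (T 2)"
    by (rule submodule_trans[OF T_module submodule_Omega])
  have "form_span 2 \<subseteq> submod_span R (Om 2) ?S"
    unfolding form_span_def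
  proof (rule span_minimal[OF _ sub], clarify)
    fix ws assume "ws \<in> words (Omega1 R A) 2"
    then have "set ws \<subseteq> Omega_one" "length ws = 2" by (simp_all add: words_def)
    then obtain u v where uv: "ws = [u, v]" "u \<in> Omega_one" "v \<in> Omega_one" by (rule form_words_2E)
    then have "cup 1 1 u v \<in> ?S" unfolding carrier_Omega_1 by blast
    then show "form_prod R A ws \<in> submod_span R (Om 2) ?S"
      unfolding uv(1) form_prod_pair[OF uv(2,3)] by (rule span_inc)
  qed
  then have "submod_span R (Om 2) ?S = carrier (Om 2)"
    using span_subset_carrier[OF module_Omega S] unfolding carrier_Omega_2 by blast
  then show ?thesis by (simp add: decomposables2_def)
qed

theorem cup1_dg_algebra_Omega:
  assumes "inj_on (\<lambda>r. r \<odot>\<^bsub>A\<^esub> \<one>\<^bsub>A\<^esub>) (carrier R)"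
  shows "cup1_dg_algebra R Om cup unity diff (\<lambda>p. cup1 p 1)"
proof -
  have ga: "graded_algebra R Om cup unity"
  proof (rule graded_algebra.intro[OF R.is_cring], rule graded_algebra_axioms.intro)
    show "module R (Om n)" for n by (rule module_Omega)
    show "bilinear_map R (Om p) (Om q) (Om (p + q)) (cup p q)" for p q by (rule Omega_cup_bilinear)
    show "cup (p + q) s (cup p q a b) c = cup p (q + s) a (cup q s b c)"
      if "a \<in> carrier (Om p)" "b \<in> carrier (Om q)" "c \<in> carrier (Om s)" for a p b q c s
      by (intro cup_assoc Omega_closed that)
    show "unity \<in> carrier (Om 0)" unfolding carrier_Omega_0 by (rule unity_closed)
    show "cup 0 p unity a = a" if "a \<in> carrier (Om p)" for a p
      by (intro unity_cup Omega_closed that)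
    show "cup p 0 a unity = a" if "a \<in> carrier (Om p)" for a p
      by (intro cup_unity Omega_closed that)
    show "inj_on (\<lambda>r. r \<odot>\<^bsub>Om 0\<^esub> unity) (carrier R)"
      unfolding Omega_ops by (rule structure_map_inj[OF assms])
  qed
  have dga: "dg_algebra R Om cup unity diff"
  proof (rule dg_algebra.intro[OF ga], rule dg_algebra_axioms.intro)
    show "linear_map R (Om n) (Om (n + 1)) (diff n)" for n by (rule Omega_diff_linear)
    show "diff (n + 1) (diff n a) = \<zero>\<^bsub>Om (n + 2)\<^esub>" if "a \<in> carrier (Om n)" for a n
      unfolding Omega_ops by (intro diff_diff Omega_closed that)
    show "diff (p + q) (cup p q a b) = cup (p + 1) q (diff p a) b \<oplus>\<^bsub>Om (p + q + 1)\<^esub>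
        sgn_pow R p \<odot>\<^bsub>Om (p + q + 1)\<^esub> cup p (q + 1) a (diff q b)"
      if "a \<in> carrier (Om p)" "b \<in> carrier (Om q)" for a p b q
      unfolding Omega_ops by (intro leibniz Omega_closed that)
  qed
  have c1a: "cup1_algebra R Om cup unity (\<lambda>p. cup1 p 1)"
  proof (rule cup1_algebra.intro[OF ga], rule cup1_algebra_axioms.intro)
    show "bilinear_map R (Om p) (Om 1) (Om p) (cup1 p 1)" if "p \<in> {1, 2}" for p
      using that Omega_cup1_bilinear by auto
    show "cup1 2 1 (cup 1 1 a b) c = cup 1 1 a (cup1 1 1 b c) \<oplus>\<^bsub>Om 2\<^esub> cup 1 1 (cup1 1 1 a c) b"
      if "a \<in> carrier (Om 1)" "b \<in> carrier (Om 1)" "c \<in> carrier (Om 1)" for a b c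
      unfolding Omega_ops by (intro hirsch Omega_closed that)
    show "cring (cup1_extension R (Om 1) (cup1 1 1))"
      by (rule cring_cup1_extension[OF module_Omega Omega_cup1_bilinear(1)])
        (intro cup1_assoc cup1_comm Omega_closed; assumption)+
  qed
  have circ: "bilinear_map R (Om 2) (Om 2) (Om 2) (T_circ 2)"
  proof -
    have "T_circ 2 X Y \<in> carrier (Om 2)" if "X \<in> carrier (Om 2)" "Y \<in> carrier (Om 2)" for X Y
      using that unfolding carrier_Omega_2 by (rule T_circ_form_span_2)
    from bilinear_map_restrict[OF T_circ_bilinear Omega_subset Omega_subset this]
    show ?thesis unfolding Omega_update .
  qed
  have d_formula: "diff 1 (cup1 1 1 a b) =
      \<ominus>\<^bsub>Om 2\<^esub> cup 1 1 a b \<ominus>\<^bsub>Om 2\<^esub> cup 1 1 b a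
      \<oplus>\<^bsub>Om 2\<^esub> cup1 2 1 (diff 1 a) b \<oplus>\<^bsub>Om 2\<^esub> cup1 2 1 (diff 1 b) a
      \<ominus>\<^bsub>Om 2\<^esub> T_circ 2 (diff 1 a) (diff 1 b)"
    if a: "a \<in> carrier (Om 1)" and b: "b \<in> carrier (Om 1)" for a b
  proof -
    have d: "diff 1 X \<in> carrier (Om 2)" if "X \<in> carrier (Om 1)" for X
      using Omega_diff[OF that] unfolding degree_sums .
    have c: "cup 1 1 X Y \<in> carrier (Om 2)" if "X \<in> carrier (Om 1)" "Y \<in> carrier (Om 1)" for X Y
      using Omega_cup[OF that] unfolding degree_sums .
    show ?thesis
      unfolding a_minus_def Omega_ops Omega_a_inv[OF c[OF a b]] Omega_a_inv[OF c[OF b a]]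
        Omega_a_inv[OF bilinear_map_closed[OF circ d[OF a] d[OF b]]]
      by (rule diff_cup1[unfolded a_minus_def, OF Omega_closed[OF a] Omega_closed[OF b]])
  qed
  show ?thesis
  proof (rule cup1_dg_algebra.intro[OF dga c1a], rule cup1_dg_algebra_axioms.intro, unfold decomposables2_Omega,
      intro exI[of _ "T_circ 2"] conjI ballI impI)
    show "bilinear_map R (Om 2) (Om 2) (Om 2) (T_circ 2)" by (rule circ)
    show "T_circ 2 (cup 1 1 u v) (cup 1 1 w z) = cup 1 1 (cup1 1 1 u w) (cup1 1 1 v z)"
      if "u \<in> carrier (Om 1)" "v \<in> carrier (Om 1)" "w \<in> carrier (Om 1)" "z \<in> carrier (Om 1)" for u v w z
      by (intro T_circ_cup Omega_closed that)
  qed (rule d_formula)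
qed

end

theorem theorem5p3:
  fixes R :: "('r, 'm) ring_scheme" and A :: "('r, 'a, 'n) module_scheme"
  assumes "algebra R A"
    and "inj_on (\<lambda>r. r \<odot>\<^bsub>A\<^esub> \<one>\<^bsub>A\<^esub>) (carrier R)"
  shows "cup1_dg_algebra R (Omega R A) (TA_cup R A) (TA_unity R A) (TA_diff R A)
    (\<lambda>p. TA_cup1 R A p 1)"
proof -
  interpret algebra_tensors R A by (rule algebra_tensors.intro) (rule assms(1))
  show ?thesis by (rule cup1_dg_algebra_Omega) (rule assms(2))
qed

end
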